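(* Let $\{Y_n;n\ge1\}$ be a sequence of independent and identically distributed random variables in a sub-linear expectation space $(\Omega,\mathscr H,\widehat{\mathbb E})$, let $\mathbb V$ be a sub-additive capacity on $\mathcal F$ satisfying the compatibility property (C), and let $\widehat{\mathbb V}^*$ be the countably sub-additive extension of $\widehat{\mathbb V}$. Denote $\overline\sigma^2=\breve{\mathbb E}[Y_1^2]$ (finite or infinite). Consider the conditions $$\text{(1)}\quad C_{\mathbb V}\left[\frac{Y_1^2}{\log\log|Y_1|}\right]<\infty,\qquad \text{(2)}\quad \breve{\mathbb E}[Y_1]=\breve{\mathbb E}[-Y_1]=0,\qquad\text{(3)}\quad \overline\sigma^2=\lim_{c\to\infty}\widehat{\mathbb E}[Y_1^2\wedge c]<\infty .$$ (a) Suppose (1) and (2) hold. Then $$\widehat{\mathbb V}^*\left(\limsup_{n\to\infty}\frac{|\sum_{i=1}^nY_i|}{\sqrt{2n\log\log n}}>\overline\sigma\right)=0,$$ $$\lim_{n\to\infty}\max_N\mathbb V\left(\sigma_1\le\sup_{n\le m\le N}\frac{\sum_{i=1}^mY_i}{\sqrt{2m\log\log m}}\le\sigma_2\right)=1\quad\text{for all }\sigma_1<\overline\sigma<\sigma_2 .$$ (b) Suppose that there exist $n_0$ and $M$ such that $$\lim_{N\to\infty}\mathbb V\left(\sup_{n\le m\le N}\frac{|\sum_{i=1}^mY_i|}{\sqrt{2m\log\log m}}\ge M\right)<1\quad\text{for all }n\ge n_0 .$$ Then (1), (2) and (3) hold.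
   Context: Sub-linear expectation space: $(\Omega,\mathcal F)$ is a measurable space and $\mathscr H$ is a linear space of real measurable functions on it such that $\varphi(X_1,\dots,X_n)\in\mathscr H$ whenever $X_1,\dots,X_n\in\mathscr H$ and $\varphi\in C_{l,Lip}(\mathbb R^n)$, where $C_{l,Lip}(\mathbb R^n)$ is the set of $\varphi$ with $|\varphi(x)-\varphi(y)|\le C(1+|x|^m+|y|^m)|x-y|$ for some $C>0$, $m\in\mathbb N$ depending on $\varphi$. A sub-linear expectation is a map $\widehat{\mathbb E}:\mathscr H\to[-\infty,\infty]$ such that: $X\ge Y$ implies $\widehat{\mathbb E}[X]\ge\widehat{\mathbb E}[Y]$; $\widehat{\mathbb E}[c]=c$ for constants $c$; $\widehat{\mathbb E}[X+Y]\le\widehat{\mathbb E}[X]+\widehat{\mathbb E}[Y]$ whenever the right side is not of the form $\infty-\infty$; $\widehat{\mathbb E}[\lambda X]=\lambda\widehat{\mathbb E}[X]$ for $\lambda\ge0$ (with $0\cdot\infty=0$). Elements of $\mathscr H$ are called random variables. Independence: a random vector $\bm Y\in\mathscr H^n$ is independent to $\bm X\in\mathscr H^m$ if $\widehat{\mathbb E}[\varphi(\bm X,\bm Y)]=\widehat{\mathbb E}\big[\widehat{\mathbb E}[\varphi(\bm x,\bm Y)]|_{\bm x=\bm X}\big]$ for each $\varphi\in C_{l,Lip}(\mathbb R^m\times\mathbb R^n)$ with $\overline\varphi(\bm x):=\widehat{\mathbb E}[|\varphi(\bm x,\bm Y)|]<\infty$ for all $\bm x$ and $\widehat{\mathbb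 E}[|\overline\varphi(\bm X)|]<\infty$. A sequence $\{Y_n\}$ is independent if $Y_{i+1}$ is independent to $(Y_1,\dots,Y_i)$ for each $i\ge1$; it is identically distributed if $\widehat{\mathbb E}[\varphi(Y_i)]=\widehat{\mathbb E}[\varphi(Y_1)]$ for all bounded Lipschitz $\varphi$ and all $i$. Capacities: a capacity is a monotone set function $V:\mathcal F\to[0,1]$ with $V(\emptyset)=0$, $V(\Omega)=1$; it is sub-additive if $V(A\cup B)\le V(A)+V(B)$. Property (C) for $\mathbb V$: $\widehat{\mathbb E}[f]\le\mathbb V(A)\le\widehat{\mathbb E}[g]$ whenever $f\le I_A\le g$, $f,g\in\mathscr H$, $A\in\mathcal F$. Define $\widehat{\mathbb V}(A)=\inf\{\widehat{\mathbb E}[\xi]:I_A\le\xi,\ \xi\in\mathscr H\}$ and $\widehat{\mathbb V}^*(A)=\inf\{\sum_{n=1}^\infty\widehat{\mathbb V}(A_n):A\subset\bigcup_{n=1}^\infty A_n\}$, $A,A_n\in\mathcal F$. The Choquet integral is $C_V[X]=\int_0^\infty V(X\ge t)\,dt+\int_{-\infty}^0[V(X\ge t)-1]\,dt$. For a random variable $X$, $\breve{\mathbb E}[X]=\lim_{c\to\infty}\widehat{\mathbb E}[(-c)\vee(X\wedge c)]$ if the limit exists. Conventions: $\log x=\ln\max(e,x)$; $x\wedge y=\min(x,y)$, $x\vee y=\max(x,y)$; $\max_N$ denotes the supremum over integers $N\ge n$. *)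

theory Defs
  imports "HOL-Analysis.Analysis"
begin

section \<open>Sub-linear expectation spaces\<close>

text \<open>
  A vector of R^n is represented by a function on the natural numbers of which only the
  coordinates below n matter; its Euclidean norm is \<open>L2_set x {..<n}\<close>.  The inequality
  below forces \<open>\<phi>\<close> to depend on these coordinates only.
\<close>

definition C_l_Lip :: "nat \<Rightarrow> ((nat \<Rightarrow> real) \<Rightarrow> real) set" where
  "C_l_Lip n = {\<phi>. \<exists>C>0. \<exists>m::nat. \<forall>x y.
     \<bar>\<phi> x - \<phi> y\<bar> \<le> C * (1 + L2_set x {..<n} ^ m + L2_set y {..<n} ^ m)
                         * L2_set (\<lambda>i. x i - y i) {..<n}}"

text \<open>
  The measurable space is (\<open>space M\<close>, \<open>sets M\<close>); the measure carried by \<open>M\<close> plays no role.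
  The expectation is only meaningful on \<open>H\<close>: its values elsewhere are unconstrained.
\<close>

locale sublinear_expectation_space =
  fixes M :: "'a measure" and H :: "('a \<Rightarrow> real) set" and E :: "('a \<Rightarrow> real) \<Rightarrow> ereal"
  assumes measurable: "H \<subseteq> borel_measurable M"
    and zero: "(\<lambda>_. 0) \<in> H"
    and add: "\<lbrakk>X \<in> H; Y \<in> H\<rbrakk> \<Longrightarrow> (\<lambda>\<omega>. X \<omega> + Y \<omega>) \<in> H"
    and scale: "X \<in> H \<Longrightarrow> (\<lambda>\<omega>. a * X \<omega>) \<in> H"
    and compose: "\<lbrakk>\<And>i. i < n \<Longrightarrow> Xs i \<in> H; \<phi> \<in> C_l_Lip n\<rbrakk> \<Longrightarrow> (\<lambda>\<omega>. \<phi> (\<lambda>i. Xs i \<omega>)) \<in> H"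
    and E_mono: "\<lbrakk>X \<in> H; Y \<in> H; \<And>\<omega>. \<omega> \<in> space M \<Longrightarrow> Y \<omega> \<le> X \<omega>\<rbrakk> \<Longrightarrow> E Y \<le> E X"
    and E_const: "E (\<lambda>_. c) = ereal c"
    and E_subadd: "\<lbrakk>X \<in> H; Y \<in> H; \<not> (E X = \<infinity> \<and> E Y = -\<infinity>); \<not> (E X = -\<infinity> \<and> E Y = \<infinity>)\<rbrakk>
                     \<Longrightarrow> E (\<lambda>\<omega>. X \<omega> + Y \<omega>) \<le> E X + E Y"
    and E_scale: "\<lbrakk>X \<in> H; 0 \<le> a\<rbrakk> \<Longrightarrow> E (\<lambda>\<omega>. a * X \<omega>) = ereal a * E X"


section \<open>Independence and identical distribution\<close>

definition join_vec :: "nat \<Rightarrow> (nat \<Rightarrow> real) \<Rightarrow> (nat \<Rightarrow> real) \<Rightarrow> (nat \<Rightarrow> real)" where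
  "join_vec m x y = (\<lambda>i. if i < m then x i else y (i - m))"

text \<open>
  The m-dimensional \<open>X\<close> comes first: \<open>Y\<close> is independent to \<open>X\<close>.  The functions
  \<open>\<phi>_bar(X)\<close> and \<open>E[\<phi>(x,Y)]|x=X\<close> have to lie in \<open>H\<close> for their expectations to be defined,
  and this need not follow from the two finiteness conditions; the identity is required
  exactly when it is meaningful.  Both are finite under the first condition, so
  \<open>real_of_ereal\<close> loses nothing.
\<close>

definition independent_to ::
  "('a \<Rightarrow> real) set \<Rightarrow> (('a \<Rightarrow> real) \<Rightarrow> ereal) \<Rightarrow>
   nat \<Rightarrow> (nat \<Rightarrow> 'a \<Rightarrow> real) \<Rightarrow> nat \<Rightarrow> (nat \<Rightarrow> 'a \<Rightarrow> real) \<Rightarrow> bool" where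
  "independent_to H E m X n Y \<longleftrightarrow>
    (\<forall>\<phi> \<in> C_l_Lip (m + n).
      let \<phi>_XY  = (\<lambda>\<omega>. \<phi> (join_vec m (\<lambda>i. X i \<omega>) (\<lambda>j. Y j \<omega>)));
          E_phi = (\<lambda>x. E (\<lambda>\<omega>. \<phi> (join_vec m x (\<lambda>j. Y j \<omega>))));
          \<phi>_bar = (\<lambda>x. E (\<lambda>\<omega>. \<bar>\<phi> (join_vec m x (\<lambda>j. Y j \<omega>))\<bar>));
          E_phi_X = (\<lambda>\<omega>. real_of_ereal (E_phi (\<lambda>i. X i \<omega>)));
          \<phi>_bar_X = (\<lambda>\<omega>. real_of_ereal (\<phi>_bar (\<lambda>i. X i \<omega>)))
      in (\<forall>x. \<phi>_bar x < \<infinity>) \<longrightarrow> \<phi>_bar_X \<in> H \<longrightarrow> E (\<lambda>\<omega>. \<bar>\<phi>_bar_X \<omega>\<bar>) < \<infinity> \<longrightarrow> E_phi_X \<in> H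
         \<longrightarrow> E \<phi>_XY = E E_phi_X)"

text \<open>Sequences start at index 1; the value at 0 is ignored.\<close>

definition independent_seq ::
  "('a \<Rightarrow> real) set \<Rightarrow> (('a \<Rightarrow> real) \<Rightarrow> ereal) \<Rightarrow> (nat \<Rightarrow> 'a \<Rightarrow> real) \<Rightarrow> bool" where
  "independent_seq H E Y \<longleftrightarrow>
    (\<forall>i\<ge>1. independent_to H E i (\<lambda>j. Y (Suc j)) 1 (\<lambda>_. Y (Suc i)))"

definition identically_distributed_seq ::
  "(('a \<Rightarrow> real) \<Rightarrow> ereal) \<Rightarrow> (nat \<Rightarrow> 'a \<Rightarrow> real) \<Rightarrow> bool" where
  "identically_distributed_seq E Y \<longleftrightarrow>
    (\<forall>i\<ge>1. \<forall>\<phi>::real \<Rightarrow> real. bounded (range \<phi>) \<and> (\<exists>L. L-lipschitz_on UNIV \<phi>)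
       \<longrightarrow> E (\<lambda>\<omega>. \<phi> (Y i \<omega>)) = E (\<lambda>\<omega>. \<phi> (Y 1 \<omega>)))"


section \<open>Capacities\<close>

locale capacity =
  fixes M :: "'a measure" and V :: "'a set \<Rightarrow> real"
  assumes range: "A \<in> sets M \<Longrightarrow> V A \<in> {0..1}"
    and mono: "\<lbrakk>A \<in> sets M; B \<in> sets M; A \<subseteq> B\<rbrakk> \<Longrightarrow> V A \<le> V B"
    and empty: "V {} = 0"
    and full: "V (space M) = 1"

locale subadditive_capacity = capacity +
  assumes subadd: "\<lbrakk>A \<in> sets M; B \<in> sets M\<rbrakk> \<Longrightarrow> V (A \<union> B) \<le> V A + V B"

definition property_C ::
  "'a measure \<Rightarrow> ('a \<Rightarrow> real) set \<Rightarrow> (('a \<Rightarrow> real) \<Rightarrow> ereal) \<Rightarrow> ('a set \<Rightarrow> real) \<Rightarrow> bool" where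
  "property_C M H E V \<longleftrightarrow>
    (\<forall>f\<in>H. \<forall>g\<in>H. \<forall>A\<in>sets M.
       (\<forall>\<omega>\<in>space M. f \<omega> \<le> indicator A \<omega> \<and> indicator A \<omega> \<le> g \<omega>)
       \<longrightarrow> E f \<le> ereal (V A) \<and> ereal (V A) \<le> E g)"

definition V_hat ::
  "'a measure \<Rightarrow> ('a \<Rightarrow> real) set \<Rightarrow> (('a \<Rightarrow> real) \<Rightarrow> ereal) \<Rightarrow> 'a set \<Rightarrow> ereal" where
  "V_hat M H E A = (INF \<xi> \<in> {\<xi> \<in> H. \<forall>\<omega>\<in>space M. indicator A \<omega> \<le> \<xi> \<omega>}. E \<xi>)"

definition V_hat_star ::
  "'a measure \<Rightarrow> ('a \<Rightarrow> real) set \<Rightarrow> (('a \<Rightarrow> real) \<Rightarrow> ereal) \<Rightarrow> 'a set \<Rightarrow> ereal" where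
  "V_hat_star M H E A =
    (INF As \<in> {As :: nat \<Rightarrow> 'a set. range As \<subseteq> sets M \<and> A \<subseteq> (\<Union>n. As n)}. \<Sum>n. V_hat M H E (As n))"

text \<open>
  The second integral of the Choquet integral has a nonpositive integrand, hence the
  subtraction of nonnegative integrals.  The indeterminate case is irrelevant for
  nonnegative \<open>X\<close>, for which the second integral vanishes.
\<close>

definition choquet_integral :: "'a measure \<Rightarrow> ('a set \<Rightarrow> real) \<Rightarrow> ('a \<Rightarrow> real) \<Rightarrow> ereal" where
  "choquet_integral M V X =
     enn2ereal (\<integral>\<^sup>+ t \<in> {0..}. ennreal (V {\<omega> \<in> space M. X \<omega> \<ge> t}) \<partial>lborel)
   - enn2ereal (\<integral>\<^sup>+ t \<in> {..0}. ennreal (1 - V {\<omega> \<in> space M. X \<omega> \<ge> t}) \<partial>lborel)"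


section \<open>Truncated expectation\<close>

definition has_breve_expectation ::
  "(('a \<Rightarrow> real) \<Rightarrow> ereal) \<Rightarrow> ('a \<Rightarrow> real) \<Rightarrow> ereal \<Rightarrow> bool" where
  "has_breve_expectation E X l \<longleftrightarrow> ((\<lambda>c::real. E (\<lambda>\<omega>. max (- c) (min (X \<omega>) c))) \<longlongrightarrow> l) at_top"

text \<open>Meaningful only if the limit exists, as it always does for nonnegative \<open>X\<close>.\<close>

definition breve_expectation :: "(('a \<Rightarrow> real) \<Rightarrow> ereal) \<Rightarrow> ('a \<Rightarrow> real) \<Rightarrow> ereal" where
  "breve_expectation E X = (THE l. has_breve_expectation E X l)"


section \<open>Conventions for the law of the iterated logarithm\<close>

definition lg :: "real \<Rightarrow> real" where
  "lg x = ln (max (exp 1) x)"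

definition lil_norm :: "nat \<Rightarrow> real" where
  "lil_norm n = sqrt (2 * real n * lg (lg (real n)))"

definition partial_sum :: "(nat \<Rightarrow> 'a \<Rightarrow> real) \<Rightarrow> nat \<Rightarrow> 'a \<Rightarrow> real" where
  "partial_sum Y n \<omega> = (\<Sum>i=1..n. Y i \<omega>)"

definition ereal_sqrt :: "ereal \<Rightarrow> ereal" where
  "ereal_sqrt x = (if x = \<infinity> then \<infinity> else ereal (sqrt (real_of_ereal x)))"

end

(*
A bounded Lipschitz functional of Y_1, ..., Y_n is integrated one coordinate at a time, so that
everything reduces to one-step inequalities for the sub-linear functional N phi = E[phi(Y_1)] and
to potentials that are super- or submartingales for it.  Lower expectations of products over
disjoint blocks factorize, which replaces the second Borel-Cantelli lemma.

Necessity: if the partial sums stay of order sqrt(n log log n) with positive lower probability,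
then single summands cannot exit (this gives the Choquet condition), a nonzero upper mean would
make the path exit linearly fast, and a large truncated variance would make a block exit with
probability at least 1/k (a discounted cosh potential), whose sum diverges.

Upper half: an exponential supermartingale bound for the truncated path, in which the Choquet
condition controls the third moments of the summands truncated at the level sqrt(n log log n).

Lower half: a window moving at constant speed carries a compactly supported strict subsolution of
the heat equation with drift; its one-step inequality only needs that a single truncated second
moment is close to its supremum, and iterating it bounds from below the upper probability that a
block reaches nearly sigma sqrt(2 n log log n).
*)
theory Submission
  imports Defs
begin

section \<open>Bounded Lipschitz functions\<close>

text \<open>Only finite sub-additivity of \<open>E\<close> is available: no continuity along
  monotone sequences, and no additivity that would split a union into disjoint parts. Indicators
  need not lie in \<open>H\<close>, and the independence identity holds only when the integrated
  function is again in \<open>H\<close>. Bounded Lipschitz functions of finitely many coordinates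
  survive this, because integrating out one coordinate preserves both the bound and the Lipschitz
  constant. Hence events become ramps, a stopping time becomes the product weight
  \<open>stay\<close>, summands are truncated, and infinite sums are replaced by bounds uniform in
  their partial sums; property (C) translates between \<open>V\<close> and ramps.

  Upper and lower bounds are not symmetric. An upper bound for \<open>N\<close> of a sum adds upper
  values. A lower bound keeps one term at its upper value and charges the others at their worst
  case. Every potential used for lower bounds is therefore arranged so that a single term, a mean or
  a truncated second moment, carries the gain, while the remaining terms are errors that can be
  estimated separately.\<close>

definition blip :: "('b \<Rightarrow> 'b \<Rightarrow> real) \<Rightarrow> ('b \<Rightarrow> real) \<Rightarrow> bool" where
  "blip d f \<longleftrightarrow> (\<exists>C>0. \<forall>x y. \<bar>f x\<bar> \<le> C \<and> \<bar>f x - f y\<bar> \<le> C * d x y)"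

abbreviation LB :: "(real \<Rightarrow> real) \<Rightarrow> bool" where
  "LB \<equiv> blip (\<lambda>x y. \<bar>x - y\<bar>)"

text \<open>Summing only over coordinates below \<open>k\<close> forces dependence on these
  coordinates alone. With the l1 distance, changing coordinate \<open>k\<close> contributes one
  separate term, so sections and integrals keep the constant.\<close>

abbreviation BL :: "nat \<Rightarrow> ((nat \<Rightarrow> real) \<Rightarrow> real) \<Rightarrow> bool" where
  "BL k \<equiv> blip (\<lambda>x y. \<Sum>i<k. \<bar>x i - y i\<bar>)"

lemma blipE:
  assumes "blip d f"
  obtains C where "C > 0" "\<And>x. \<bar>f x\<bar> \<le> C" "\<And>x y. \<bar>f x - f y\<bar> \<le> C * d x y"
  using assms unfolding blip_def by blast

lemma blipI:
  assumes "\<And>x. \<bar>f x\<bar> \<le> B" "\<And>x y. \<bar>f x - f y\<bar> \<le> L * d x y" "\<And>x y. 0 \<le> d x y"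
  shows "blip d f"
proof -
  let ?C = "max 1 (max B L)"
  have "\<bar>f x - f y\<bar> \<le> ?C * d x y" for x y
    using assms(2)[of x y] mult_right_mono[of L ?C "d x y"] assms(3)[of x y] by linarith
  moreover have "\<bar>f x\<bar> \<le> ?C" for x
    using assms(1)[of x] by linarith
  ultimately show ?thesis
    unfolding blip_def by (intro exI[of _ ?C]) auto
qed

lemma blip_nonneg:
  assumes "blip d f" shows "0 \<le> d x y"
proof -
  obtain C where "C > 0" "\<bar>f x - f y\<bar> \<le> C * d x y"
    using assms by (auto elim: blipE)
  then have "0 \<le> C * d x y" by linarith
  with \<open>C > 0\<close> show ?thesis
    by (simp add: zero_le_mult_iff)
qed

lemma blip_const: "(\<And>x y. 0 \<le> d x y) \<Longrightarrow> blip d (\<lambda>_. c)"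
  by (rule blipI[where B = "\<bar>c\<bar>" and L = 0]) auto

lemma LB_const [simp]: "LB (\<lambda>_. c)"
  by (rule blip_const) auto

lemma BL_const [simp]: "BL k (\<lambda>_. c)"
  by (rule blip_const) (auto intro: sum_nonneg)

lemma blip_add:
  assumes "blip d f" "blip d g" shows "blip d (\<lambda>x. f x + g x)"
proof -
  obtain C where C: "\<And>x. \<bar>f x\<bar> \<le> C" "\<And>x y. \<bar>f x - f y\<bar> \<le> C * d x y"
    using blipE[OF assms(1)] by metis
  obtain D where D: "\<And>x. \<bar>g x\<bar> \<le> D" "\<And>x y. \<bar>g x - g y\<bar> \<le> D * d x y"
    using blipE[OF assms(2)] by metis
  show ?thesis
  proof (rule blipI[where B = "C + D" and L = "C + D"])
    show "\<bar>f x + g x\<bar> \<le> C + D" for x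
      using C(1)[of x] D(1)[of x] by linarith
    show "\<bar>f x + g x - (f y + g y)\<bar> \<le> (C + D) * d x y" for x y
      using C(2)[of x y] D(2)[of x y] unfolding distrib_right by linarith
  qed (rule blip_nonneg[OF assms(1)])
qed

lemma blip_mult:
  assumes "blip d f" "blip d g" shows "blip d (\<lambda>x. f x * g x)"
proof -
  obtain C where C: "C > 0" "\<And>x. \<bar>f x\<bar> \<le> C" "\<And>x y. \<bar>f x - f y\<bar> \<le> C * d x y"
    using blipE[OF assms(1)] by metis
  obtain D where D: "D > 0" "\<And>x. \<bar>g x\<bar> \<le> D" "\<And>x y. \<bar>g x - g y\<bar> \<le> D * d x y"
    using blipE[OF assms(2)] by metis
  show ?thesis
  proof (rule blipI[where B = "C * D" and L = "2 * C * D"])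
    show "\<bar>f x * g x\<bar> \<le> C * D" for x
      unfolding abs_mult using C D by (intro mult_mono) (auto intro: less_imp_le)
    show "\<bar>f x * g x - f y * g y\<bar> \<le> 2 * C * D * d x y" for x y
    proof -
      have "f x * g x - f y * g y = f x * (g x - g y) + g y * (f x - f y)"
        by (simp add: algebra_simps)
      also have "\<bar>\<dots>\<bar> \<le> \<bar>f x\<bar> * \<bar>g x - g y\<bar> + \<bar>g y\<bar> * \<bar>f x - f y\<bar>"
        by (metis abs_mult abs_triangle_ineq)
      also have "\<dots> \<le> C * (D * d x y) + D * (C * d x y)"
        using C D by (intro add_mono mult_mono) (auto intro: less_imp_le)
      finally show ?thesis by (simp add: algebra_simps)
    qed
  qed (rule blip_nonneg[OF assms(1)])
qed

lemma blip_cmult: "blip d f \<Longrightarrow> blip d (\<lambda>x. c * f x)"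
  by (rule blip_mult[OF blip_const[OF blip_nonneg]])

lemma blip_uminus: "blip d f \<Longrightarrow> blip d (\<lambda>x. - f x)"
  using blip_cmult[of d f "-1"] by simp

lemma blip_diff: "blip d f \<Longrightarrow> blip d g \<Longrightarrow> blip d (\<lambda>x. f x - g x)"
  using blip_add[OF _ blip_uminus, of d f g] by simp

lemma blip_add_const: "blip d f \<Longrightarrow> blip d (\<lambda>x. f x + c)"
  by (rule blip_add[OF _ blip_const[OF blip_nonneg]])

lemma blip_diff_const: "blip d f \<Longrightarrow> blip d (\<lambda>x. c - f x)"
  by (rule blip_diff[OF blip_const[OF blip_nonneg]])

lemma blip_abs:
  assumes "blip d f" shows "blip d (\<lambda>x. \<bar>f x\<bar>)"
proof -
  obtain C where C: "C > 0" "\<And>x. \<bar>f x\<bar> \<le> C" "\<And>x y. \<bar>f x - f y\<bar> \<le> C * d x y"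
    using blipE[OF assms] by metis
  then show ?thesis
    by (intro blipI[where B = C and L = C] blip_nonneg[OF assms]) (auto intro: order_trans[OF abs_triangle_ineq3])
qed

lemma blip_LB_comp:
  assumes "LB \<phi>" "\<And>x y. \<bar>f x - f y\<bar> \<le> L * d x y" "\<And>x y. 0 \<le> d x y"
  shows "blip d (\<lambda>x. \<phi> (f x))"
proof -
  obtain C where C: "C > 0" "\<And>x. \<bar>\<phi> x\<bar> \<le> C" "\<And>x y. \<bar>\<phi> x - \<phi> y\<bar> \<le> C * \<bar>x - y\<bar>"
    using blipE[OF assms(1)] by metis
  have "\<bar>\<phi> (f x) - \<phi> (f y)\<bar> \<le> C * L * d x y" for x y
    using C(3)[of "f x" "f y"] mult_left_mono[OF assms(2)[of x y], of C] C(1) by linarith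
  with C assms(3) show ?thesis
    by (intro blipI[where B = C and L = "C * L"]) auto
qed

lemma blip_LB_blip: "LB \<phi> \<Longrightarrow> blip d f \<Longrightarrow> blip d (\<lambda>x. \<phi> (f x))"
  by (metis blip_LB_comp blipE blip_nonneg)

text \<open>From exp a - exp b <= exp a * (a - b), with the factor exp a bounded because
  \<open>f\<close> is. This admits exponential potentials of truncated sums.\<close>

lemma blip_exp:
  assumes "blip d f" shows "blip d (\<lambda>x. exp (f x))"
proof -
  obtain C where C: "C > 0" "\<And>x. \<bar>f x\<bar> \<le> C" "\<And>x y. \<bar>f x - f y\<bar> \<le> C * d x y"
    using blipE[OF assms] by metis
  have *: "exp (f x) - exp (f y) \<le> exp C * C * d x y" for x y
  proof -
    have "exp (f x) - exp (f y) = exp (f x) * (1 - exp (f y - f x))"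
      by (simp add: algebra_simps exp_diff)
    also have "\<dots> \<le> exp (f x) * (f x - f y)"
    proof (rule mult_left_mono)
      show "1 - exp (f y - f x) \<le> f x - f y"
        using exp_ge_add_one_self[of "f y - f x"] by linarith
    qed simp
    also have "\<dots> \<le> exp (f x) * (C * d x y)"
      using C(3)[of x y] by (intro mult_left_mono) auto
    also have "\<dots> \<le> exp C * (C * d x y)"
      using C(2)[of x] C(1) blip_nonneg[OF assms, of x y] by (intro mult_right_mono) auto
    finally show ?thesis by (simp add: mult.assoc)
  qed
  have **: "exp (f y) - exp (f x) \<le> exp C * C * d x y" for x y
  proof -
    have "exp (f y) - exp (f x) = exp (f y) * (1 - exp (f x - f y))"
      by (simp add: algebra_simps exp_diff)
    also have "\<dots> \<le> exp (f y) * (f y - f x)"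
    proof (rule mult_left_mono)
      show "1 - exp (f x - f y) \<le> f y - f x"
        using exp_ge_add_one_self[of "f x - f y"] by linarith
    qed simp
    also have "\<dots> \<le> exp (f y) * (C * d x y)"
      using C(3)[of x y] by (intro mult_left_mono) auto
    also have "\<dots> \<le> exp C * (C * d x y)"
      using C(2)[of y] C(1) blip_nonneg[OF assms, of x y] by (intro mult_right_mono) auto
    finally show ?thesis by (simp add: mult.assoc)
  qed
  have "\<bar>exp (f x)\<bar> \<le> exp C" for x
    using C(2)[of x] by simp
  with * ** show ?thesis
    by (intro blipI[where B = "exp C" and L = "exp C * C"] blip_nonneg[OF assms])
       (auto simp: abs_le_iff)
qed

lemma blip_cosh:
  assumes "blip d f" shows "blip d (\<lambda>x. cosh (f x))"
proof -
  have "blip d (\<lambda>x. 1 / 2 * (exp (f x) + exp (- f x)))"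
    by (intro blip_cmult blip_add blip_exp blip_uminus assms)
  then show ?thesis by (simp add: cosh_def)
qed

lemma blip_power: "blip d f \<Longrightarrow> blip d (\<lambda>x. f x ^ n)"
  by (induction n) (auto intro: blip_mult blip_const blip_nonneg)

lemma blip_sum:
  "finite I \<Longrightarrow> (\<And>x y. 0 \<le> d x y) \<Longrightarrow> (\<And>i. i \<in> I \<Longrightarrow> blip d (f i)) \<Longrightarrow> blip d (\<lambda>x. \<Sum>i\<in>I. f i x)"
  by (induction I rule: finite_induct) (auto intro: blip_add blip_const)

lemma blip_prod:
  "finite I \<Longrightarrow> (\<And>x y. 0 \<le> d x y) \<Longrightarrow> (\<And>i. i \<in> I \<Longrightarrow> blip d (f i)) \<Longrightarrow> blip d (\<lambda>x. \<Prod>i\<in>I. f i x)"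
  by (induction I rule: finite_induct) (auto intro: blip_mult blip_const)

lemma BL_dist_nonneg: "0 \<le> (\<Sum>i<k. \<bar>(x::nat\<Rightarrow>real) i - y i\<bar>)"
  by (auto intro: sum_nonneg)

lemmas BL_sum = blip_sum[of _ "\<lambda>x y. \<Sum>i<k. \<bar>(x::nat\<Rightarrow>real) i - y i\<bar>" for k, OF _ BL_dist_nonneg]
lemmas BL_prod = blip_prod[of _ "\<lambda>x y. \<Sum>i<k. \<bar>(x::nat\<Rightarrow>real) i - y i\<bar>" for k, OF _ BL_dist_nonneg]

lemma BL_coord:
  assumes "LB \<phi>" "i < k" shows "BL k (\<lambda>x. \<phi> (x i))"
proof (rule blip_LB_comp[OF assms(1), where L = 1])
  show "\<bar>x i - y i\<bar> \<le> 1 * (\<Sum>i<k. \<bar>x i - y i\<bar>)" for x y :: "nat \<Rightarrow> real"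
    using assms(2) member_le_sum[of i "{..<k}" "\<lambda>i. \<bar>x i - y i\<bar>"] by simp
qed (auto intro: sum_nonneg)

lemma BL_linear:
  assumes "LB \<phi>" "n \<le> k" shows "BL k (\<lambda>x. \<phi> (a * (\<Sum>i<n. x i) + b))"
proof (rule blip_LB_comp[OF assms(1), where L = "\<bar>a\<bar>"])
  fix x y :: "nat \<Rightarrow> real"
  have "\<bar>a * (\<Sum>i<n. x i) + b - (a * (\<Sum>i<n. y i) + b)\<bar> = \<bar>a\<bar> * \<bar>\<Sum>i<n. x i - y i\<bar>"
    by (simp add: sum_subtractf flip: abs_mult right_diff_distrib)
  also have "\<dots> \<le> \<bar>a\<bar> * (\<Sum>i<n. \<bar>x i - y i\<bar>)"
    by (intro mult_left_mono sum_abs) auto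
  also have "\<dots> \<le> \<bar>a\<bar> * (\<Sum>i<k. \<bar>x i - y i\<bar>)"
    using assms(2) by (intro mult_left_mono sum_mono2) auto
  finally show "\<bar>a * (\<Sum>i<n. x i) + b - (a * (\<Sum>i<n. y i) + b)\<bar> \<le> \<bar>a\<bar> * (\<Sum>i<k. \<bar>x i - y i\<bar>)" .
qed (auto intro: sum_nonneg)

lemma BL_mono:
  assumes "BL k f" "k \<le> m" shows "BL m f"
proof -
  obtain C where C: "C > 0" "\<And>x. \<bar>f x\<bar> \<le> C" "\<And>x y. \<bar>f x - f y\<bar> \<le> C * (\<Sum>i<k. \<bar>x i - y i\<bar>)"
    using blipE[OF assms(1)] by metis
  have "\<bar>f x - f y\<bar> \<le> C * (\<Sum>i<m. \<bar>x i - y i\<bar>)" for x y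
    using assms(2) C(1)
    by (intro order_trans[OF C(3)] mult_left_mono sum_mono2) auto
  with C show ?thesis
    by (intro blipI[where B = C and L = C] BL_dist_nonneg) auto
qed

lemma BL_shift:
  assumes "BL m f" shows "BL (n + m) (\<lambda>x. f (\<lambda>i. x (n + i)))"
proof -
  obtain C where C: "C > 0" "\<And>x. \<bar>f x\<bar> \<le> C" "\<And>x y. \<bar>f x - f y\<bar> \<le> C * (\<Sum>i<m. \<bar>x i - y i\<bar>)"
    using blipE[OF assms(1)] by metis
  have "(\<Sum>i<m. \<bar>x (n + i) - y (n + i)\<bar>) \<le> (\<Sum>i<n + m. \<bar>x i - y i\<bar>)" for x y :: "nat \<Rightarrow> real"
  proof -
    have "(\<Sum>i<m. \<bar>x (n + i) - y (n + i)\<bar>) = (\<Sum>i\<in>(\<lambda>i. n + i) ` {..<m}. \<bar>x i - y i\<bar>)"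
      by (subst sum.reindex) auto
    also have "\<dots> \<le> (\<Sum>i<n + m. \<bar>x i - y i\<bar>)"
      by (intro sum_mono2) auto
    finally show ?thesis .
  qed
  then have "\<bar>f (\<lambda>i. x (n + i)) - f (\<lambda>i. y (n + i))\<bar> \<le> C * (\<Sum>i<n + m. \<bar>x i - y i\<bar>)" for x y
    using C(1) by (intro order_trans[OF C(3)] mult_left_mono) auto
  with C show ?thesis
    by (intro blipI[where B = C and L = C] BL_dist_nonneg) auto
qed

lemma BL_section:
  assumes "BL (Suc k) f" shows "LB (\<lambda>y. f (x(k := y)))"
proof -
  obtain C where C: "C > 0" "\<And>x. \<bar>f x\<bar> \<le> C" "\<And>x y. \<bar>f x - f y\<bar> \<le> C * (\<Sum>i<Suc k. \<bar>x i - y i\<bar>)"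
    using blipE[OF assms(1)] by metis
  have "\<bar>f (x(k := y)) - f (x(k := z))\<bar> \<le> C * \<bar>y - z\<bar>" for y z
    using C(3)[of "x(k := y)" "x(k := z)"] by simp
  with C show ?thesis
    by (intro blipI[where B = C and L = C]) auto
qed

lemma BL_cong:
  assumes "BL k f" "\<And>i. i < k \<Longrightarrow> x i = y i" shows "f x = f y"
proof -
  obtain C where "\<bar>f x - f y\<bar> \<le> C * (\<Sum>i<k. \<bar>x i - y i\<bar>)"
    using blipE[OF assms(1)] by metis
  with assms(2) show ?thesis by simp
qed

text \<open>Growth exponent 0 suffices. The factor \<open>real k + 1\<close> instead of
  \<open>real k\<close> keeps the constant positive when \<open>k = 0\<close>.\<close>

lemma BL_imp_C_l_Lip:
  assumes "BL k f" shows "f \<in> C_l_Lip k"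
proof -
  obtain C where C: "C > 0" "\<And>x y. \<bar>f x - f y\<bar> \<le> C * (\<Sum>i<k. \<bar>x i - y i\<bar>)"
    using blipE[OF assms(1)] by metis
  have *: "(\<Sum>i<k. \<bar>x i - y i\<bar>) \<le> (real k + 1) * L2_set (\<lambda>i. x i - y i) {..<k}" for x y :: "nat \<Rightarrow> real"
  proof -
    have "(\<Sum>i<k. \<bar>x i - y i\<bar>) = (\<Sum>i<k. L2_set (\<lambda>i. x i - y i) {i})"
      by (simp add: L2_set_def)
    also have "\<dots> \<le> (\<Sum>i<k. L2_set (\<lambda>i. x i - y i) {..<k})"
      unfolding L2_set_def by (intro sum_mono real_sqrt_le_mono sum_mono2) auto
    also have "\<dots> \<le> (real k + 1) * L2_set (\<lambda>i. x i - y i) {..<k}"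
      by (simp add: algebra_simps)
    finally show ?thesis .
  qed
  have "\<bar>f x - f y\<bar> \<le> (C * (real k + 1)) * (1 + L2_set x {..<k} ^ 0 + L2_set y {..<k} ^ 0)
      * L2_set (\<lambda>i. x i - y i) {..<k}" for x y
  proof -
    have "\<bar>f x - f y\<bar> \<le> C * ((real k + 1) * L2_set (\<lambda>i. x i - y i) {..<k})"
      using C(1) * by (intro order_trans[OF C(2)] mult_left_mono) auto
    also have "\<dots> \<le> 3 * (C * ((real k + 1) * L2_set (\<lambda>i. x i - y i) {..<k}))"
      using C(1) by simp
    finally show ?thesis by (simp add: algebra_simps)
  qed
  then show ?thesis
    unfolding C_l_Lip_def using C(1)
    by (intro CollectI exI[of _ "C * (real k + 1)"] conjI exI[of _ 0] allI) auto
qed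

section \<open>Truncations and continuous cut-offs\<close>

definition trunc :: "real \<Rightarrow> real \<Rightarrow> real" where
  "trunc c x = max (- c) (min x c)"

lemma LB_trunc: "LB (trunc c)"
  by (rule blipI[where B = "\<bar>c\<bar>" and L = 1]) (auto simp: trunc_def max_def min_def)

text \<open>For \<open>a < b\<close> a Lipschitz stand-in for the indicator of the half-line from
  \<open>b\<close> on; it differs from it only between \<open>a\<close> and
  \<open>b\<close>.\<close>

definition ramp :: "real \<Rightarrow> real \<Rightarrow> real \<Rightarrow> real" where
  "ramp a b x = max 0 (min 1 ((x - a) / (b - a)))"

lemma LB_ramp:
  assumes "a < b" shows "LB (ramp a b)"
proof -
  have "\<bar>ramp a b x - ramp a b y\<bar> \<le> \<bar>(x - a) / (b - a) - (y - a) / (b - a)\<bar>" for x y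
    unfolding ramp_def by (auto simp: max_def min_def)
  also have "\<dots> x y = 1 / (b - a) * \<bar>x - y\<bar>" for x y
    using assms by (simp add: diff_divide_distrib[symmetric] abs_div)
  finally have "\<bar>ramp a b x - ramp a b y\<bar> \<le> 1 / (b - a) * \<bar>x - y\<bar>" for x y .
  then show ?thesis
    by (intro blipI[where B = 1 and L = "1 / (b - a)"]) (auto simp: ramp_def)
qed

lemma ramp_range: "0 \<le> ramp a b x" "ramp a b x \<le> 1"
  by (auto simp: ramp_def)

lemma ramp_eq_1: "a < b \<Longrightarrow> b \<le> x \<Longrightarrow> ramp a b x = 1"
  by (auto simp: ramp_def max_def min_def field_simps)

lemma ramp_eq_0: "a < b \<Longrightarrow> x \<le> a \<Longrightarrow> ramp a b x = 0"
  by (auto simp: ramp_def max_def min_def field_simps divide_le_0_iff)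

lemma ramp_pos: "a < b \<Longrightarrow> 0 < ramp a b x \<Longrightarrow> a < x"
  using ramp_eq_0[of a b x] by force


section \<open>Expectations along an independent, identically distributed sequence\<close>

locale iid_seq = sublinear_expectation_space M H E
  for M :: "'a measure" and H E +
  fixes Y :: "nat \<Rightarrow> 'a \<Rightarrow> real"
  assumes Y_in_H: "n \<ge> 1 \<Longrightarrow> Y n \<in> H"
    and indep: "independent_seq H E Y"
    and ident: "identically_distributed_seq E Y"
begin

definition path :: "'a \<Rightarrow> nat \<Rightarrow> real" where
  "path \<omega> i = Y (Suc i) \<omega>"

definition Er :: "((nat \<Rightarrow> real) \<Rightarrow> real) \<Rightarrow> real" where
  "Er f = real_of_ereal (E (\<lambda>\<omega>. f (path \<omega>)))"

text \<open>The one-step functional. Identical distribution makes it the expectation over any single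
  coordinate, and iterating it gives \<open>Er\<close>.\<close>

definition N :: "(real \<Rightarrow> real) \<Rightarrow> real" where
  "N \<phi> = Er (\<lambda>x. \<phi> (x 0))"

lemma BL_path_in_H:
  assumes "BL k f" shows "(\<lambda>\<omega>. f (path \<omega>)) \<in> H"
proof -
  have "(\<lambda>\<omega>. f (\<lambda>i. Y (Suc i) \<omega>)) \<in> H"
    by (rule compose[where n = k and Xs = "\<lambda>i. Y (Suc i)" and \<phi> = f])
       (simp_all add: Y_in_H BL_imp_C_l_Lip[OF assms])
  then show ?thesis by (simp add: path_def[abs_def])
qed

lemma const_in_H: "(\<lambda>_. c) \<in> H"
  by (rule BL_path_in_H[OF BL_const[of 0]])

lemma E_bounds:
  assumes "X \<in> H" "\<And>\<omega>. a \<le> X \<omega>" "\<And>\<omega>. X \<omega> \<le> b"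
  shows "ereal a \<le> E X" "E X \<le> ereal b"
  using E_mono[OF assms(1) const_in_H[of a]] E_mono[OF const_in_H[of b] assms(1)] assms(2,3)
  by (auto simp: E_const)

lemma E_finite:
  assumes "X \<in> H" "\<And>\<omega>. \<bar>X \<omega>\<bar> \<le> b"
  shows "E X = ereal (real_of_ereal (E X))"
proof -
  have "- b \<le> X \<omega>" "X \<omega> \<le> b" for \<omega>
    using assms(2)[of \<omega>] by linarith+
  then have "ereal (- b) \<le> E X" "E X \<le> ereal b"
    using E_bounds[OF assms(1)] by blast+
  then show ?thesis
    by (cases "E X") auto
qed

lemma Er_eq:
  assumes "BL k f" shows "E (\<lambda>\<omega>. f (path \<omega>)) = ereal (Er f)"
proof -
  obtain C where "\<And>x. \<bar>f x\<bar> \<le> C"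
    using blipE[OF assms] by metis
  then show ?thesis
    unfolding Er_def by (rule E_finite[OF BL_path_in_H[OF assms]])
qed

lemma Er_mono:
  assumes "BL k f" "BL m g" "\<And>x. f x \<le> g x" shows "Er f \<le> Er g"
proof -
  have "E (\<lambda>\<omega>. f (path \<omega>)) \<le> E (\<lambda>\<omega>. g (path \<omega>))"
    by (intro E_mono BL_path_in_H[OF assms(1)] BL_path_in_H[OF assms(2)] assms(3))
  then show ?thesis using Er_eq[OF assms(1)] Er_eq[OF assms(2)] by simp
qed

lemma Er_const [simp]: "Er (\<lambda>_. c) = c"
  by (simp add: Er_def E_const)

lemma Er_add:
  assumes "BL k f" "BL k g" shows "Er (\<lambda>x. f x + g x) \<le> Er f + Er g"
proof -
  have "E (\<lambda>\<omega>. f (path \<omega>) + g (path \<omega>)) \<le> E (\<lambda>\<omega>. f (path \<omega>)) + E (\<lambda>\<omega>. g (path \<omega>))"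
    using Er_eq[OF assms(1)] Er_eq[OF assms(2)]
    by (intro E_subadd BL_path_in_H[OF assms(1)] BL_path_in_H[OF assms(2)]) auto
  then show ?thesis
    using Er_eq[OF blip_add[OF assms]] Er_eq[OF assms(1)] Er_eq[OF assms(2)] by simp
qed

lemma Er_cmult:
  assumes "BL k f" "0 \<le> a" shows "Er (\<lambda>x. a * f x) = a * Er f"
proof -
  have "E (\<lambda>\<omega>. a * f (path \<omega>)) = ereal a * E (\<lambda>\<omega>. f (path \<omega>))"
    by (intro E_scale BL_path_in_H[OF assms(1)] assms(2))
  then show ?thesis
    using Er_eq[OF blip_cmult[OF assms(1)], of a] Er_eq[OF assms(1)] by simp
qed

text \<open>Sub-additivity applied to (f + g) + (-g). It is the only lower bound for a sum, and it
  charges \<open>g\<close> at its lower expectation.\<close>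

lemma Er_add_ge:
  assumes "BL k f" "BL k g" shows "Er f - Er (\<lambda>x. - g x) \<le> Er (\<lambda>x. f x + g x)"
  using Er_add[OF blip_add[OF assms] blip_uminus[OF assms(2)]] by simp

lemma Er_add_const:
  assumes "BL k f" shows "Er (\<lambda>x. f x + c) = Er f + c"
  using Er_add[OF assms BL_const[of k c]] Er_add_ge[OF assms BL_const[of k c]] by simp

lemma Er_sum_le:
  assumes "finite I" "\<And>i. i \<in> I \<Longrightarrow> BL k (f i)"
  shows "Er (\<lambda>x. \<Sum>i\<in>I. f i x) \<le> (\<Sum>i\<in>I. Er (f i))"
  using assms
proof (induction I rule: finite_induct)
  case (insert j I)
  have "Er (\<lambda>x. f j x + (\<Sum>i\<in>I. f i x)) \<le> Er (f j) + Er (\<lambda>x. \<Sum>i\<in>I. f i x)"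
    using insert by (intro Er_add[where k = k] BL_sum) auto
  with insert show ?case by simp
qed simp

lemma Er_bounds:
  assumes "BL k f"
  shows "(\<And>x. a \<le> f x) \<Longrightarrow> a \<le> Er f" "(\<And>x. f x \<le> b) \<Longrightarrow> Er f \<le> b"
  using Er_mono[OF BL_const[of 0 a] assms] Er_mono[OF assms BL_const[of 0 b]] by auto

lemma LB_BL: "LB \<phi> \<Longrightarrow> BL 1 (\<lambda>x. \<phi> (x 0))"
  by (rule BL_coord) auto

lemma N_const [simp]: "N (\<lambda>_. c) = c"
  by (simp add: N_def)

lemma N_mono: "LB \<phi> \<Longrightarrow> LB \<psi> \<Longrightarrow> (\<And>x. \<phi> x \<le> \<psi> x) \<Longrightarrow> N \<phi> \<le> N \<psi>"
  unfolding N_def by (intro Er_mono[OF LB_BL LB_BL]) auto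

lemma N_bounds:
  assumes "LB \<phi>"
  shows "(\<And>x. a \<le> \<phi> x) \<Longrightarrow> a \<le> N \<phi>" "(\<And>x. \<phi> x \<le> b) \<Longrightarrow> N \<phi> \<le> b"
  unfolding N_def using Er_bounds[OF LB_BL[OF assms]] by auto

lemma N_add: "LB \<phi> \<Longrightarrow> LB \<psi> \<Longrightarrow> N (\<lambda>x. \<phi> x + \<psi> x) \<le> N \<phi> + N \<psi>"
  unfolding N_def by (intro Er_add[OF LB_BL LB_BL])

lemma N_add_ge: "LB \<phi> \<Longrightarrow> LB \<psi> \<Longrightarrow> N \<phi> - N (\<lambda>x. - \<psi> x) \<le> N (\<lambda>x. \<phi> x + \<psi> x)"
  unfolding N_def by (intro Er_add_ge[OF LB_BL LB_BL])

lemma N_cmult: "LB \<phi> \<Longrightarrow> 0 \<le> a \<Longrightarrow> N (\<lambda>x. a * \<phi> x) = a * N \<phi>"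
  unfolding N_def by (intro Er_cmult[OF LB_BL])

lemma N_add_const: "LB \<phi> \<Longrightarrow> N (\<lambda>x. \<phi> x + c) = N \<phi> + c"
  unfolding N_def by (intro Er_add_const[OF LB_BL])

text \<open>\<open>N\<close> is nonexpansive: this is behind the regularity of integrated functions
  and behind the comparison of means at two truncation levels.\<close>

lemma N_diff_le: "LB \<phi> \<Longrightarrow> LB \<psi> \<Longrightarrow> N \<phi> - N \<psi> \<le> N (\<lambda>x. \<bar>\<phi> x - \<psi> x\<bar>)"
proof -
  assume *: "LB \<phi>" "LB \<psi>"
  have "N \<phi> \<le> N (\<lambda>x. \<psi> x + \<bar>\<phi> x - \<psi> x\<bar>)"
    using * by (intro N_mono) (auto intro!: blip_add blip_abs blip_diff)
  also have "\<dots> \<le> N \<psi> + N (\<lambda>x. \<bar>\<phi> x - \<psi> x\<bar>)"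
    using * by (intro N_add) (auto intro!: blip_abs blip_diff)
  finally show ?thesis by simp
qed

lemma N_sum_le:
  assumes "finite I" "\<And>i. i \<in> I \<Longrightarrow> LB (f i)"
  shows "N (\<lambda>x. \<Sum>i\<in>I. f i x) \<le> (\<Sum>i\<in>I. N (f i))"
  unfolding N_def using assms by (intro Er_sum_le[where k = 1] LB_BL) auto

lemma E_LB_Y:
  assumes "LB \<phi>" "i \<ge> 1" shows "E (\<lambda>\<omega>. \<phi> (Y i \<omega>)) = ereal (N \<phi>)"
proof -
  obtain C where C: "C > 0" "\<And>x. \<bar>\<phi> x\<bar> \<le> C" "\<And>x y. \<bar>\<phi> x - \<phi> y\<bar> \<le> C * \<bar>x - y\<bar>"
    using blipE[OF assms(1)] by metis
  have "bounded (range \<phi>)"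
    using C(2) by (auto simp: bounded_iff)
  moreover have "C-lipschitz_on UNIV \<phi>"
    using C by (auto simp: lipschitz_on_def dist_real_def)
  ultimately have "E (\<lambda>\<omega>. \<phi> (Y i \<omega>)) = E (\<lambda>\<omega>. \<phi> (Y 1 \<omega>))"
    using ident assms(2) unfolding identically_distributed_seq_def by blast
  also have "\<dots> = ereal (N \<phi>)"
    unfolding N_def using Er_eq[OF LB_BL[OF assms(1)]] by (simp add: path_def)
  finally show ?thesis .
qed

lemma Er_coord: "LB \<phi> \<Longrightarrow> Er (\<lambda>x. \<phi> (x i)) = N \<phi>"
  using E_LB_Y[of \<phi> "Suc i"] by (simp add: Er_def path_def)

text \<open>Nonexpansiveness of \<open>N\<close> carries the constant of \<open>f\<close> over to
  the remaining coordinates. The integrated function thus lies in \<open>H\<close>, which discharges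
  the side conditions in the definition of independence.\<close>

lemma BL_integrate:
  assumes "BL (Suc k) f" shows "BL k (\<lambda>x. N (\<lambda>y. f (x(k := y))))"
proof -
  obtain C where C: "C > 0" "\<And>x. \<bar>f x\<bar> \<le> C" "\<And>x y. \<bar>f x - f y\<bar> \<le> C * (\<Sum>i<Suc k. \<bar>x i - y i\<bar>)"
    using blipE[OF assms] by metis
  note sec = BL_section[OF assms]
  have "\<bar>N (\<lambda>y. f (x(k := y)))\<bar> \<le> C" for x
  proof -
    have "- C \<le> f (x(k := y)) \<and> f (x(k := y)) \<le> C" for y
      using C(2)[of "x(k := y)"] by linarith
    then have "- C \<le> N (\<lambda>y. f (x(k := y)))" "N (\<lambda>y. f (x(k := y))) \<le> C"
      using N_bounds[OF sec] by auto
    then show ?thesis by linarith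
  qed
  moreover have *: "N (\<lambda>y. f (x(k := y))) - N (\<lambda>y. f (z(k := y))) \<le> C * (\<Sum>i<k. \<bar>x i - z i\<bar>)" for x z
  proof -
    have "N (\<lambda>y. f (x(k := y))) - N (\<lambda>y. f (z(k := y))) \<le> N (\<lambda>y. \<bar>f (x(k := y)) - f (z(k := y))\<bar>)"
      by (intro N_diff_le sec)
    also have "\<dots> \<le> C * (\<Sum>i<k. \<bar>x i - z i\<bar>)"
    proof (rule N_bounds(2))
      show "LB (\<lambda>y. \<bar>f (x(k := y)) - f (z(k := y))\<bar>)"
        by (intro blip_abs blip_diff sec)
      show "\<bar>f (x(k := y)) - f (z(k := y))\<bar> \<le> C * (\<Sum>i<k. \<bar>x i - z i\<bar>)" for y
        using C(3)[of "x(k := y)" "z(k := y)"] by simp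
    qed
    finally show ?thesis .
  qed
  moreover have "\<bar>N (\<lambda>y. f (x(k := y))) - N (\<lambda>y. f (z(k := y)))\<bar> \<le> C * (\<Sum>i<k. \<bar>x i - z i\<bar>)" for x z
    using *[of x z] *[of z x] by (simp add: abs_minus_commute abs_le_iff)
  ultimately show ?thesis
    by (intro blipI[where B = C and L = C] BL_dist_nonneg)
qed

text \<open>The tower property. Since \<open>f\<close> sees only coordinates up to \<open>k\<close>,
  updating coordinate \<open>k\<close> may replace the joined vector in the definition of
  independence.\<close>

lemma Er_step:
  assumes "BL (Suc k) f" shows "Er f = Er (\<lambda>x. N (\<lambda>y. f (x(k := y))))"
\<comment> \<open>Independence concerns indices from 1 on; with one coordinate the claim unfolds to
  the definition of \<open>N\<close>.\<close>
proof (cases "k = 0")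
  case True
  have "f x = f (z(0 := x 0))" for x z
    by (rule BL_cong[OF assms]) (use True in auto)
  then have "Er f = N (\<lambda>y. f (z(0 := y)))" for z
    unfolding N_def by metis
  then have "(\<lambda>x. N (\<lambda>y. f (x(k := y)))) = (\<lambda>_. Er f)"
    using True by auto
  then show ?thesis by simp
next
  case False
  then have k: "k \<ge> 1" by simp
  have join: "f (join_vec k x (\<lambda>_. y)) = f (x(k := y))" for x y
    by (rule BL_cong[OF assms]) (auto simp: join_vec_def less_Suc_eq)
  have join': "f ((\<lambda>i. Y (Suc i) \<omega>)(k := Y (Suc k) \<omega>)) = f (path \<omega>)" for \<omega>
    by (rule BL_cong[OF assms]) (auto simp: path_def)
  have abs_BL: "BL (Suc k) (\<lambda>x. \<bar>f x\<bar>)"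
    by (intro blip_abs assms)
  have E_phi: "E (\<lambda>\<omega>. f (x(k := Y (Suc k) \<omega>))) = ereal (N (\<lambda>y. f (x(k := y))))" for x
    by (rule E_LB_Y[OF BL_section[OF assms]]) auto
  have phi_bar: "E (\<lambda>\<omega>. \<bar>f (x(k := Y (Suc k) \<omega>))\<bar>) = ereal (N (\<lambda>y. \<bar>f (x(k := y))\<bar>))" for x
    by (rule E_LB_Y[OF BL_section[OF abs_BL]]) auto
  note int = BL_integrate[OF assms] and int_abs = BL_integrate[OF abs_BL]
  have inH: "(\<lambda>\<omega>. N (\<lambda>y. f ((\<lambda>i. Y (Suc i) \<omega>)(k := y)))) \<in> H"
    "(\<lambda>\<omega>. N (\<lambda>y. \<bar>f ((\<lambda>i. Y (Suc i) \<omega>)(k := y))\<bar>)) \<in> H"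
    using BL_path_in_H[OF int] BL_path_in_H[OF int_abs] by (simp_all add: path_def[abs_def])
  have fin: "E (\<lambda>\<omega>. \<bar>N (\<lambda>y. \<bar>f ((\<lambda>i. Y (Suc i) \<omega>)(k := y))\<bar>)\<bar>) < \<infinity>"
    using Er_eq[OF blip_abs[OF int_abs]] by (simp add: path_def[abs_def])
  have ind: "independent_to H E k (\<lambda>j. Y (Suc j)) 1 (\<lambda>_. Y (Suc k))"
    using indep k by (simp add: independent_seq_def)
  have "f \<in> C_l_Lip (k + 1)"
    using BL_imp_C_l_Lip[OF assms] by simp
  from ind[unfolded independent_to_def Let_def, rule_format, OF this]
  have "E (\<lambda>\<omega>. f (path \<omega>)) = E (\<lambda>\<omega>. N (\<lambda>y. f ((\<lambda>i. Y (Suc i) \<omega>)(k := y))))"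
    unfolding join join' E_phi phi_bar real_of_ereal.simps using inH fin by simp
  then show ?thesis by (simp add: Er_def path_def[abs_def])
qed

text \<open>This and the next lemma are the supermartingale and submartingale steps: a pointwise
  one-step inequality for a potential becomes an inequality of expectations.\<close>

lemma Er_le_step:
  assumes "BL (Suc k) f" "BL k g" "\<And>x. N (\<lambda>y. f (x(k := y))) \<le> g x"
  shows "Er f \<le> Er g"
  unfolding Er_step[OF assms(1)] by (intro Er_mono[OF BL_integrate[OF assms(1)] assms(2)] assms(3))

lemma Er_ge_step:
  assumes "BL (Suc k) f" "BL k g" "\<And>x. g x \<le> N (\<lambda>y. f (x(k := y)))"
  shows "Er g \<le> Er f"
  unfolding Er_step[OF assms(1)] by (intro Er_mono[OF assms(2) BL_integrate[OF assms(1)]] assms(3))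

text \<open>Induction on the length of the second block, integrating its last coordinate first. The
  sign of \<open>P\<close> matters, since only nonnegative factors come out of
  \<open>N\<close>.\<close>

lemma Er_block_factor:
  assumes "BL n P" "\<And>x. 0 \<le> P x" "BL m f"
  shows "Er (\<lambda>x. P x * f (\<lambda>i. x (n + i))) = Er (\<lambda>x. P x * Er f)"
  using assms(3)
proof (induction m arbitrary: f)
  case 0
  have "f x = f (\<lambda>_. 0)" for x
    by (rule BL_cong[OF 0]) simp
  then have "f = (\<lambda>_. f (\<lambda>_. 0))" by blast
  then show ?case by (metis Er_const)
next
  case (Suc m)
  let ?g = "\<lambda>x. N (\<lambda>y. f (x(m := y)))"
  have BL1: "BL (Suc (n + m)) (\<lambda>x. P x * f (\<lambda>i. x (n + i)))"
    using BL_shift[OF Suc.prems, of n] by (intro blip_mult BL_mono[OF assms(1)]) auto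
  have "N (\<lambda>y. P (x(n + m := y)) * f (\<lambda>i. (x(n + m := y)) (n + i))) = P x * ?g (\<lambda>i. x (n + i))" for x
  proof -
    have "P (x(n + m := y)) = P x" for y
      by (rule BL_cong[OF assms(1)]) auto
    moreover have "(\<lambda>i. (x(n + m := y)) (n + i)) = (\<lambda>i. x (n + i))(m := y)" for y
      by auto
    ultimately show ?thesis
      using assms(2) by (simp add: N_cmult BL_section[OF Suc.prems])
  qed
  then have "Er (\<lambda>x. P x * f (\<lambda>i. x (n + i))) = Er (\<lambda>x. P x * ?g (\<lambda>i. x (n + i)))"
    by (subst Er_step[OF BL1]) simp
  also have "\<dots> = Er (\<lambda>x. P x * Er ?g)"
    by (rule Suc.IH[OF BL_integrate[OF Suc.prems]])
  also have "Er ?g = Er f"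
    by (rule Er_step[OF Suc.prems, symmetric])
  finally show ?case .
qed

text \<open>Exact, not just an inequality: with the sign reversed, each new factor multiplies the
  upper expectation of minus the product by the nonnegative constant
  \<open>1 - Er (f r)\<close>.\<close>

lemma Er_block_product:
  assumes n: "\<And>k. n (Suc k) = n k + b k"
    and f: "\<And>k. BL (b k) (f k)" "\<And>k x. f k x \<le> 1"
  shows "Er (\<lambda>x. 1 - (\<Prod>k<r. 1 - f k (\<lambda>i. x (n k + i)))) = 1 - (\<Prod>k<r. 1 - Er (f k))"
proof -
  define P where "P r x = (\<Prod>k<r. 1 - f k (\<lambda>i. x (n k + i)))" for r x
  have BLf: "BL (n r) (\<lambda>x. f k (\<lambda>i. x (n k + i)))" if "k < r" for k r
  proof (rule BL_mono)
    show "BL (n k + b k) (\<lambda>x. f k (\<lambda>i. x (n k + i)))"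
      by (rule BL_shift[OF f(1)])
    show "n k + b k \<le> n r"
      using lift_Suc_mono_le[of n "Suc k" r] that by (simp add: n)
  qed
  have BLP: "BL (n r) (P r)" for r
    unfolding P_def[abs_def] by (rule BL_prod) (auto intro: blip_diff_const BLf)
  have P_nonneg: "0 \<le> P r x" for r x
    unfolding P_def using f(2) by (intro prod_nonneg) auto
  have "Er (\<lambda>x. - P r x) = - (\<Prod>k<r. 1 - Er (f k))"
  proof (induction r)
    case (Suc r)
    have BLg: "BL (b r) (\<lambda>y. f r y + - 1)"
      by (rule blip_add_const[OF f(1)])
    have "- P (Suc r) x = P r x * (f r (\<lambda>i. x (n r + i)) + - 1)" for x
      by (simp add: P_def algebra_simps)
    then have "Er (\<lambda>x. - P (Suc r) x) = Er (\<lambda>x. P r x * (\<lambda>y. f r y + - 1) (\<lambda>i. x (n r + i)))"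
      by simp
    also have "\<dots> = Er (\<lambda>x. P r x * Er (\<lambda>y. f r y + - 1))"
      by (rule Er_block_factor[OF BLP P_nonneg BLg])
    also have "\<dots> = Er (\<lambda>x. (1 - Er (f r)) * - P r x)"
      unfolding Er_add_const[OF f(1)] by (simp add: algebra_simps)
    also have "\<dots> = (1 - Er (f r)) * Er (\<lambda>x. - P r x)"
      using Er_bounds(2)[OF f(1) f(2)] by (intro Er_cmult[OF blip_uminus[OF BLP]]) auto
    finally show ?case using Suc by simp
  qed (simp add: P_def)
  then have "Er (\<lambda>x. - P r x + 1) = 1 - (\<Prod>k<r. 1 - Er (f k))"
    unfolding Er_add_const[OF blip_uminus[OF BLP]] by simp
  then show ?thesis
    by (simp add: P_def)
qed

end

section \<open>The iterated logarithm\<close>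

lemma max_exp_pos [simp]: "0 < max (exp 1) (x::real)"
  by (simp add: less_max_iff_disj)

lemma lg_ge_1: "1 \<le> lg x"
proof -
  have "ln (exp 1) \<le> ln (max (exp 1) x)"
    by (subst ln_le_cancel_iff) auto
  then show ?thesis by (simp add: lg_def)
qed

lemma lg_mono: "x \<le> y \<Longrightarrow> lg x \<le> lg y"
  unfolding lg_def by (subst ln_le_cancel_iff) auto

lemma lg_mult_le:
  assumes "1 \<le> r" shows "lg (r * x) \<le> ln r + lg x"
proof -
  have "max (exp 1) (r * x) \<le> r * max (exp 1) x"
  proof (rule max.boundedI)
    show "exp 1 \<le> r * max (exp 1) x"
      using mult_mono[of 1 r "exp 1" "max (exp 1) x"] assms by simp
    show "r * x \<le> r * max (exp 1) x"
      using assms by (intro mult_left_mono) auto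
  qed
  moreover have "0 < max (exp 1) x" "0 < max (exp 1) (r * x)"
    by auto
  ultimately have "lg (r * x) \<le> ln (r * max (exp 1) x)"
    unfolding lg_def using assms by (subst ln_le_cancel_iff) auto
  also have "\<dots> = ln r + lg x"
    unfolding lg_def using assms by (intro ln_mult_pos max_exp_pos) simp
  finally show ?thesis .
qed

text \<open>ln r <= r - 1, and the additive term may be multiplied by \<open>lg x\<close> because
  \<open>lg\<close> is at least 1.\<close>

lemma lg_scale_le:
  assumes "1 \<le> r" shows "lg (r * x) \<le> r * lg x"
proof -
  have "lg (r * x) \<le> (r - 1) * 1 + lg x"
    using lg_mult_le[OF assms, of x] ln_le_minus_one[of r] assms by simp
  also have "\<dots> \<le> (r - 1) * lg x + lg x"
    using assms lg_ge_1[of x] by (intro add_mono mult_left_mono) auto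
  finally show ?thesis by (simp add: algebra_simps)
qed

lemma lg_le_self: "1 \<le> x \<Longrightarrow> lg x \<le> x"
  using lg_scale_le[of x 1] by (simp add: lg_def max_def)

text \<open>The iterated logarithm with the convention built in, so that it is at least 1 everywhere
  and may be divided by freely.\<close>

definition ll :: "real \<Rightarrow> real" where
  "ll x = lg (lg x)"

lemma ll_ge_1: "1 \<le> ll x"
  by (simp add: ll_def lg_ge_1)

lemma ll_pos: "0 < ll x"
  using ll_ge_1[of x] by linarith

lemma ll_mono: "x \<le> y \<Longrightarrow> ll x \<le> ll y"
  by (simp add: ll_def lg_mono)

lemma ll_scale_le:
  assumes "1 \<le> r" shows "ll (r * x) \<le> r * ll x"
  unfolding ll_def using lg_mono[OF lg_scale_le[OF assms, of x]] lg_scale_le[OF assms, of "lg x"]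
  by linarith

lemma ll_le_self: "1 \<le> x \<Longrightarrow> ll x \<le> x"
  unfolding ll_def using lg_le_self[of x] lg_le_self[OF lg_ge_1[of x]] by linarith

lemma ll_square_le:
  assumes "0 \<le> x" shows "ll (x\<^sup>2) \<le> 2 * ll x"
proof (cases "x \<le> 1")
  case True
  then have "x\<^sup>2 \<le> x"
    using assms by (simp add: power2_eq_square mult_left_le)
  then show ?thesis
    using ll_mono[of "x\<^sup>2" x] ll_ge_1[of x] by linarith
next
  case False
  then have "lg (x * x) \<le> ln x + lg x"
    by (intro lg_mult_le) auto
  moreover have "ln x \<le> lg x"
    using False unfolding lg_def by (subst ln_le_cancel_iff) auto
  ultimately have "lg (x\<^sup>2) \<le> 2 * lg x"
    by (simp add: power2_eq_square)
  then show ?thesis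
    unfolding ll_def using lg_mono[of "lg (x\<^sup>2)" "2 * lg x"] lg_scale_le[of 2 "lg x"] by linarith
qed

text \<open>The growth in \<open>r\<close> is only logarithmic. Along \<open>r = 2 ^ j\<close> this
  leaves a convergent dyadic series where the linear bound of \<open>ll_scale_le\<close> would
  not.\<close>

lemma ll_mult_le:
  assumes "1 \<le> r" shows "ll (r * x) \<le> (1 + ln r) * ll x"
proof -
  have "lg (r * x) \<le> ln r * 1 + lg x"
    using lg_mult_le[OF assms, of x] by simp
  also have "\<dots> \<le> ln r * lg x + lg x"
    using assms lg_ge_1[of x] by (intro add_mono mult_left_mono) auto
  finally have "lg (r * x) \<le> (1 + ln r) * lg x" by (simp add: algebra_simps)
  moreover have "0 \<le> ln r" using assms by simp
  ultimately show ?thesis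
    unfolding ll_def
    using lg_mono[of "lg (r * x)" "(1 + ln r) * lg x"] lg_scale_le[of "1 + ln r" "lg x"] by linarith
qed

text \<open>Turns exponentials of \<open>ll\<close> into powers of the logarithm, hence along
  geometric block ends into powers of the block number.\<close>

lemma exp_ll: "exp (ll x) = max (exp 1) (lg x)"
  unfolding ll_def lg_def[of "lg x"] by (rule exp_ln) simp

lemma filterlim_ll: "filterlim ll at_top at_top"
proof -
  have "filterlim (\<lambda>x::real. ln (ln x)) at_top at_top"
    by (intro filterlim_compose[OF ln_at_top] ln_at_top)
  moreover have "\<forall>\<^sub>F x in at_top. ln (ln x) \<le> ll x"
    using eventually_ge_at_top[of "exp 1 :: real"]
  proof eventually_elim
    case (elim x)
    then have "ln x = lg x"
      by (simp add: lg_def max_def)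
    moreover have "0 < lg x" using lg_ge_1[of x] by linarith
    ultimately show ?case
      unfolding ll_def lg_def[of "lg x"] by (simp add: max_def ln_le_cancel_iff)
  qed
  ultimately show ?thesis
    by (rule filterlim_at_top_mono)
qed

lemma lil_norm_ll: "lil_norm n = sqrt (2 * real n * ll (real n))"
  by (simp add: lil_norm_def ll_def)

lemma lil_norm_sq: "(lil_norm n)\<^sup>2 = 2 * real n * ll (real n)"
  unfolding lil_norm_ll using ll_pos[of n] by (intro real_sqrt_pow2) auto

lemma lil_norm_pos: "1 \<le> n \<Longrightarrow> 0 < lil_norm n"
  unfolding lil_norm_ll using ll_pos[of n] by simp

lemma lil_norm_nonneg: "0 \<le> lil_norm n"
  unfolding lil_norm_ll using ll_pos[of n] by simp

lemma lil_norm_mono: "m \<le> n \<Longrightarrow> lil_norm m \<le> lil_norm n"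
  unfolding lil_norm_ll using ll_pos[of m] ll_mono[of m n]
  by (intro real_sqrt_le_mono mult_mono) auto

lemma lil_norm_ge_sqrt: "sqrt (real n) \<le> lil_norm n"
proof -
  have "real n * 1 \<le> real n * (2 * ll n)"
    using ll_ge_1[of n] by (intro mult_left_mono) auto
  then show ?thesis
    unfolding lil_norm_ll by (intro real_sqrt_le_mono) (simp add: algebra_simps)
qed

definition lil_quot :: "real \<Rightarrow> real" where
  "lil_quot x = x\<^sup>2 / ll \<bar>x\<bar>"

text \<open>Writing the larger argument as \<open>r\<close> times the smaller one, the denominator
  grows at most by \<open>r\<close> while the numerator grows by its square. Monotonicity lets tails
  of \<open>lil_quot (Y 1)\<close> be read as tails of the absolute value.\<close>

lemma lil_quot_mono:
  assumes "\<bar>x\<bar> \<le> \<bar>y\<bar>" shows "lil_quot x \<le> lil_quot y"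
proof (cases "x = 0")
  case True
  then show ?thesis
    using ll_pos[of "\<bar>y\<bar>"] by (simp add: lil_quot_def)
next
  case False
  define r where "r = \<bar>y\<bar> / \<bar>x\<bar>"
  have r: "1 \<le> r" "\<bar>y\<bar> = r * \<bar>x\<bar>"
    using False assms by (auto simp: r_def)
  have "ll \<bar>y\<bar> \<le> r * ll \<bar>x\<bar>"
    unfolding r(2) by (rule ll_scale_le[OF r(1)])
  also have "\<dots> \<le> r\<^sup>2 * ll \<bar>x\<bar>"
    using r(1) ll_pos[of "\<bar>x\<bar>"] by (intro mult_right_mono) (auto simp: power2_eq_square)
  finally have "x\<^sup>2 * ll \<bar>y\<bar> \<le> x\<^sup>2 * (r\<^sup>2 * ll \<bar>x\<bar>)"
    by (intro mult_left_mono) auto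
  also have "\<dots> = (r * \<bar>x\<bar>)\<^sup>2 * ll \<bar>x\<bar>"
    by (simp add: power_mult_distrib)
  also have "\<dots> = y\<^sup>2 * ll \<bar>x\<bar>"
    unfolding r(2)[symmetric] by simp
  finally show ?thesis
    unfolding lil_quot_def using ll_pos[of "\<bar>x\<bar>"] ll_pos[of "\<bar>y\<bar>"] by (simp add: field_simps)
qed

lemma lil_quot_nonneg: "0 \<le> lil_quot x"
  unfolding lil_quot_def using ll_pos[of "\<bar>x\<bar>"] by simp

text \<open>Level \<open>C * lil_norm m\<close> for a summand corresponds to a level of order
  \<open>m\<close> for \<open>lil_quot\<close>. The strict inequality is what \<open>F_le_G\<close>
  consumes, and it fails at \<open>m = 0\<close>.\<close>

lemma lil_quot_norm_bound:
  assumes "0 < C"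
  shows "\<exists>D>0. \<forall>m. lil_quot (C * lil_norm m) < D * real m \<or> m = 0"
proof -
  define r where "r = max 1 (1 / C)"
  have r: "1 \<le> r" "1 \<le> r * C" using assms by (auto simp: r_def max_def field_simps)
  define D where "D = 4 * C\<^sup>2 * r + 1"
  have "lil_quot (C * lil_norm m) < D * real m" if "m \<noteq> 0" for m
  proof -
    have "sqrt m \<le> r * (C * lil_norm m)"
    proof -
      have "sqrt m * 1 \<le> lil_norm m * (r * C)"
        using r lil_norm_ge_sqrt[of m] lil_norm_nonneg[of m] by (intro mult_mono) auto
      then show ?thesis by (simp add: algebra_simps)
    qed
    then have "ll (sqrt m) \<le> r * ll (C * lil_norm m)"
      using ll_mono ll_scale_le[OF r(1)] by (meson order_trans)
    moreover have "ll (real m) \<le> 2 * ll (sqrt m)"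
      using ll_square_le[of "sqrt m"] by simp
    ultimately have "ll (real m) \<le> 2 * r * ll (C * lil_norm m)" by simp
    then have "C\<^sup>2 * (2 * real m * ll (real m)) \<le> C\<^sup>2 * (2 * real m * (2 * r * ll (C * lil_norm m)))"
      by (intro mult_left_mono) auto
    also have "\<dots> = (4 * C\<^sup>2 * r) * real m * ll (C * lil_norm m)"
      by (simp add: algebra_simps)
    also have "\<dots> < D * real m * ll (C * lil_norm m)"
      unfolding D_def using that ll_pos by (intro mult_strict_right_mono) auto
    finally have "(C * lil_norm m)\<^sup>2 < D * real m * ll (C * lil_norm m)"
      by (simp add: power_mult_distrib lil_norm_sq)
    moreover have "\<bar>C * lil_norm m\<bar> = C * lil_norm m"
      using assms lil_norm_nonneg[of m] by simp
    ultimately show ?thesis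
      unfolding lil_quot_def using ll_pos by (simp add: divide_less_eq)
  qed
  moreover have "D > 0" using r by (simp add: D_def add_nonneg_pos)
  ultimately show ?thesis by blast
qed


section \<open>Antitone tails and their integrals\<close>

text \<open>A lower Riemann sum on an arbitrary partition; geometric partitions match geometric
  blocks.\<close>

lemma antimono_integral_sum_le:
  fixes F :: "real \<Rightarrow> real"
  assumes F: "antimono F" "\<And>t. 0 \<le> F t"
    and fin: "(\<integral>\<^sup>+ t \<in> {0..}. ennreal (F t) \<partial>lborel) = ennreal J" "0 \<le> J"
    and \<tau>: "incseq \<tau>" "0 \<le> \<tau> 0"
  shows "(\<Sum>k<r. (\<tau> (Suc k) - \<tau> k) * F (\<tau> (Suc k))) \<le> J"
proof -
  let ?I = "\<lambda>k. {\<tau> k <.. \<tau> (Suc k)}"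
  have disj: "(\<Sum>k<r. ennreal (F (\<tau> (Suc k))) * indicator (?I k) t) \<le> ennreal (F t) * indicator {0..} t" for t
  proof (cases "\<exists>k<r. t \<in> ?I k")
    case True
    then obtain k where k: "k < r" "t \<in> ?I k" by blast
    have uniq: "j = k" if "t \<in> ?I j" for j
    proof (rule ccontr)
      assume "j \<noteq> k"
      then consider "Suc j \<le> k" | "Suc k \<le> j" by linarith
      then show False
        using incseqD[OF \<tau>(1), of "Suc j" k] incseqD[OF \<tau>(1), of "Suc k" j] k that by cases auto
    qed
    have "ennreal (F (\<tau> (Suc j))) * indicator (?I j) t = (if j = k then ennreal (F (\<tau> (Suc k))) else 0)" for j
    proof (cases "j = k")
      case True
      then show ?thesis using k(2) by (simp only: indicator_simps if_True mult_1_right refl)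
    next
      case False
      then have "t \<notin> ?I j" using uniq by blast
      then show ?thesis using False by (simp only: indicator_eq_0_iff[THEN iffD2] if_False mult_zero_right refl not_False_eq_True)
    qed
    then have "(\<Sum>j<r. ennreal (F (\<tau> (Suc j))) * indicator (?I j) t)
        = (\<Sum>j<r. if j = k then ennreal (F (\<tau> (Suc k))) else 0)"
      by (intro sum.cong) simp_all
    also have "\<dots> = ennreal (F (\<tau> (Suc k)))"
      using k by simp
    also have "\<dots> \<le> ennreal (F t)"
      using k F(1) by (intro ennreal_leI) (auto simp: antimono_def)
    also have "\<dots> = ennreal (F t) * indicator {0..} t"
      using k \<tau>(2) incseqD[OF \<tau>(1), of 0 k] by (auto simp: indicator_def)
    finally show ?thesis .
  next
    case False
    then have "(\<Sum>k<r. ennreal (F (\<tau> (Suc k))) * indicator (?I k) t) = 0"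
      by (intro sum.neutral) (auto simp: indicator_def)
    then show ?thesis by simp
  qed
  have nn: "0 \<le> (\<tau> (Suc k) - \<tau> k) * F (\<tau> (Suc k))" for k
    using incseqD[OF \<tau>(1), of k "Suc k"] F(2) by simp
  have int: "ennreal ((\<tau> (Suc k) - \<tau> k) * F (\<tau> (Suc k)))
      = (\<integral>\<^sup>+ t. ennreal (F (\<tau> (Suc k))) * indicator (?I k) t \<partial>lborel)" for k
  proof -
    have "(\<integral>\<^sup>+ t. ennreal (F (\<tau> (Suc k))) * indicator (?I k) t \<partial>lborel)
        = ennreal (F (\<tau> (Suc k))) * emeasure lborel (?I k)"
      by (rule nn_integral_cmult_indicator) simp
    also have "emeasure lborel (?I k) = ennreal (\<tau> (Suc k) - \<tau> k)"
      using incseqD[OF \<tau>(1), of k "Suc k"] by (subst emeasure_lborel_Ioc) simp_all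
    also have "ennreal (F (\<tau> (Suc k))) * ennreal (\<tau> (Suc k) - \<tau> k)
        = ennreal (F (\<tau> (Suc k)) * (\<tau> (Suc k) - \<tau> k))"
      by (rule ennreal_mult'[symmetric]) (rule F(2))
    finally show ?thesis by (simp only: mult.commute)
  qed
  have "ennreal (\<Sum>k<r. (\<tau> (Suc k) - \<tau> k) * F (\<tau> (Suc k)))
      = (\<Sum>k<r. ennreal ((\<tau> (Suc k) - \<tau> k) * F (\<tau> (Suc k))))"
    by (rule sum_ennreal[symmetric]) (rule nn)
  also have "\<dots> = (\<Sum>k<r. \<integral>\<^sup>+ t. ennreal (F (\<tau> (Suc k))) * indicator (?I k) t \<partial>lborel)"
    by (simp only: int)
  also have "\<dots> = (\<integral>\<^sup>+ t. (\<Sum>k<r. ennreal (F (\<tau> (Suc k))) * indicator (?I k) t) \<partial>lborel)"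
    by (intro nn_integral_sum[symmetric]) auto
  also have "\<dots> \<le> (\<integral>\<^sup>+ t. ennreal (F t) * indicator {0..} t \<partial>lborel)"
    by (intro nn_integral_mono disj)
  also have "\<dots> = ennreal J" by (rule fin(1))
  finally show ?thesis
    using fin(2) by (simp only: ennreal_le_iff)
qed

text \<open>The converse direction of the integral test: an upper Riemann sum of mesh
  \<open>D\<close>.\<close>

lemma antimono_integral_finite:
  fixes F :: "real \<Rightarrow> real"
  assumes F: "antimono F" "\<And>t. 0 \<le> F t" and D: "0 < D"
    and sum: "summable (\<lambda>m. F (D * real m))"
  shows "(\<integral>\<^sup>+ t \<in> {0..}. ennreal (F t) \<partial>lborel) < \<infinity>"
proof -
  let ?I = "\<lambda>m::nat. {D * real m ..< D * real (Suc m)}"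
  have le: "ennreal (F t) * indicator {0..} t \<le> (\<Sum>m. ennreal (F (D * real m)) * indicator (?I m) t)" for t
  proof (cases "0 \<le> t")
    case True
    define m where "m = nat \<lfloor>t / D\<rfloor>"
    have m: "real m \<le> t / D" "t / D < real m + 1"
      using True D by (auto simp: m_def)
    then have t: "D * real m \<le> t" "t < D * (real m + 1)"
      using D by (auto simp: field_simps)
    have "ennreal (F t) \<le> ennreal (F (D * real m)) * indicator (?I m) t"
      using t F(1) by (auto simp: antimono_def algebra_simps intro!: ennreal_leI)
    also have "\<dots> \<le> (\<Sum>m. ennreal (F (D * real m)) * indicator (?I m) t)"
    proof -
      have "sum (\<lambda>m. ennreal (F (D * real m)) * indicator (?I m) t) {m}
          \<le> (\<Sum>m. ennreal (F (D * real m)) * indicator (?I m) t)"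
        by (rule sum_le_suminf) auto
      then show ?thesis by (simp only: sum.insert finite.emptyI empty_iff sum.empty add_0_right not_False_eq_True)
    qed
    finally show ?thesis using True by simp
  qed simp
  have "(\<integral>\<^sup>+ t \<in> {0..}. ennreal (F t) \<partial>lborel)
      \<le> (\<integral>\<^sup>+ t. (\<Sum>m. ennreal (F (D * real m)) * indicator (?I m) t) \<partial>lborel)"
    by (intro nn_integral_mono le)
  also have "\<dots> = (\<Sum>m. \<integral>\<^sup>+ t. ennreal (F (D * real m)) * indicator (?I m) t \<partial>lborel)"
    by (intro nn_integral_suminf) auto
  also have "\<dots> = (\<Sum>m. ennreal (D * F (D * real m)))"
  proof (intro suminf_cong)
    fix m
    have "(\<integral>\<^sup>+ t. ennreal (F (D * real m)) * indicator (?I m) t \<partial>lborel)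
        = ennreal (F (D * real m)) * emeasure lborel (?I m)"
      by (rule nn_integral_cmult_indicator) auto
    also have "emeasure lborel (?I m) = ennreal D"
      using D by (subst emeasure_lborel_Ico) (auto simp: algebra_simps)
    finally show "(\<integral>\<^sup>+ t. ennreal (F (D * real m)) * indicator (?I m) t \<partial>lborel)
        = ennreal (D * F (D * real m))"
      using D F(2) by (simp add: ennreal_mult' mult.commute)
  qed
  also have "\<dots> = ennreal (\<Sum>m. D * F (D * real m))"
    using D F(2) by (intro suminf_ennreal2 summable_mult sum) auto
  also have "\<dots> < \<infinity>" by simp
  finally show ?thesis .
qed

text \<open>The terms of the convergent dyadic lower sum tend to zero, and between consecutive
  powers of 2 monotonicity loses only a factor 4.\<close>

lemma antimono_integral_tail:
  fixes F :: "real \<Rightarrow> real"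
  assumes F: "antimono F" "\<And>t. 0 \<le> F t"
    and fin: "(\<integral>\<^sup>+ t \<in> {0..}. ennreal (F t) \<partial>lborel) = ennreal J" "0 \<le> J"
    and "0 < \<epsilon>"
  shows "\<exists>T>0. \<forall>t\<ge>T. t * F t \<le> \<epsilon>"
proof -
  have "(\<Sum>k<r. (2 ^ Suc k - 2 ^ k) * F (2 ^ Suc k)) \<le> J" for r
    by (rule antimono_integral_sum_le[OF F fin]) (auto simp: incseq_def power_increasing)
  then have "summable (\<lambda>k. 2 ^ k * F (2 ^ Suc k))"
    using F(2) by (intro summableI_nonneg_bounded[of _ J]) auto
  then have "(\<lambda>k. 2 ^ k * F (2 ^ Suc k)) \<longlonglongrightarrow> 0"
    by (rule summable_LIMSEQ_zero)
  then have "eventually (\<lambda>k. 2 ^ k * F (2 ^ Suc k) < \<epsilon> / 4) sequentially"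
    using \<open>0 < \<epsilon>\<close> by (intro order_tendstoD) auto
  then obtain k0 where k0: "2 ^ k * F (2 ^ Suc k) < \<epsilon> / 4" if "k \<ge> k0" for k
    by (auto simp: eventually_sequentially)
  have "t * F t \<le> \<epsilon>" if t: "2 ^ Suc k0 \<le> t" for t
  proof -
    define j where "j = nat \<lfloor>log 2 t\<rfloor>"
    have t1: "1 \<le> t" using one_le_power[of "2::real" "Suc k0"] t by linarith
    then have j: "real j \<le> log 2 t" "log 2 t < real j + 1"
      by (auto simp: j_def)
    have "2 powr real j \<le> 2 powr log 2 t" "2 powr log 2 t < 2 powr real (Suc j)"
      using j by (auto intro: powr_mono powr_less_mono)
    then have j1: "2 ^ j \<le> t" "t < 2 ^ Suc j"
      using t1 by (simp_all add: powr_realpow del: of_nat_Suc power_Suc)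
    have "k0 < j"
    proof (rule ccontr)
      assume "\<not> k0 < j"
      then have "(2::real) ^ Suc j \<le> 2 ^ Suc k0" by (intro power_increasing) auto
      with t j1 show False by linarith
    qed
    then obtain i where i: "j = Suc i" "i \<ge> k0" by (cases j) auto
    have "t * F t \<le> 2 ^ Suc j * F (2 ^ j)"
      using j1 F t1 by (intro mult_mono) (auto simp: antimono_def)
    also have "\<dots> = 4 * (2 ^ i * F (2 ^ Suc i))" using i by simp
    also have "\<dots> \<le> \<epsilon>" using k0[OF i(2)] by simp
    finally show ?thesis .
  qed
  then show ?thesis by (intro exI[of _ "2 ^ Suc k0"]) auto
qed

section \<open>The capacity and the expectation\<close>

lemma sum_Suc_div_power2: "(\<Sum>j<n. (1 + real j) / 2 ^ j) \<le> 4"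
proof -
  have "(\<Sum>j<n. (1 + real j) / 2 ^ j) = 4 - 2 * (real n + 2) / 2 ^ n"
  proof (induction n)
    case (Suc n)
    have "(\<Sum>j<Suc n. (1 + real j) / 2 ^ j) = 4 - 2 * (real n + 2) / 2 ^ n + (1 + real n) / 2 ^ n"
      by (simp only: sum.lessThan_Suc Suc)
    also have "\<dots> = 4 - 2 * (real (Suc n) + 2) / 2 ^ Suc n"
      by (simp add: field_simps)
    finally show ?case .
  qed simp
  then show ?thesis by simp
qed

locale lil_setting = iid_seq M H E Y
  for M :: "'a measure" and H E Y +
  fixes V :: "'a set \<Rightarrow> real"
  assumes cap: "subadditive_capacity M V"
    and propC: "property_C M H E V"
begin

lemma V_nonneg: "A \<in> sets M \<Longrightarrow> 0 \<le> V A"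
  and V_le_1: "A \<in> sets M \<Longrightarrow> V A \<le> 1"
  and V_mono: "A \<in> sets M \<Longrightarrow> B \<in> sets M \<Longrightarrow> A \<subseteq> B \<Longrightarrow> V A \<le> V B"
  and V_Un: "A \<in> sets M \<Longrightarrow> B \<in> sets M \<Longrightarrow> V (A \<union> B) \<le> V A + V B"
  and V_space: "V (space M) = 1"
  using cap unfolding subadditive_capacity_def subadditive_capacity_axioms_def capacity_def
  by auto

lemma Y_measurable: "n \<ge> 1 \<Longrightarrow> Y n \<in> borel_measurable M"
  using Y_in_H measurable by blast

lemma path_measurable [measurable]: "(\<lambda>\<omega>. path \<omega> i) \<in> borel_measurable M"
  unfolding path_def by (rule Y_measurable) simp

lemma partial_sum_path: "partial_sum Y n \<omega> = (\<Sum>i<n. path \<omega> i)"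
  by (simp add: partial_sum_def path_def sum.atLeast1_atMost_eq)

lemma V_ge_Er:
  assumes "BL k f" "A \<in> sets M" "\<And>\<omega>. \<omega> \<in> space M \<Longrightarrow> f (path \<omega>) \<le> indicator A \<omega>"
  shows "Er f \<le> V A"
proof -
  have "E (\<lambda>\<omega>. f (path \<omega>)) \<le> ereal (V A)"
    using propC[unfolded property_C_def, rule_format, OF BL_path_in_H[OF assms(1)] const_in_H[of 1] assms(2)]
      assms(3) by (auto simp: indicator_def)
  then show ?thesis using Er_eq[OF assms(1)] by simp
qed

lemma V_le_Er:
  assumes "BL k f" "A \<in> sets M" "\<And>\<omega>. \<omega> \<in> space M \<Longrightarrow> indicator A \<omega> \<le> f (path \<omega>)"
  shows "V A \<le> Er f"
proof -
  have "ereal (V A) \<le> E (\<lambda>\<omega>. f (path \<omega>))"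
    using propC[unfolded property_C_def, rule_format, OF const_in_H[of 0] BL_path_in_H[OF assms(1)] assms(2)]
      assms(3) by (auto simp: indicator_def)
  then show ?thesis using Er_eq[OF assms(1)] by simp
qed

text \<open>Two tails of the same variable: \<open>G\<close> in terms of its absolute value,
  \<open>F\<close> in terms of \<open>lil_quot\<close>, the integrand of the Choquet
  condition.\<close>

definition G :: "real \<Rightarrow> real" where
  "G s = V {\<omega> \<in> space M. s \<le> \<bar>Y 1 \<omega>\<bar>}"

definition F :: "real \<Rightarrow> real" where
  "F t = V {\<omega> \<in> space M. t \<le> lil_quot (Y 1 \<omega>)}"

lemma lil_quot_measurable [measurable]: "lil_quot \<in> borel_measurable borel"
  unfolding lil_quot_def[abs_def] ll_def[abs_def] lg_def[abs_def] by measurable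

lemma sets_G [measurable]: "{\<omega> \<in> space M. s \<le> \<bar>Y 1 \<omega>\<bar>} \<in> sets M"
  using Y_measurable[of 1, measurable] by measurable

lemma sets_F [measurable]: "{\<omega> \<in> space M. t \<le> lil_quot (Y 1 \<omega>)} \<in> sets M"
  using Y_measurable[of 1, measurable] by measurable

lemma F_antimono: "antimono F"
  unfolding antimono_def F_def by (intro allI impI V_mono sets_F) auto

lemma F_nonneg: "0 \<le> F t"
  unfolding F_def by (intro V_nonneg) measurable

lemma G_nonneg: "0 \<le> G s"
  unfolding G_def by (intro V_nonneg) measurable

lemma G_le_F: "0 \<le> s \<Longrightarrow> G s \<le> F (lil_quot s)"
  unfolding G_def F_def by (intro V_mono sets_G sets_F) (auto intro: lil_quot_mono)

lemma F_le_G: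
  assumes "lil_quot s < t" "0 \<le> s" shows "F t \<le> G s"
proof -
  have "s \<le> \<bar>y\<bar>" if "t \<le> lil_quot y" for y
    using lil_quot_mono[of y s] that assms by force
  then show ?thesis
    unfolding G_def F_def by (intro V_mono sets_G sets_F) auto
qed

text \<open>This lemma and \<open>G_le_N\<close> are the two halves of property (C) for tail events:
  Lipschitz functions below or above the indicator.\<close>

lemma N_le_G:
  assumes "LB \<phi>" "\<And>x. \<phi> x \<le> 1" "\<And>x. 0 < \<phi> x \<Longrightarrow> s \<le> \<bar>x\<bar>"
  shows "N \<phi> \<le> G s"
  unfolding N_def G_def
proof (rule V_ge_Er[OF LB_BL[OF assms(1)] sets_G])
  fix \<omega> assume "\<omega> \<in> space M"
  then show "\<phi> (path \<omega> 0) \<le> indicator {\<omega> \<in> space M. s \<le> \<bar>Y 1 \<omega>\<bar>} \<omega>"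
    using assms(2,3)[of "Y 1 \<omega>"]
    by (cases "0 < \<phi> (Y 1 \<omega>)") (auto simp: indicator_def path_def not_less)
qed

lemma G_le_N:
  assumes "LB \<phi>" "\<And>x. 0 \<le> \<phi> x" "\<And>x. s \<le> \<bar>x\<bar> \<Longrightarrow> 1 \<le> \<phi> x"
  shows "G s \<le> N \<phi>"
  unfolding N_def G_def
proof (rule V_le_Er[OF LB_BL[OF assms(1)] sets_G])
  fix \<omega> assume "\<omega> \<in> space M"
  then show "indicator {\<omega> \<in> space M. s \<le> \<bar>Y 1 \<omega>\<bar>} \<omega> \<le> \<phi> (path \<omega> 0)"
    using assms(2,3)[of "Y 1 \<omega>"] by (auto simp: indicator_def path_def)
qed

definition choquet_fin :: bool where
  "choquet_fin \<longleftrightarrow> (\<integral>\<^sup>+ t \<in> {0..}. ennreal (F t) \<partial>lborel) < \<infinity>"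

text \<open>The second part of the Choquet integral vanishes because \<open>lil_quot\<close> is
  nonnegative.\<close>

lemma choquet_fin_iff:
  "choquet_integral M V (\<lambda>\<omega>. (Y 1 \<omega>)\<^sup>2 / lg (lg \<bar>Y 1 \<omega>\<bar>)) < \<infinity> \<longleftrightarrow> choquet_fin"
proof -
  have "(1 - V {\<omega> \<in> space M. t \<le> lil_quot (Y 1 \<omega>)}) = 0" if "t \<le> 0" for t
  proof -
    have "{\<omega> \<in> space M. t \<le> lil_quot (Y 1 \<omega>)} = space M"
      using that lil_quot_nonneg by (auto intro: order_trans)
    then show ?thesis by (simp add: V_space)
  qed
  then have "(\<integral>\<^sup>+ t \<in> {..0}. ennreal (1 - V {\<omega> \<in> space M. t \<le> lil_quot (Y 1 \<omega>)}) \<partial>lborel) = 0"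
    by (subst nn_integral_cong[where v = "\<lambda>_. 0"]) (auto simp: indicator_def)
  then have "choquet_integral M V (\<lambda>\<omega>. lil_quot (Y 1 \<omega>))
      = enn2ereal (\<integral>\<^sup>+ t \<in> {0..}. ennreal (F t) \<partial>lborel)"
    unfolding choquet_integral_def F_def by (simp add: zero_ennreal.rep_eq)
  moreover have "(\<lambda>\<omega>. lil_quot (Y 1 \<omega>)) = (\<lambda>\<omega>. (Y 1 \<omega>)\<^sup>2 / lg (lg \<bar>Y 1 \<omega>\<bar>))"
    by (simp add: lil_quot_def ll_def)
  moreover have "enn2ereal u < \<infinity> \<longleftrightarrow> u < \<infinity>" for u
    by (cases u rule: ennreal_cases) (auto simp: top_ennreal.rep_eq)
  ultimately show ?thesis
    unfolding choquet_fin_def by simp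
qed

lemma choquet_finE:
  assumes choquet_fin
  obtains J where "0 \<le> J" "(\<integral>\<^sup>+ t \<in> {0..}. ennreal (F t) \<partial>lborel) = ennreal J"
  using assms unfolding choquet_fin_def by (cases "\<integral>\<^sup>+ t \<in> {0..}. ennreal (F t) \<partial>lborel" rule: ennreal_cases) auto

text \<open>A weak-type consequence of condition (1), with an arbitrarily small constant: evaluate t
  F(t) -> 0 at t = s^2 / ll s.\<close>

lemma G_tail:
  assumes choquet_fin "0 < \<epsilon>"
  shows "\<exists>s0>0. \<forall>s\<ge>s0. G s \<le> \<epsilon> * ll s / s\<^sup>2"
proof -
  obtain J where J: "0 \<le> J" "(\<integral>\<^sup>+ t \<in> {0..}. ennreal (F t) \<partial>lborel) = ennreal J"
    using choquet_finE[OF assms(1)] by metis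
  obtain T where T: "T > 0" "\<And>t. t \<ge> T \<Longrightarrow> t * F t \<le> \<epsilon>"
    using antimono_integral_tail[OF F_antimono F_nonneg J(2,1) assms(2)] by metis
  have "G s \<le> \<epsilon> * ll s / s\<^sup>2" if s: "max 1 T \<le> s" for s
  proof -
    have q: "lil_quot s = s\<^sup>2 / ll s" using s by (simp add: lil_quot_def)
    have "s * ll s \<le> s * s" using ll_le_self[of s] s by (intro mult_left_mono) auto
    then have "s \<le> lil_quot s"
      unfolding q using ll_pos[of s] by (simp add: field_simps power2_eq_square)
    then have "lil_quot s * F (lil_quot s) \<le> \<epsilon>" "0 < lil_quot s"
      using T(2)[of "lil_quot s"] s by auto
    then have "F (lil_quot s) \<le> \<epsilon> / lil_quot s" by (simp add: field_simps)
    then show ?thesis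
      using G_le_F[of s] s by (simp add: q)
  qed
  then show ?thesis by (intro exI[of _ "max 1 T"]) auto
qed

text \<open>The difference lives on |x| >= a and is at most \<open>a\<close> there. The ramp starts
  at \<open>a / 2\<close> because the indicator of that event is not admissible.\<close>

lemma N_trunc_double:
  assumes "0 < a" "a \<le> z" "z \<le> 2 * a"
  shows "N (\<lambda>x. \<bar>trunc z x - trunc a x\<bar>) \<le> a * G (a / 2)"
proof -
  let ?h = "\<lambda>x. ramp (a / 2) a \<bar>x\<bar>"
  have LBh: "LB ?h"
    using assms by (intro blip_LB_comp[OF LB_ramp, where L = 1]) auto
  have "N (\<lambda>x. \<bar>trunc z x - trunc a x\<bar>) \<le> N (\<lambda>x. a * ?h x)"
  proof (intro N_mono blip_abs blip_diff LB_trunc blip_cmult LBh)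
    show "\<bar>trunc z x - trunc a x\<bar> \<le> a * ?h x" for x
    proof (cases "\<bar>x\<bar> < a")
      case True
      then have "trunc z x = trunc a x" using assms by (auto simp: trunc_def)
      then show ?thesis using assms ramp_range[of "a / 2" a "\<bar>x\<bar>"] by simp
    next
      case False
      then show ?thesis
        using assms ramp_eq_1[of "a / 2" a "\<bar>x\<bar>"] unfolding trunc_def max_def min_def
        by (simp split: if_splits)
    qed
  qed
  also have "\<dots> = a * N ?h"
    using assms by (intro N_cmult LBh) auto
  also have "\<dots> \<le> a * G (a / 2)"
    using assms by (intro mult_left_mono N_le_G LBh) (auto simp: ramp_range dest: ramp_pos[rotated])
  finally show ?thesis .
qed

lemma N_trunc_dyadic:
  assumes "0 < y" "y \<le> z" "z \<le> 2 ^ n * y"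
  shows "N (\<lambda>x. \<bar>trunc z x - trunc y x\<bar>) \<le> (\<Sum>j<n. 2 ^ j * y * G (2 ^ j * y / 2))"
  using assms(2,3)
proof (induction n arbitrary: z)
  case (Suc n)
  let ?a = "2 ^ n * y"
  have nn: "0 \<le> ?a * G (?a / 2)"
    using assms(1) G_nonneg by simp
  show ?case
  proof (cases "z \<le> ?a")
    case True
    then show ?thesis using Suc.IH[OF Suc.prems(1) True] nn by simp
  next
    case False
    have "y \<le> ?a"
      using assms(1) mult_right_mono[of 1 "2 ^ n" y] by simp
    have "N (\<lambda>x. \<bar>trunc z x - trunc y x\<bar>)
        \<le> N (\<lambda>x. \<bar>trunc z x - trunc ?a x\<bar> + \<bar>trunc ?a x - trunc y x\<bar>)"
      by (intro N_mono blip_add blip_abs blip_diff LB_trunc) auto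
    also have "\<dots> \<le> N (\<lambda>x. \<bar>trunc z x - trunc ?a x\<bar>) + N (\<lambda>x. \<bar>trunc ?a x - trunc y x\<bar>)"
      by (intro N_add blip_abs blip_diff LB_trunc)
    also have "\<dots> \<le> ?a * G (?a / 2) + (\<Sum>j<n. 2 ^ j * y * G (2 ^ j * y / 2))"
      using False Suc.prems assms(1) by (intro add_mono N_trunc_double Suc.IH \<open>y \<le> ?a\<close>) auto
    finally show ?thesis by simp
  qed
qed (use assms in auto)

text \<open>Available before any second moment bound. At y of order sqrt(n ll n), a mean of size ll
  y / y adds up over n steps to the order of \<open>lil_norm n\<close>, so an arbitrarily small
  constant makes the drift negligible.\<close>

lemma N_trunc_tail:
  assumes choquet_fin "0 < \<epsilon>"
  shows "\<exists>y0>0. \<forall>y\<ge>y0. \<forall>z\<ge>y. N (\<lambda>x. \<bar>trunc z x - trunc y x\<bar>) \<le> \<epsilon> * ll y / y"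
proof -
  \<comment> \<open>The 16 is 4 from evaluating the tail at half the level, times 4 for the sum of
    (1 + j) / 2^j.\<close>
  obtain s0 where s0: "s0 > 0" "\<And>s. s \<ge> s0 \<Longrightarrow> G s \<le> \<epsilon> / 16 * ll s / s\<^sup>2"
    using G_tail[OF assms(1), of "\<epsilon> / 16"] assms(2) by auto
  have "N (\<lambda>x. \<bar>trunc z x - trunc y x\<bar>) \<le> \<epsilon> * ll y / y" if y: "y \<ge> 2 * s0" "y \<le> z" for y z
  proof -
    have y0: "y > 0" using y s0 by linarith
    obtain n where "z / y < 2 ^ n"
      using real_arch_pow[of 2 "z / y"] by auto
    then have n: "z \<le> 2 ^ n * y" using y0 by (simp add: field_simps)
    have "2 ^ j * y * G (2 ^ j * y / 2) \<le> \<epsilon> / 4 * ll y / y * ((1 + real j) / 2 ^ j)" for j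
    proof -
      have "2 ^ j * y \<ge> 1 * y"
        using y0 by (intro mult_right_mono one_le_power) auto
      then have "2 ^ j * y / 2 \<ge> s0" using y by linarith
      then have "G (2 ^ j * y / 2) \<le> \<epsilon> / 16 * ll (2 ^ j * y / 2) / (2 ^ j * y / 2)\<^sup>2"
        by (rule s0(2))
      also have "\<dots> \<le> \<epsilon> / 16 * ((1 + real j) * ll y) / (2 ^ j * y / 2)\<^sup>2"
      proof -
        have "ll (2 ^ j * y / 2) \<le> ll (2 ^ j * y)"
          using y0 by (intro ll_mono) auto
        also have "\<dots> \<le> (1 + ln (2 ^ j)) * ll y"
          by (intro ll_mult_le) auto
        also have "\<dots> \<le> (1 + real j) * ll y"
          using ln_le_minus_one[of "2::real"] ll_pos[of y]
          by (intro mult_right_mono) (auto simp: ln_realpow mult_left_le)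
        finally show ?thesis
          using assms(2) by (intro divide_right_mono mult_left_mono) auto
      qed
      also have "2 ^ j * y * \<dots> = \<epsilon> / 4 * ll y / y * ((1 + real j) / 2 ^ j)"
        using y0 by (simp add: field_simps power2_eq_square)
      finally show ?thesis
        using y0 by (simp add: mult_left_mono)
    qed
    then have "(\<Sum>j<n. 2 ^ j * y * G (2 ^ j * y / 2)) \<le> (\<Sum>j<n. \<epsilon> / 4 * ll y / y * ((1 + real j) / 2 ^ j))"
      by (intro sum_mono)
    also have "\<dots> = \<epsilon> / 4 * ll y / y * (\<Sum>j<n. (1 + real j) / 2 ^ j)"
      by (simp add: sum_distrib_left)
    also have "\<dots> \<le> \<epsilon> / 4 * ll y / y * 4"
      using assms(2) y0 ll_pos[of y] by (intro mult_left_mono sum_Suc_div_power2) auto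
    finally show ?thesis
      using N_trunc_dyadic[OF y0 y(2) n] by simp
  qed
  then show ?thesis using s0(1) by (intro exI[of _ "2 * s0"]) auto
qed

end


section \<open>Weights of paths that have not crossed a level\<close>

definition wsum :: "(real \<Rightarrow> real) \<Rightarrow> nat \<Rightarrow> (nat \<Rightarrow> real) \<Rightarrow> real" where
  "wsum \<xi> n x = (\<Sum>i<n. \<xi> (x i))"

text \<open>The weight of a path killed with weight \<open>h\<close> at each position it visits at
  times 1 to \<open>n\<close>. It replaces the indicator that no exit has happened, and
  \<open>1 - stay\<close> is the exit event in bounded Lipschitz form.\<close>

definition stay :: "(real \<Rightarrow> real) \<Rightarrow> (real \<Rightarrow> real) \<Rightarrow> nat \<Rightarrow> (nat \<Rightarrow> real) \<Rightarrow> real" where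
  "stay h \<xi> n x = (\<Prod>j<n. 1 - h (wsum \<xi> (Suc j) x))"

lemma BL_wsum: "LB \<xi> \<Longrightarrow> n \<le> k \<Longrightarrow> BL k (wsum \<xi> n)"
  unfolding wsum_def[abs_def] by (intro BL_sum BL_coord) auto

lemma BL_stay:
  assumes "LB \<xi>" "LB h" "n \<le> k" shows "BL k (stay h \<xi> n)"
  unfolding stay_def[abs_def]
proof (rule BL_prod)
  fix j assume "j \<in> {..<n}"
  then have "BL k (wsum \<xi> (Suc j))"
    using assms by (intro BL_wsum) auto
  then show "BL k (\<lambda>x. 1 - h (wsum \<xi> (Suc j) x))"
    by (intro blip_diff_const blip_LB_blip[OF assms(2)])
qed auto

lemma wsum_0 [simp]: "wsum \<xi> 0 x = 0"
  and stay_0 [simp]: "stay h \<xi> 0 x = 1"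
  by (simp_all add: wsum_def stay_def)

lemma stay_Suc: "stay h \<xi> (Suc n) x = stay h \<xi> n x * (1 - h (wsum \<xi> (Suc n) x))"
  by (simp add: stay_def)

lemma wsum_upd: "n \<le> k \<Longrightarrow> wsum \<xi> n (x(k := y)) = wsum \<xi> n x"
  unfolding wsum_def by (intro sum.cong) auto

lemma wsum_Suc_upd: "wsum \<xi> (Suc n) (x(n := y)) = wsum \<xi> n x + \<xi> y"
  using wsum_upd[of n n \<xi> x y] by (simp add: wsum_def)

lemma stay_upd: "n \<le> k \<Longrightarrow> stay h \<xi> n (x(k := y)) = stay h \<xi> n x"
  unfolding stay_def by (intro prod.cong refl) (simp add: wsum_upd)

lemma stay_range:
  assumes "\<And>s. 0 \<le> h s" "\<And>s. h s \<le> 1"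
  shows "0 \<le> stay h \<xi> n x" "stay h \<xi> n x \<le> 1"
  unfolding stay_def using assms by (auto intro!: prod_nonneg prod_le_1)

text \<open>A path that still has weight sits where killing is not total; this confines the present
  position in all potential arguments.\<close>

lemma stay_pos_last:
  assumes "0 < stay h \<xi> n x" "0 < n" shows "h (wsum \<xi> n x) \<noteq> 1"
  using assms by (cases n) (auto simp: stay_Suc)

lemma stay_less_1:
  assumes "stay h \<xi> n x < 1" "\<And>s. 0 \<le> h s"
  shows "\<exists>j\<le>n. 0 < h (wsum \<xi> j x)"
proof (rule ccontr)
  assume "\<not> ?thesis"
  then have "h (wsum \<xi> (Suc j) x) = 0" if "j < n" for j
    using assms(2)[of "wsum \<xi> (Suc j) x"] that by (meson Suc_leI antisym not_le)
  then have "stay h \<xi> n x = 1"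
    unfolding stay_def by (intro prod.neutral) auto
  with assms(1) show False by simp
qed

lemma LB_ramp_abs: "a < b \<Longrightarrow> LB (\<lambda>s. ramp a b \<bar>s\<bar>)"
  by (intro blip_LB_comp[OF LB_ramp, where L = 1]) auto

text \<open>A summand cut off by \<open>\<xi>\<close> leaves the interval \<open>[-R, R]\<close> in a single step,
  so truncation creates no spurious exits.\<close>

lemma exit_wsum_imp_exit:
  assumes "0 < R" and \<xi>: "\<And>x. \<bar>x\<bar> \<le> 2 * R \<Longrightarrow> \<xi> x = c * x" "\<bar>c\<bar> = 1"
    and "stay (\<lambda>s. ramp R (2 * R) \<bar>s\<bar>) \<xi> n x < 1"
  shows "\<exists>j\<le>n. R \<le> \<bar>\<Sum>i<j. x i\<bar>"
proof (rule ccontr)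
  assume "\<not> ?thesis"
  then have small: "\<bar>\<Sum>i<j. x i\<bar> < R" if "j \<le> n" for j
    using that by force
  obtain j where j: "j \<le> n" "0 < ramp R (2 * R) \<bar>wsum \<xi> j x\<bar>"
    using stay_less_1[OF assms(4)] ramp_range by blast
  have "\<xi> (x i) = c * x i" if "i < j" for i
  proof (rule \<xi>(1))
    have "x i = (\<Sum>i<Suc i. x i) - (\<Sum>i<i. x i)" by simp
    then show "\<bar>x i\<bar> \<le> 2 * R"
      using small[of i] small[of "Suc i"] that j(1) by linarith
  qed
  then have "wsum \<xi> j x = c * (\<Sum>i<j. x i)"
    unfolding wsum_def sum_distrib_left by (intro sum.cong) auto
  then have "\<bar>wsum \<xi> j x\<bar> = \<bar>\<Sum>i<j. x i\<bar>"
    by (simp add: abs_mult \<xi>(2))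
  with ramp_pos[OF _ j(2)] small[OF j(1)] \<open>0 < R\<close> show False by simp
qed

context iid_seq
begin

text \<open>The potential is the surviving weight times the distance to a barrier at 4R. An upward
  mean lowers it by a fixed fraction per step under the best choice, and on survival it is at least
  2R times the weight, so survival decays geometrically.\<close>

lemma exit_linear:
  assumes "0 < R" and \<xi>: "LB \<xi>" "\<And>x. \<bar>\<xi> x\<bar> \<le> 2 * R" and \<mu>: "0 \<le> \<mu>" "\<mu> \<le> N \<xi>"
  shows "1 - 2 * (1 - \<mu> / (6 * R)) ^ n \<le> Er (\<lambda>x. 1 - stay (\<lambda>s. ramp R (2 * R) \<bar>s\<bar>) \<xi> n x)"
proof -
  let ?h = "\<lambda>s. ramp R (2 * R) \<bar>s\<bar>"
  let ?P = "stay ?h \<xi>" and ?S = "wsum \<xi>"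
  define q where "q = 1 - \<mu> / (6 * R)"
  have h: "LB ?h" using \<open>0 < R\<close> by (intro LB_ramp_abs) auto
  have P0: "0 \<le> ?P n x" "?P n x \<le> 1" for n x
    by (auto intro!: stay_range ramp_range)
  have "N \<xi> \<le> 2 * R"
    using \<xi>(2) by (intro N_bounds(2)[OF \<xi>(1)]) (auto simp: abs_le_iff)
  then have q0: "0 \<le> q"
    using \<mu> \<open>0 < R\<close> by (simp add: q_def field_simps)
  have S_le: "\<bar>?S n x\<bar> < 2 * R" if "0 < ?P n x" for n x
  proof (cases "n = 0")
    case False
    then have "?h (?S n x) \<noteq> 1" using stay_pos_last[OF that] by simp
    then show ?thesis
      using ramp_eq_1[of R "2 * R" "\<bar>?S n x\<bar>"] \<open>0 < R\<close> by (cases "\<bar>?S n x\<bar> < 2 * R") auto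
  qed (use \<open>0 < R\<close> in simp)
  \<comment> \<open>A surviving position is below 2R and a step adds at most 2R, so the distance to
    4R never becomes negative, even at the exit step.\<close>
  define v where "v n x = ?P n x * (4 * R - ?S n x)" for n x
  have BLv: "BL k (v n)" if "n \<le> k" for n k
    unfolding v_def[abs_def] using that by (intro blip_mult blip_diff_const BL_stay BL_wsum h \<xi>)
  have step: "- q * v n x \<le> N (\<lambda>y. - v (Suc n) (x(n := y)))" for n x
  proof -
    have "N (\<lambda>y. ?P n x * (\<xi> y + (?S n x - 4 * R))) \<le> N (\<lambda>y. - v (Suc n) (x(n := y)))"
    proof (rule N_mono)
      fix y
      let ?s = "?S n x + \<xi> y"
      have "?P n x * (1 - ?h ?s) * (4 * R - ?s) \<le> ?P n x * (4 * R - ?s)"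
      proof (cases "?P n x = 0")
        case False
        then have "?S n x < 2 * R" using S_le[of n x] P0[of n x] by linarith
        then have "0 \<le> 4 * R - ?s" using \<xi>(2)[of y] by linarith
        moreover have "?P n x * (1 - ?h ?s) \<le> ?P n x * 1"
          using P0[of n x] ramp_range[of R "2 * R" "\<bar>?s\<bar>"] by (intro mult_left_mono) auto
        ultimately show ?thesis by (intro mult_right_mono) auto
      qed simp
      then show "?P n x * (\<xi> y + (?S n x - 4 * R)) \<le> - v (Suc n) (x(n := y))"
        by (simp add: v_def stay_Suc stay_upd wsum_Suc_upd algebra_simps)
    next
      show "LB (\<lambda>y. ?P n x * (\<xi> y + (?S n x - 4 * R)))"
        by (intro blip_cmult blip_add_const \<xi>)
      show "LB (\<lambda>y. - v (Suc n) (x(n := y)))"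
        by (intro blip_uminus BL_section BLv order_refl)
    qed
    also have "N (\<lambda>y. ?P n x * (\<xi> y + (?S n x - 4 * R))) = ?P n x * (N \<xi> + (?S n x - 4 * R))"
      using P0[of n x] by (subst N_cmult) (auto intro: blip_add_const \<xi>(1) simp: N_add_const[OF \<xi>(1)])
    finally have *: "?P n x * (N \<xi> + (?S n x - 4 * R)) \<le> N (\<lambda>y. - v (Suc n) (x(n := y)))" .
    \<comment> \<open>The distance is at most 6R, which is where the 6R in the contraction factor
      comes from.\<close>
    have "- q * (4 * R - ?S n x) \<le> N \<xi> + (?S n x - 4 * R)" if "\<bar>?S n x\<bar> < 2 * R"
    proof -
      have "\<mu> / (6 * R) * (4 * R - ?S n x) \<le> \<mu> / (6 * R) * (6 * R)"
        using that \<mu> \<open>0 < R\<close> by (intro mult_left_mono) auto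
      also have "\<dots> = \<mu>" using \<open>0 < R\<close> by simp
      finally show ?thesis using \<mu>(2) unfolding q_def by (simp add: algebra_simps)
    qed
    then have "?P n x * (- q * (4 * R - ?S n x)) \<le> ?P n x * (N \<xi> + (?S n x - 4 * R))"
      using S_le[of n x] P0[of n x] by (cases "?P n x = 0") (simp, intro mult_left_mono, auto)
    with * show ?thesis by (simp add: v_def algebra_simps)
  qed
  have "- 4 * R * q ^ n \<le> Er (\<lambda>x. - v n x)"
  proof (induction n)
    case (Suc n)
    have "- 4 * R * q ^ Suc n = q * (- 4 * R * q ^ n)" by simp
    also have "\<dots> \<le> q * Er (\<lambda>x. - v n x)"
      using q0 Suc by (intro mult_left_mono)
    also have "\<dots> = Er (\<lambda>x. - q * v n x)"
      using Er_cmult[OF blip_uminus[OF BLv[OF order_refl]] q0, of n] by simp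
    also have "\<dots> \<le> Er (\<lambda>x. - v (Suc n) x)"
      by (intro Er_ge_step[where k = n] blip_uminus blip_cmult BLv step order_refl)
    finally show ?case .
  qed (simp add: v_def)
  also have "Er (\<lambda>x. - v n x) \<le> Er (\<lambda>x. 2 * R * - ?P n x)"
  proof (rule Er_mono)
    show "- v n x \<le> 2 * R * - ?P n x" for x
    proof (cases "?P n x = 0")
      case False
      then have "?P n x * (2 * R) \<le> ?P n x * (4 * R - ?S n x)"
        using S_le[of n x] P0[of n x] by (intro mult_left_mono) auto
      then show ?thesis by (simp add: v_def algebra_simps)
    qed (simp add: v_def)
    show "BL n (\<lambda>x. - v n x)" by (intro blip_uminus BLv order_refl)
    show "BL n (\<lambda>x. 2 * R * - ?P n x)" by (intro blip_cmult blip_uminus BL_stay h \<xi> order_refl)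
  qed
  also have "\<dots> = 2 * R * Er (\<lambda>x. - ?P n x)"
    using \<open>0 < R\<close> by (intro Er_cmult[where k = n] blip_uminus BL_stay h \<xi> order_refl) auto
  finally have "2 * R * (- 2 * q ^ n) \<le> 2 * R * Er (\<lambda>x. - ?P n x)" by simp
  then have "- 2 * q ^ n \<le> Er (\<lambda>x. - ?P n x)"
    using \<open>0 < R\<close> by (subst (asm) mult_le_cancel_left_pos) auto
  moreover have "Er (\<lambda>x. - ?P n x + 1) = Er (\<lambda>x. - ?P n x) + 1"
    by (intro Er_add_const[where k = n] blip_uminus BL_stay h \<xi> order_refl)
  ultimately show ?thesis unfolding q_def by simp
qed

end

section \<open>Exits caused by a large variance\<close>

lemma exp_ge_quadratic: "1 + b + min (b\<^sup>2) 1 / 4 \<le> exp (b::real)"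
\<comment> \<open>For b >= -2 square the inequality 1 + b/2 <= exp(b/2). Further left no uncut
  quadratic bound survives, hence the minimum with 1.\<close>
proof (cases "- 2 \<le> b")
  case True
  have "0 \<le> 1 + b / 2" "1 + b / 2 \<le> exp (b / 2)"
    using True exp_ge_add_one_self[of "b / 2"] by auto
  then have "(1 + b / 2)\<^sup>2 \<le> (exp (b / 2))\<^sup>2"
    by (intro power_mono)
  also have "(exp (b / 2))\<^sup>2 = exp b"
    by (simp add: power2_eq_square flip: exp_add)
  finally have "1 + b + b\<^sup>2 / 4 \<le> exp b"
    by (simp add: power2_eq_square field_simps)
  then show ?thesis by linarith
next
  case False
  have "min (b\<^sup>2) 1 / 4 \<le> 1" by simp
  with False show ?thesis using exp_gt_zero[of b] by linarith
qed

text \<open>\<open>A\<close> is any quantity below both the square of the increment and 1. It later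
  comes from a summand cut at a fixed level, so that only one truncated second moment
  enters.\<close>

lemma cosh_add_ge:
  assumes "0 \<le> A" "A \<le> b\<^sup>2" "A \<le> 1"
  shows "cosh a + sinh a * b + cosh a * A / 4 \<le> cosh (a + b :: real)"
proof -
  have e: "1 + b + A / 4 \<le> exp b" "1 - b + A / 4 \<le> exp (- b)"
    using exp_ge_quadratic[of b] exp_ge_quadratic[of "- b"] assms by auto
  have "cosh a + sinh a * b + cosh a * A / 4
      = (exp a * (1 + b + A / 4) + exp (- a) * (1 - b + A / 4)) / 2"
    by (simp add: cosh_def sinh_def field_simps)
  also have "\<dots> \<le> (exp a * exp b + exp (- a) * exp (- b)) / 2"
    using e by (intro divide_right_mono add_mono mult_left_mono) auto
  also have "\<dots> = cosh (a + b)"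
    by (simp add: cosh_def flip: exp_add)
  finally show ?thesis .
qed

lemma cosh_le_exp: "0 \<le> x \<Longrightarrow> cosh x \<le> exp (x::real)"
  by (simp add: cosh_def)

lemma abs_sinh_le_cosh: "\<bar>sinh x\<bar> \<le> cosh (x::real)"
  by (simp add: sinh_def cosh_def abs_le_iff)

lemma cosh_abs_mono:
  assumes "\<bar>x\<bar> \<le> y" shows "cosh x \<le> cosh (y::real)"
proof -
  have "cosh \<bar>x\<bar> \<le> cosh y"
    using assms by (subst cosh_real_nonneg_le_iff) auto
  then show ?thesis by simp
qed

lemma sum_shift: "(\<Sum>i<n + j. p i) = (\<Sum>i<n. p i) + (\<Sum>i<j. p (n + i :: nat) :: real)"
  by (induction j) auto

lemma ll_le_sqrt: "1 \<le> x \<Longrightarrow> ll x \<le> 2 * sqrt x"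
  using ll_square_le[of "sqrt x"] ll_le_self[of "sqrt x"] by simp

lemma ll_le_eps:
  assumes "0 < C" shows "\<exists>x0\<ge>1. \<forall>x\<ge>x0. C * ll x \<le> x"
proof (intro exI[of _ "max 1 (4 * C\<^sup>2)"] conjI allI impI)
  fix x assume x: "max 1 (4 * C\<^sup>2) \<le> x"
  have "2 * C \<le> sqrt x"
    using x assms by (intro real_le_rsqrt) (auto simp: power_mult_distrib)
  then have "(2 * C) * sqrt x \<le> sqrt x * sqrt x"
    using x by (intro mult_right_mono) auto
  moreover have "C * ll x \<le> C * (2 * sqrt x)"
    using ll_le_sqrt[of x] x assms by (intro mult_left_mono) auto
  ultimately show "C * ll x \<le> x" using x by simp
qed auto

lemma lil_norm_sublinear:
  assumes "0 < C" shows "\<exists>n1. \<forall>n\<ge>n1. C * lil_norm (n0 + n) \<le> real n"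
proof -
  obtain x0 where x0: "x0 \<ge> 1" "\<And>x. x \<ge> x0 \<Longrightarrow> (8 * C\<^sup>2) * ll x \<le> x"
    using ll_le_eps[of "8 * C\<^sup>2"] assms by auto
  show ?thesis
  proof (intro exI[of _ "max n0 (nat \<lceil>x0\<rceil>)"] allI impI)
    fix n assume n: "max n0 (nat \<lceil>x0\<rceil>) \<le> n"
    have "x0 \<le> real (n0 + n)" using n by linarith
    then have "8 * C\<^sup>2 * ll (real (n0 + n)) \<le> real (n0 + n)" by (rule x0(2))
    then have "real (n0 + n) * (8 * C\<^sup>2 * ll (real (n0 + n))) \<le> real (n0 + n) * real (n0 + n)"
      by (intro mult_left_mono) auto
    also have "\<dots> \<le> (2 * real n) * (2 * real n)"
      using n by (intro mult_mono) auto
    finally have "4 * (C * lil_norm (n0 + n))\<^sup>2 \<le> 4 * (real n)\<^sup>2"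
      unfolding power_mult_distrib lil_norm_sq by (simp add: power2_eq_square algebra_simps)
    then have "(C * lil_norm (n0 + n))\<^sup>2 \<le> (real n)\<^sup>2"
      by linarith
    then show "C * lil_norm (n0 + n) \<le> real n"
      by (rule power2_le_imp_le) (rule of_nat_0_le_iff)
  qed
qed

context iid_seq
begin

text \<open>The quadratic term keeps its upper value while the linear term is charged at its worst
  sign; hence both one-sided means have to be at most \<open>d\<close>.\<close>

lemma N_linear_quadratic_ge:
  assumes "LB \<xi>" "LB A" "0 \<le> c" "N \<xi> \<le> d" "N (\<lambda>x. - \<xi> x) \<le> d"
  shows "a + c * N A - \<bar>b\<bar> * d \<le> N (\<lambda>x. a + b * \<xi> x + c * A x)"
proof -
  have "N (\<lambda>x. - (b * \<xi> x)) \<le> \<bar>b\<bar> * d"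
  proof (cases "0 \<le> b")
    case True
    then have "N (\<lambda>x. b * - \<xi> x) = b * N (\<lambda>x. - \<xi> x)"
      by (intro N_cmult blip_uminus assms)
    then show ?thesis using True assms(5) by (simp add: mult_left_mono)
  next
    case False
    then have "N (\<lambda>x. (- b) * \<xi> x) = (- b) * N \<xi>"
      by (intro N_cmult assms) auto
    then show ?thesis using False mult_left_mono[OF assms(4), of "- b"] by simp
  qed
  moreover have "N (\<lambda>x. c * A x) - N (\<lambda>x. - (b * \<xi> x)) \<le> N (\<lambda>x. c * A x + b * \<xi> x)"
    by (intro N_add_ge blip_cmult assms)
  moreover have "N (\<lambda>x. (c * A x + b * \<xi> x) + a) = N (\<lambda>x. c * A x + b * \<xi> x) + a"
    by (intro N_add_const blip_add blip_cmult assms)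
  moreover have "N (\<lambda>x. c * A x) = c * N A"
    by (intro N_cmult assms)
  ultimately show ?thesis by (simp add: algebra_simps)
qed

text \<open>While alive, the potential is cosh discounted by 1 + \<gamma> per step; once dead it is
  worth \<open>B\<close>, the largest value of cosh reachable at an exit. The variance gain beats
  discount and drift, so the expectation never falls below its initial value 1. By time
  \<open>n\<close> the discount has pushed the surviving part below 1/2, and the other half must
  come from exits.\<close>

lemma exit_cosh:
  assumes R: "0 < R" and \<theta>: "0 < \<theta>"
    and \<xi>: "LB \<xi>" "\<And>x. \<bar>\<xi> x\<bar> \<le> 2 * R" "N \<xi> \<le> d" "N (\<lambda>x. - \<xi> x) \<le> d"
    and A: "LB A" "\<And>x. 0 \<le> A x" "\<And>x. A x \<le> (\<xi> x)\<^sup>2" "\<And>x. \<theta>\<^sup>2 * A x \<le> 1"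
    and \<gamma>: "0 \<le> \<gamma>" "\<gamma> \<le> \<theta>\<^sup>2 * N A / 4 - \<theta> * d"
    and n: "2 * cosh (2 * R * \<theta>) \<le> (1 + \<gamma>) ^ n"
  shows "1 / (2 * cosh (4 * R * \<theta>)) \<le> Er (\<lambda>x. 1 - stay (\<lambda>s. ramp R (2 * R) \<bar>s\<bar>) \<xi> n x)"
proof -
  let ?h = "\<lambda>s. ramp R (2 * R) \<bar>s\<bar>"
  let ?P = "stay ?h \<xi>" and ?S = "wsum \<xi>"
  define B where "B = cosh (4 * R * \<theta>)"
  define q where "q = 1 / (1 + \<gamma>)"
  have q: "0 < q" "q \<le> 1" "q * (1 + \<gamma>) = 1"
    using \<gamma>(1) by (auto simp: q_def)
  have h: "LB ?h" using R by (intro LB_ramp_abs) auto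
  have P0: "0 \<le> ?P n x" "?P n x \<le> 1" for n x
    by (auto intro!: stay_range ramp_range)
  have S_le: "\<bar>?S n x\<bar> \<le> 2 * R" if "?P n x \<noteq> 0" for n x
  proof (cases "n = 0")
    case False
    then have "?h (?S n x) \<noteq> 1" using stay_pos_last[of ?h \<xi> n x] that P0[of n x] by simp
    then show ?thesis
      using ramp_eq_1[of R "2 * R" "\<bar>?S n x\<bar>"] R by (cases "\<bar>?S n x\<bar> < 2 * R") auto
  qed (use R in simp)
  define u where "u n x = (1 - ?P n x) * B + ?P n x * (q ^ n * cosh (\<theta> * ?S n x))" for n x
  have BLu: "BL n (u n)" for n
    unfolding u_def[abs_def]
    by (intro blip_add blip_mult blip_diff_const blip_cosh BL_stay BL_wsum h \<xi> order_refl BL_const)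
  have step: "u n x \<le> N (\<lambda>y. u (Suc n) (x(n := y)))" for n x
  proof -
    let ?p = "?P n x" and ?s = "?S n x"
    let ?w = "\<lambda>y. q ^ Suc n * cosh (\<theta> * (?s + \<xi> y))"
    have LBc: "LB (\<lambda>y. cosh (\<theta> * (?s + \<xi> y)))"
      using blip_cosh[OF blip_cmult[OF blip_add_const[OF \<xi>(1), of ?s], of \<theta>]] by (simp add: add.commute)
    have "cosh (\<theta> * ?s) * (1 + \<gamma>) \<le> N (\<lambda>y. cosh (\<theta> * (?s + \<xi> y)))"
    proof -
      have "cosh (\<theta> * ?s) * (1 + \<gamma>)
          \<le> cosh (\<theta> * ?s) * (1 + (\<theta>\<^sup>2 * N A / 4 - \<theta> * d))"
        using \<gamma> by (intro mult_left_mono) auto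
      also have "\<dots> = cosh (\<theta> * ?s) + cosh (\<theta> * ?s) * \<theta>\<^sup>2 / 4 * N A - cosh (\<theta> * ?s) * (\<theta> * d)"
        by (simp add: algebra_simps)
      also have "\<dots> \<le> cosh (\<theta> * ?s) + cosh (\<theta> * ?s) * \<theta>\<^sup>2 / 4 * N A - \<bar>sinh (\<theta> * ?s) * \<theta>\<bar> * d"
      proof -
        have "- N \<xi> \<le> N (\<lambda>x. - \<xi> x)"
          using N_add[OF \<xi>(1) blip_uminus[OF \<xi>(1)]] by simp
        then have "0 \<le> d" using \<xi>(3,4) by linarith
        then have "\<bar>sinh (\<theta> * ?s)\<bar> * (\<theta> * d) \<le> cosh (\<theta> * ?s) * (\<theta> * d)"
          using \<theta> by (intro mult_right_mono abs_sinh_le_cosh) auto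
        then show ?thesis using \<theta> by (simp add: abs_mult mult.assoc)
      qed
      also have "\<dots> \<le> N (\<lambda>y. cosh (\<theta> * ?s) + sinh (\<theta> * ?s) * \<theta> * \<xi> y + cosh (\<theta> * ?s) * \<theta>\<^sup>2 / 4 * A y)"
        by (intro N_linear_quadratic_ge \<xi> A) auto
      also have "\<dots> \<le> N (\<lambda>y. cosh (\<theta> * (?s + \<xi> y)))"
      proof (rule N_mono[OF _ LBc])
        show "LB (\<lambda>y. cosh (\<theta> * ?s) + sinh (\<theta> * ?s) * \<theta> * \<xi> y + cosh (\<theta> * ?s) * \<theta>\<^sup>2 / 4 * A y)"
          by (intro blip_add blip_cmult LB_const \<xi> A)
        fix y
        have "\<theta>\<^sup>2 * A y \<le> \<theta>\<^sup>2 * (\<xi> y)\<^sup>2"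
          by (intro mult_left_mono A) auto
        then show "cosh (\<theta> * ?s) + sinh (\<theta> * ?s) * \<theta> * \<xi> y + cosh (\<theta> * ?s) * \<theta>\<^sup>2 / 4 * A y
            \<le> cosh (\<theta> * (?s + \<xi> y))"
          using cosh_add_ge[of "\<theta>\<^sup>2 * A y" "\<theta> * \<xi> y" "\<theta> * ?s"] A(2,4)[of y]
          by (simp add: power_mult_distrib algebra_simps)
      qed
      finally show ?thesis .
    qed
    then have "q ^ Suc n * (cosh (\<theta> * ?s) * (1 + \<gamma>)) \<le> q ^ Suc n * N (\<lambda>y. cosh (\<theta> * (?s + \<xi> y)))"
      using q by (intro mult_left_mono) auto
    moreover have "q ^ Suc n * (cosh (\<theta> * ?s) * (1 + \<gamma>)) = q ^ n * cosh (\<theta> * ?s)"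
    proof -
      have "q ^ Suc n * (cosh (\<theta> * ?s) * (1 + \<gamma>)) = q ^ n * cosh (\<theta> * ?s) * (q * (1 + \<gamma>))"
        by (simp add: algebra_simps)
      then show ?thesis by (simp only: q(3) mult_1_right)
    qed
    moreover have "N ?w = q ^ Suc n * N (\<lambda>y. cosh (\<theta> * (?s + \<xi> y)))"
      using q by (intro N_cmult LBc) auto
    ultimately have "q ^ n * cosh (\<theta> * ?s) \<le> N ?w"
      by linarith
    then have "?p * (q ^ n * cosh (\<theta> * ?s)) \<le> ?p * N ?w"
      using P0 by (intro mult_left_mono) auto
    also have "\<dots> = N (\<lambda>y. ?p * ?w y)"
      using P0 by (intro N_cmult[symmetric] blip_cmult LBc) auto
    finally have "u n x \<le> N (\<lambda>y. ?p * ?w y) + (1 - ?p) * B"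
      by (simp add: u_def)
    also have "\<dots> = N (\<lambda>y. ?p * ?w y + (1 - ?p) * B)"
      by (intro N_add_const[symmetric] blip_cmult LBc)
    also have "\<dots> \<le> N (\<lambda>y. u (Suc n) (x(n := y)))"
    proof (rule N_mono)
      show "LB (\<lambda>y. ?p * ?w y + (1 - ?p) * B)"
        by (intro blip_add_const blip_cmult LBc)
      show "LB (\<lambda>y. u (Suc n) (x(n := y)))"
        by (intro BL_section BLu)
      fix y
      let ?t = "?s + \<xi> y"
      \<comment> \<open>Replacing killed mass by \<open>B\<close> can only help: an exit jumps from
        within 2R by at most 2R, so cosh is at most \<open>B\<close> there.\<close>
      have "?p * (?h ?t * (B - q ^ Suc n * cosh (\<theta> * ?t))) \<ge> 0"
      proof (cases "?p = 0")
        case False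
        then have "\<bar>?t\<bar> \<le> 4 * R" using S_le[of n x] \<xi>(2)[of y] by linarith
        then have "\<bar>\<theta> * ?t\<bar> \<le> 4 * R * \<theta>"
          using \<theta> by (simp add: abs_mult mult.commute mult_right_mono)
        then have "cosh (\<theta> * ?t) \<le> B" unfolding B_def by (rule cosh_abs_mono)
        moreover have "q ^ Suc n * cosh (\<theta> * ?t) \<le> 1 * cosh (\<theta> * ?t)"
          using q by (intro mult_right_mono power_le_one) auto
        ultimately have "0 \<le> B - q ^ Suc n * cosh (\<theta> * ?t)" by linarith
        then show ?thesis by (intro mult_nonneg_nonneg P0 ramp_range)
      qed simp
      then show "?p * ?w y + (1 - ?p) * B \<le> u (Suc n) (x(n := y))"
        by (simp add: u_def stay_Suc stay_upd wsum_Suc_upd algebra_simps)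
    qed
    finally show ?thesis .
  qed
  have "1 \<le> Er (u n)"
  proof (induction n)
    case (Suc n)
    also have "Er (u n) \<le> Er (u (Suc n))"
      by (rule Er_ge_step[OF BLu BLu step])
    finally show ?case .
  qed (simp add: u_def)
  also have "Er (u n) \<le> Er (\<lambda>x. B * (1 - ?P n x) + 1 / 2)"
  proof (rule Er_mono[OF BLu])
    show "BL n (\<lambda>x. B * (1 - ?P n x) + 1 / 2)"
      by (intro blip_add_const blip_cmult blip_diff_const BL_stay h \<xi> order_refl)
    fix x
    have "?P n x * (q ^ n * cosh (\<theta> * ?S n x)) \<le> 1 / 2"
    proof (cases "?P n x = 0")
      case False
      then have "\<bar>\<theta> * ?S n x\<bar> \<le> 2 * R * \<theta>"
        using S_le[of n x] \<theta> by (simp add: abs_mult mult.commute mult_right_mono)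
      then have "q ^ n * cosh (\<theta> * ?S n x) \<le> q ^ n * cosh (2 * R * \<theta>)"
        using q by (intro mult_left_mono cosh_abs_mono) auto
      also have "\<dots> \<le> q ^ n * ((1 + \<gamma>) ^ n / 2)"
        using q n by (intro mult_left_mono) auto
      also have "\<dots> = 1 / 2"
        using q(3) by (simp flip: power_mult_distrib)
      finally have "?P n x * (q ^ n * cosh (\<theta> * ?S n x)) \<le> 1 * (1 / 2)"
        using P0 q by (intro mult_mono) auto
      then show ?thesis by simp
    qed simp
    then show "u n x \<le> B * (1 - ?P n x) + 1 / 2"
      by (simp add: u_def algebra_simps)
  qed
  also have "\<dots> = B * Er (\<lambda>x. 1 - ?P n x) + 1 / 2"
  proof -
    have BL: "BL n (\<lambda>x. 1 - ?P n x)"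
      by (intro blip_diff_const BL_stay h \<xi> order_refl)
    have "0 \<le> B" unfolding B_def by simp
    then show ?thesis
      using Er_add_const[OF blip_cmult[OF BL, of B], of "1 / 2"] Er_cmult[OF BL, of B] by simp
  qed
  finally have "1 / 2 \<le> B * Er (\<lambda>x. 1 - ?P n x)" by simp
  moreover have "0 < B" unfolding B_def by simp
  ultimately show ?thesis
    unfolding B_def[symmetric] by (simp add: field_simps)
qed

end

lemma prod_1_minus_le_exp:
  fixes p :: "nat \<Rightarrow> real"
  assumes "\<And>k. p k \<le> 1" shows "(\<Prod>k<r. 1 - p k) \<le> exp (- (\<Sum>k<r. p k))"
proof -
  have "(\<Prod>k<r. 1 - p k) \<le> (\<Prod>k<r. exp (- p k))"
    using assms exp_ge_add_one_self[of "- p k" for k] by (intro prod_mono) (auto simp: algebra_simps)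
  also have "\<dots> = exp (- (\<Sum>k<r. p k))"
    by (simp add: exp_sum sum_negf[symmetric])
  finally show ?thesis .
qed


section \<open>Necessity\<close>

context lil_setting
begin

lemma sets_exceed [measurable]:
  "{\<omega> \<in> space M. \<exists>m\<in>{a..b}. c m \<le> \<bar>partial_sum Y m \<omega>\<bar>} \<in> sets M"
  unfolding partial_sum_path by measurable

text \<open>The hypothesis of part (b) at one starting index, with a bound uniform in the horizon
  and division by the norm cleared.\<close>

definition lil_bounded :: "real \<Rightarrow> nat \<Rightarrow> real \<Rightarrow> bool" where
  "lil_bounded K n0 l \<longleftrightarrow> 0 < K \<and> 1 \<le> n0 \<and> l < 1 \<and>
     (\<forall>N\<ge>n0. V {\<omega> \<in> space M. \<exists>m\<in>{n0..N}. K * lil_norm m \<le> \<bar>partial_sum Y m \<omega>\<bar>} \<le> l)"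

text \<open>The exit level is twice \<open>K * lil_norm\<close> because a block increment is a
  difference of two partial sums, one of which must then be large. The product formula for blocks
  gives 1 - l <= exp of minus the sum, so exit weights are summable with an explicit bound.\<close>

lemma blocks_le:
  assumes "lil_bounded K n0 l"
    and n: "\<And>k. n (Suc k) = n k + b k" "n0 \<le> n 0"
    and f: "\<And>k. BL (b k) (f k)" "\<And>k x. 0 \<le> f k x" "\<And>k x. f k x \<le> 1"
    and exit: "\<And>k x. 0 < f k x \<Longrightarrow> \<exists>j\<le>b k. 2 * K * lil_norm (n (Suc k)) \<le> \<bar>\<Sum>i<j. x i\<bar>"
  shows "(\<Sum>k<r. Er (f k)) \<le> - ln (1 - l)"
proof -
  let ?A = "{\<omega> \<in> space M. \<exists>m\<in>{n0..n r}. K * lil_norm m \<le> \<bar>partial_sum Y m \<omega>\<bar>}"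
  let ?P = "\<lambda>x. \<Prod>k<r. 1 - f k (\<lambda>i. x (n k + i))"
  have hyp: "0 < K" "l < 1" "\<And>N. N \<ge> n0 \<Longrightarrow> V {\<omega> \<in> space M. \<exists>m\<in>{n0..N}. K * lil_norm m \<le> \<bar>partial_sum Y m \<omega>\<bar>} \<le> l"
    using assms(1) unfolding lil_bounded_def by auto
  have mono: "n i \<le> n j" if "i \<le> j" for i j
    using that by (rule lift_Suc_mono_le[of n, rotated]) (simp add: n)
  have BLP: "BL (n r) (\<lambda>x. 1 - ?P x)"
  proof (rule blip_diff_const, rule BL_prod)
    fix k assume "k \<in> {..<r}"
    then have "n k + b k \<le> n r" using mono[of "Suc k" r] by (simp add: n)
    then show "BL (n r) (\<lambda>x. 1 - f k (\<lambda>i. x (n k + i)))"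
      by (intro blip_diff_const BL_mono[OF BL_shift[OF f(1)]])
  qed auto
  have "1 - (\<Prod>k<r. 1 - Er (f k)) = Er (\<lambda>x. 1 - ?P x)"
    by (rule Er_block_product[where n = n and b = b, symmetric]) (auto simp: n f)
  also have "\<dots> \<le> V ?A"
  proof (rule V_ge_Er[OF BLP sets_exceed])
    fix \<omega> assume \<omega>: "\<omega> \<in> space M"
    show "1 - ?P (path \<omega>) \<le> indicator ?A \<omega>"
    proof (cases "\<exists>k<r. 0 < f k (\<lambda>i. path \<omega> (n k + i))")
      case True
      then obtain k where k: "k < r" "0 < f k (\<lambda>i. path \<omega> (n k + i))" by blast
      then obtain j where j: "j \<le> b k"
        "2 * K * lil_norm (n (Suc k)) \<le> \<bar>\<Sum>i<j. path \<omega> (n k + i)\<bar>"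
        using exit by blast
      have "partial_sum Y (n k + j) \<omega> = partial_sum Y (n k) \<omega> + (\<Sum>i<j. path \<omega> (n k + i))"
        unfolding partial_sum_path by (rule sum_shift)
      then have "K * lil_norm (n (Suc k)) \<le> \<bar>partial_sum Y (n k + j) \<omega>\<bar> \<or>
          K * lil_norm (n (Suc k)) \<le> \<bar>partial_sum Y (n k) \<omega>\<bar>"
        using j(2) by linarith
      then obtain m where m: "m = n k + j \<or> m = n k" "K * lil_norm (n (Suc k)) \<le> \<bar>partial_sum Y m \<omega>\<bar>"
        by blast
      have "m \<le> n (Suc k)" "n0 \<le> m"
        using m(1) j(1) n mono[of 0 k] by auto
      moreover have "n (Suc k) \<le> n r" using mono k by simp
      moreover have "K * lil_norm m \<le> K * lil_norm (n (Suc k))"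
        using hyp(1) \<open>m \<le> n (Suc k)\<close> by (intro mult_left_mono lil_norm_mono) auto
      ultimately have "\<omega> \<in> ?A" using m(2) \<omega> by (auto intro!: bexI[of _ m])
      moreover have "0 \<le> ?P (path \<omega>)" using f(3) by (intro prod_nonneg) auto
      ultimately show ?thesis by simp
    next
      case False
      then have "f k (\<lambda>i. path \<omega> (n k + i)) = 0" if "k < r" for k
        using f(2)[of k] that by (meson antisym not_less)
      then have "?P (path \<omega>) = 1" by (intro prod.neutral) auto
      then show ?thesis by simp
    qed
  qed
  also have "V ?A \<le> l"
    using n(2) mono[of 0 r] by (intro hyp(3)) auto
  finally have "1 - l \<le> (\<Prod>k<r. 1 - Er (f k))" by simp
  also have "\<dots> \<le> exp (- (\<Sum>k<r. Er (f k)))"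
    using Er_bounds(2)[OF f(1) f(3)] by (intro prod_1_minus_le_exp)
  finally have "ln (1 - l) \<le> ln (exp (- (\<Sum>k<r. Er (f k))))"
    using hyp(2) by (subst ln_le_cancel_iff) auto
  then show ?thesis by simp
qed

text \<open>Blocks of length one: a single summand above \<open>2 * a k\<close> already forces a
  large partial sum before or after it. Summability of the resulting tails is the Choquet condition
  by the integral test.\<close>

lemma choquet_fin_if_bounded:
  assumes "lil_bounded K n0 l" shows choquet_fin
proof -
  have K: "0 < K" "1 \<le> n0" using assms unfolding lil_bounded_def by auto
  define a where "a k = K * lil_norm (n0 + Suc k)" for k
  have a: "0 < a k" for k
    unfolding a_def using K lil_norm_pos[of "n0 + Suc k"] by simp
  define \<phi> where "\<phi> k x = ramp (2 * a k) (4 * a k) \<bar>x\<bar>" for k x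
  have LB\<phi>: "LB (\<phi> k)" for k
    unfolding \<phi>_def using a[of k] by (intro LB_ramp_abs) auto
  have "(\<Sum>k<r. Er (\<lambda>x. \<phi> k (x 0))) \<le> - ln (1 - l)" for r
  proof (rule blocks_le[OF assms, where n = "\<lambda>k. n0 + k" and b = "\<lambda>_. 1"])
    show "BL 1 (\<lambda>x. \<phi> k (x 0))" for k by (rule LB_BL[OF LB\<phi>])
    fix k and x :: "nat \<Rightarrow> real" assume "0 < \<phi> k (x 0)"
    then have "2 * a k < \<bar>x 0\<bar>"
      unfolding \<phi>_def using a[of k] ramp_pos[of "2 * a k" "4 * a k" "\<bar>x 0\<bar>"] by linarith
    then show "\<exists>j\<le>1. 2 * K * lil_norm (n0 + Suc k) \<le> \<bar>\<Sum>i<j. x i\<bar>"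
      by (intro exI[of _ 1]) (auto simp: a_def)
  qed (auto simp: \<phi>_def ramp_range)
  moreover have "G (4 * a k) \<le> Er (\<lambda>x. \<phi> k (x 0))" for k
    unfolding N_def[symmetric] using a[of k]
    by (intro G_le_N LB\<phi>) (auto simp: \<phi>_def ramp_range ramp_eq_1)
  ultimately have "(\<Sum>k<r. G (4 * a k)) \<le> - ln (1 - l)" for r
    by (meson order_trans sum_mono)
  then have "summable (\<lambda>k. G (4 * a k))"
    by (intro summableI_nonneg_bounded G_nonneg)
  then have sumG: "summable (\<lambda>k. G (4 * K * lil_norm (k + Suc n0)))"
    by (simp add: a_def algebra_simps)
  obtain D where D: "D > 0" "\<And>m. lil_quot (4 * K * lil_norm m) < D * real m \<or> m = 0"
    using lil_quot_norm_bound[of "4 * K"] K by auto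
  \<comment> \<open>The shift keeps the index away from 0, the one value excluded in the comparison
    of levels, and is harmless for summability.\<close>
  have "F (D * real (k + Suc n0)) \<le> G (4 * K * lil_norm (k + Suc n0))" for k
    using D(2)[of "k + Suc n0"] K lil_norm_nonneg[of "k + Suc n0"] by (intro F_le_G) auto
  then have "summable (\<lambda>k. F (D * real (k + Suc n0)))"
    using F_nonneg by (intro summable_comparison_test[OF _ sumG]) auto
  then have "summable (\<lambda>k. F (D * real k))"
    by (subst (asm) summable_iff_shift[of "\<lambda>k. F (D * real k)" "Suc n0"])
  then show ?thesis
    unfolding choquet_fin_def by (rule antimono_integral_finite[OF F_antimono F_nonneg D(1)])
qed

text \<open>The factor \<open>c\<close> of modulus 1 treats the upper means of Y and of -Y together.
  The rate, not just the limit, is needed later.\<close>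

lemma trunc_mean_limit:
  assumes choquet_fin "\<bar>c\<bar> = 1"
  shows "\<exists>\<mu>. \<forall>\<epsilon>>0. \<exists>y0>0. \<forall>y\<ge>y0. \<bar>N (\<lambda>x. c * trunc y x) - \<mu>\<bar> \<le> \<epsilon> * ll y / y"
proof -
  let ?m = "\<lambda>y. N (\<lambda>x. c * trunc y x)"
  have diff: "\<exists>y0>0. \<forall>y\<ge>y0. \<forall>z\<ge>y. \<bar>?m z - ?m y\<bar> \<le> \<epsilon> * ll y / y" if eps: "\<epsilon> > 0" for \<epsilon>
  proof -
    obtain y0 where y0: "y0 > 0" "\<And>y z. y0 \<le> y \<Longrightarrow> y \<le> z \<Longrightarrow> N (\<lambda>x. \<bar>trunc z x - trunc y x\<bar>) \<le> \<epsilon> * ll y / y"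
      using N_trunc_tail[OF assms(1) eps] by metis
    have "\<bar>?m z - ?m y\<bar> \<le> \<epsilon> * ll y / y" if "y0 \<le> y" "y \<le> z" for y z
    proof -
      have "\<bar>c * trunc z x - c * trunc y x\<bar> = \<bar>trunc z x - trunc y x\<bar>"
        "\<bar>c * trunc y x - c * trunc z x\<bar> = \<bar>trunc z x - trunc y x\<bar>" for x
        using assms(2) by (simp_all add: abs_mult abs_minus_commute flip: right_diff_distrib)
      then have "?m z - ?m y \<le> N (\<lambda>x. \<bar>trunc z x - trunc y x\<bar>)" "?m y - ?m z \<le> N (\<lambda>x. \<bar>trunc z x - trunc y x\<bar>)"
        using N_diff_le[OF blip_cmult[OF LB_trunc] blip_cmult[OF LB_trunc], of c z c y]
          N_diff_le[OF blip_cmult[OF LB_trunc] blip_cmult[OF LB_trunc], of c y c z] by simp_all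
      then show ?thesis using y0(2)[OF that] by linarith
    qed
    then show ?thesis using y0(1) by blast
  qed
  have small: "\<epsilon> * ll y / y \<le> \<epsilon>" if "y \<ge> 1" "\<epsilon> > 0" for y \<epsilon>
    using ll_le_self[OF that(1)] that by (simp add: field_simps)
  \<comment> \<open>The limit is taken along integer levels; the comparison between arbitrary levels
    then transfers it to real ones with the rate.\<close>
  have "Cauchy (\<lambda>k. ?m (real k))"
  proof (rule CauchyI')
    fix \<epsilon> :: real assume "\<epsilon> > 0"
    then obtain y0 where y0: "y0 > 0" "\<And>y z. y0 \<le> y \<Longrightarrow> y \<le> z \<Longrightarrow> \<bar>?m z - ?m y\<bar> \<le> \<epsilon> / 2 * ll y / y"
      using diff[of "\<epsilon> / 2"] by auto
    have "norm (?m (real k) - ?m (real j)) < \<epsilon>" if "nat \<lceil>max 1 y0\<rceil> \<le> k" "k < j" for k j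
    proof -
      have "y0 \<le> real k" "1 \<le> real k" using that by linarith+
      then show ?thesis
        using y0(2)[of "real k" "real j"] small[of "real k" "\<epsilon> / 2"] that \<open>\<epsilon> > 0\<close>
        by (simp add: abs_minus_commute)
    qed
    then show "\<exists>k. \<forall>m\<ge>k. \<forall>n>m. dist (?m (real m)) (?m (real n)) < \<epsilon>"
      unfolding dist_norm by blast
  qed
  then obtain \<mu> where \<mu>: "(\<lambda>k. ?m (real k)) \<longlonglongrightarrow> \<mu>"
    by (auto simp: Cauchy_convergent_iff convergent_def)
  have "\<exists>y0>0. \<forall>y\<ge>y0. \<bar>?m y - \<mu>\<bar> \<le> \<epsilon> * ll y / y" if "\<epsilon> > 0" for \<epsilon>
  proof -
    obtain y0 where y0: "y0 > 0" "\<And>y z. y0 \<le> y \<Longrightarrow> y \<le> z \<Longrightarrow> \<bar>?m z - ?m y\<bar> \<le> \<epsilon> * ll y / y"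
      using diff[OF \<open>\<epsilon> > 0\<close>] by auto
    have "\<bar>?m y - \<mu>\<bar> \<le> \<epsilon> * ll y / y" if "y0 \<le> y" for y
    proof (rule LIMSEQ_le_const2)
      show "(\<lambda>k. \<bar>?m y - ?m (real k)\<bar>) \<longlonglongrightarrow> \<bar>?m y - \<mu>\<bar>"
        by (intro tendsto_intros \<mu>)
      have "\<bar>?m y - ?m (real k)\<bar> \<le> \<epsilon> * ll y / y" if "nat \<lceil>y\<rceil> \<le> k" for k
      proof -
        have "y \<le> real k" using that by linarith
        then show ?thesis
          using y0(2)[OF \<open>y0 \<le> y\<close>, of "real k"] by (simp add: abs_minus_commute)
      qed
      then show "\<exists>n. \<forall>k\<ge>n. \<bar>?m y - ?m (real k)\<bar> \<le> \<epsilon> * ll y / y" by blast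
    qed
    then show ?thesis using y0(1) by blast
  qed
  then show ?thesis by blast
qed

end

lemma lil_norm_sq_2: "(lil_norm (2 * b))\<^sup>2 = 4 * real b * ll (2 * real b)"
  by (simp add: lil_norm_sq)

lemma abs_trunc_le: "0 \<le> w \<Longrightarrow> \<bar>trunc w x\<bar> \<le> w"
  by (auto simp: trunc_def)

lemma trunc_eq: "\<bar>x\<bar> \<le> w \<Longrightarrow> trunc w x = x"
  by (auto simp: trunc_def)

lemma lil_norm_ge_const: "0 < C \<Longrightarrow> (w / C)\<^sup>2 \<le> real m \<Longrightarrow> 0 \<le> w \<Longrightarrow> w \<le> C * lil_norm m"
proof -
  assume *: "0 < C" "(w / C)\<^sup>2 \<le> real m" "0 \<le> w"
  then have "w / C \<le> sqrt (real m)" by (intro real_le_rsqrt)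
  also have "\<dots> \<le> lil_norm m" by (rule lil_norm_ge_sqrt)
  finally show ?thesis using *(1) by (simp add: field_simps)
qed

context lil_setting
begin

text \<open>Block k runs from \<open>2 ^ k * m0\<close> to twice that, and \<open>R k\<close> uses
  the norm at its end, which is \<open>2 * (2 ^ k * m0)\<close>.\<close>

lemma doubling_blocks:
  assumes "lil_bounded K n0 l" "n0 \<le> m0" "1 \<le> m0"
    and R: "\<And>k. R k = 2 * K * lil_norm (2 * (2 ^ k * m0))"
    and \<xi>: "\<And>k. LB (\<xi> k)" "\<And>k x. \<bar>x\<bar> \<le> 2 * R k \<Longrightarrow> \<xi> k x = c * x" "\<bar>c\<bar> = 1"
  shows "(\<Sum>k<r. Er (\<lambda>x. 1 - stay (\<lambda>s. ramp (R k) (2 * R k) \<bar>s\<bar>) (\<xi> k) (2 ^ k * m0) x)) \<le> - ln (1 - l)"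
proof (rule blocks_le[OF assms(1), where n = "\<lambda>k. 2 ^ k * m0" and b = "\<lambda>k. 2 ^ k * m0"])
  have K: "0 < K" using assms(1) by (simp add: lil_bounded_def)
  have Rpos: "0 < R k" for k
  proof -
    have "1 \<le> 2 * (2 ^ k * m0)" using assms(3) by simp
    then show ?thesis unfolding R using K lil_norm_pos by simp
  qed
  show "BL (2 ^ k * m0) (\<lambda>x. 1 - stay (\<lambda>s. ramp (R k) (2 * R k) \<bar>s\<bar>) (\<xi> k) (2 ^ k * m0) x)" for k
    using Rpos[of k] by (intro blip_diff_const BL_stay \<xi> LB_ramp_abs order_refl) auto
  show "0 \<le> 1 - stay (\<lambda>s. ramp (R k) (2 * R k) \<bar>s\<bar>) (\<xi> k) (2 ^ k * m0) x"
    "1 - stay (\<lambda>s. ramp (R k) (2 * R k) \<bar>s\<bar>) (\<xi> k) (2 ^ k * m0) x \<le> 1" for k x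
    using stay_range[of "\<lambda>s. ramp (R k) (2 * R k) \<bar>s\<bar>" "\<xi> k" "2 ^ k * m0" x] ramp_range by auto
  fix k x assume "0 < 1 - stay (\<lambda>s. ramp (R k) (2 * R k) \<bar>s\<bar>) (\<xi> k) (2 ^ k * m0) x"
  then have "\<exists>j\<le>2 ^ k * m0. R k \<le> \<bar>\<Sum>i<j. x i\<bar>"
    by (intro exit_wsum_imp_exit[OF Rpos \<xi>(2,3)]) auto
  then show "\<exists>j\<le>2 ^ k * m0. 2 * K * lil_norm (2 ^ Suc k * m0) \<le> \<bar>\<Sum>i<j. x i\<bar>"
    by (simp add: R mult.assoc)
qed (use assms in auto)

text \<open>A positive limit \<mu> would give every doubling block exit weight at least 1/2, since
  its length exceeds any multiple of R / \<mu>; the sum over blocks would then be unbounded.\<close>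

lemma mean_limit_nonpos:
  assumes bd: "lil_bounded K n0 l" and c: "\<bar>c\<bar> = 1"
    and lim: "\<And>\<epsilon>. \<epsilon> > 0 \<Longrightarrow> \<exists>y0>0. \<forall>y\<ge>y0. \<bar>N (\<lambda>x. c * trunc y x) - \<mu>\<bar> \<le> \<epsilon> * ll y / y"
  shows "\<mu> \<le> 0"
proof (rule ccontr)
  assume "\<not> \<mu> \<le> 0"
  then have \<mu>: "0 < \<mu>" by simp
  have K: "0 < K" "1 \<le> n0" using bd by (simp_all add: lil_bounded_def)
  obtain y0 where y0: "y0 > 0" "\<And>y. y \<ge> y0 \<Longrightarrow> \<bar>N (\<lambda>x. c * trunc y x) - \<mu>\<bar> \<le> \<mu> / 2 * ll y / y"
    using lim[of "\<mu> / 2"] \<mu> by auto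
  have half: "\<mu> / 2 \<le> N (\<lambda>x. c * trunc y x)" if "max 1 y0 \<le> y" for y
  proof -
    have "\<mu> / 2 * ll y / y \<le> \<mu> / 2"
      using ll_le_self[of y] that \<mu> by (simp add: field_simps)
    then show ?thesis using y0(2)[of y] that by (simp add: abs_le_iff)
  qed
  \<comment> \<open>96 makes b \<mu> / (12 R) >= 2 for R = 2K \<open>lil_norm (2 b)\<close>, so the
    survival factor is at most exp(-2) <= 1/4 and exit has weight at least 1/2.\<close>
  obtain n1 where n1: "\<And>n. n \<ge> n1 \<Longrightarrow> (96 * K / \<mu>) * lil_norm (0 + n) \<le> real n"
    using lil_norm_sublinear[of "96 * K / \<mu>" 0] K \<mu> by auto
  define m0 where "m0 = max n0 (max n1 (nat \<lceil>(max 1 y0 / (4 * K))\<^sup>2\<rceil>))"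
  define R where "R k = 2 * K * lil_norm (2 * (2 ^ k * m0))" for k
  have m0: "n0 \<le> m0" "1 \<le> m0" "n1 \<le> m0" "(max 1 y0 / (4 * K))\<^sup>2 \<le> real m0"
    using K by (auto simp: m0_def le_max_iff_disj) linarith
  let ?f = "\<lambda>k x. 1 - stay (\<lambda>s. ramp (R k) (2 * R k) \<bar>s\<bar>) (\<lambda>x. c * trunc (2 * R k) x) (2 ^ k * m0) x"
  have "1 / 2 \<le> Er (?f k)" for k
  proof -
    let ?b = "2 ^ k * m0"
    have b: "m0 \<le> ?b" by simp
    have large: "max 1 y0 \<le> 4 * K * lil_norm (2 * ?b)"
    proof (rule lil_norm_ge_const)
      have "real m0 \<le> real (2 * ?b)"
        unfolding of_nat_le_iff using b by linarith
      with m0(4) show "(max 1 y0 / (4 * K))\<^sup>2 \<le> real (2 * ?b)" by (rule order_trans)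
    qed (use K in auto)
    then have y: "max 1 y0 \<le> 2 * R k" by (simp add: R_def)
    then have Rpos: "0 < R k" by linarith
    have "1 - 2 * (1 - \<mu> / 2 / (6 * R k)) ^ ?b \<le> Er (?f k)"
    proof (rule exit_linear[OF Rpos])
      show "LB (\<lambda>x. c * trunc (2 * R k) x)" by (intro blip_cmult LB_trunc)
      show "\<bar>c * trunc (2 * R k) x\<bar> \<le> 2 * R k" for x
        using abs_trunc_le[of "2 * R k" x] Rpos c by (simp add: abs_mult)
      show "\<mu> / 2 \<le> N (\<lambda>x. c * trunc (2 * R k) x)" by (rule half[OF y])
    qed (use \<mu> in auto)
    moreover have "(1 - \<mu> / 2 / (6 * R k)) ^ ?b \<le> 1 / 4"
    proof -
      have "\<mu> / 2 \<le> 2 * R k"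
      proof -
        have "c * trunc (2 * R k) x \<le> 2 * R k" for x
        proof -
          have "\<bar>c * trunc (2 * R k) x\<bar> \<le> 2 * R k"
            using abs_trunc_le[of "2 * R k" x] Rpos c by (simp add: abs_mult)
          then show ?thesis by linarith
        qed
        then have "N (\<lambda>x. c * trunc (2 * R k) x) \<le> 2 * R k"
          by (rule N_bounds(2)[OF blip_cmult[OF LB_trunc]])
        then show ?thesis using half[OF y] by linarith
      qed
      then have "0 \<le> 1 - \<mu> / 2 / (6 * R k)" using Rpos by (simp add: field_simps)
      moreover have "1 - \<mu> / 2 / (6 * R k) \<le> exp (- (\<mu> / 2 / (6 * R k)))"
        using exp_ge_add_one_self[of "- (\<mu> / 2 / (6 * R k))"] by simp
      ultimately have "(1 - \<mu> / 2 / (6 * R k)) ^ ?b \<le> exp (- (\<mu> / 2 / (6 * R k))) ^ ?b"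
        by (intro power_mono)
      also have "\<dots> = exp (- (real ?b * (\<mu> / 2 / (6 * R k))))"
        by (simp flip: exp_of_nat_mult)
      also have "\<dots> \<le> exp (- 2)"
      proof -
        have "(96 * K / \<mu>) * lil_norm (2 * ?b) \<le> 2 * real ?b"
          using n1[of "2 * ?b"] b m0(3) by simp
        then have "2 \<le> real ?b * (\<mu> / 2 / (6 * R k))"
          using Rpos \<mu> by (simp add: R_def field_simps)
        then show ?thesis by simp
      qed
      also have "exp (- 2 :: real) \<le> 1 / 4"
      proof -
        have "(4::real) \<le> exp 2" using exp_lower_Taylor_quadratic[of "2::real"] by simp
        then show ?thesis by (simp add: exp_minus field_simps)
      qed
      finally show ?thesis .
    qed
    ultimately show ?thesis by linarith
  qed
  then have "(\<Sum>k<r. 1 / 2) \<le> (\<Sum>k<r. Er (?f k))" for r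
    by (intro sum_mono)
  moreover have "(\<Sum>k<r. Er (?f k)) \<le> - ln (1 - l)" for r
  proof (rule doubling_blocks[OF bd m0(1,2) R_def _ _ c])
    show "LB (\<lambda>x. c * trunc (2 * R k) x)" for k by (intro blip_cmult LB_trunc)
    show "c * trunc (2 * R k) x = c * x" if "\<bar>x\<bar> \<le> 2 * R k" for k x
      using trunc_eq[OF that] by simp
  qed
  ultimately have "(\<Sum>k<r. 1 / 2) \<le> - ln (1 - l)" for r :: nat
    by (rule order_trans)
  then have "real r / 2 \<le> - ln (1 - l)" for r :: nat
    by simp
  from this[of "nat \<lceil>2 * (- ln (1 - l)) + 1\<rceil>"] show False by linarith
qed

text \<open>Neither upper mean has a positive limit, while sub-additivity makes their sum
  nonnegative; so both limits vanish and the rate of convergence is a bound.\<close>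

lemma mean_zero_if_bounded:
  assumes bd: "lil_bounded K n0 l" and "\<epsilon> > 0"
  shows "\<exists>y0>0. \<forall>y\<ge>y0. \<bar>N (trunc y)\<bar> \<le> \<epsilon> * ll y / y \<and> \<bar>N (\<lambda>x. - trunc y x)\<bar> \<le> \<epsilon> * ll y / y"
proof -
  note fin = choquet_fin_if_bounded[OF bd]
  obtain \<mu>1 where \<mu>1: "\<And>\<epsilon>. \<epsilon> > 0 \<Longrightarrow> \<exists>y0>0. \<forall>y\<ge>y0. \<bar>N (\<lambda>x. 1 * trunc y x) - \<mu>1\<bar> \<le> \<epsilon> * ll y / y"
    using trunc_mean_limit[OF fin, of 1] by auto
  obtain \<mu>2 where \<mu>2: "\<And>\<epsilon>. \<epsilon> > 0 \<Longrightarrow> \<exists>y0>0. \<forall>y\<ge>y0. \<bar>N (\<lambda>x. (- 1) * trunc y x) - \<mu>2\<bar> \<le> \<epsilon> * ll y / y"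
    using trunc_mean_limit[OF fin, of "-1"] by auto
  have le0: "\<mu>1 \<le> 0" "\<mu>2 \<le> 0"
    using mean_limit_nonpos[OF bd _ \<mu>1] mean_limit_nonpos[OF bd _ \<mu>2] by auto
  have "0 \<le> \<mu>1 + \<mu>2 + \<delta>" if \<delta>: "\<delta> > 0" for \<delta>
  proof -
    obtain y1 where y1: "\<And>y. y \<ge> y1 \<Longrightarrow> \<bar>N (trunc y) - \<mu>1\<bar> \<le> \<delta> / 2 * ll y / y"
      using \<mu>1[of "\<delta> / 2"] \<delta> by auto
    obtain y2 where y2: "\<And>y. y \<ge> y2 \<Longrightarrow> \<bar>N (\<lambda>x. - trunc y x) - \<mu>2\<bar> \<le> \<delta> / 2 * ll y / y"
      using \<mu>2[of "\<delta> / 2"] \<delta> by auto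
    define y where "y = max 1 (max y1 y2)"
    have "\<delta> / 2 * ll y / y \<le> \<delta> / 2"
      using ll_le_self[of y] \<delta> by (simp add: field_simps y_def)
    moreover have "0 \<le> N (trunc y) + N (\<lambda>x. - trunc y x)"
      using N_add[OF LB_trunc blip_uminus[OF LB_trunc], of y y] by simp
    moreover have "y1 \<le> y" "y2 \<le> y" by (simp_all add: y_def)
    ultimately show ?thesis
      using y1[of y] y2[of y] by linarith
  qed
  then have "0 \<le> \<mu>1 + \<mu>2"
    by (rule field_le_epsilon)
  with le0 have "\<mu>1 = 0" "\<mu>2 = 0" by auto
  with \<mu>1[OF \<open>\<epsilon> > 0\<close>] \<mu>2[OF \<open>\<epsilon> > 0\<close>] obtain y1 y2 where
    "y1 > 0" "\<And>y. y \<ge> y1 \<Longrightarrow> \<bar>N (trunc y)\<bar> \<le> \<epsilon> * ll y / y"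
    "y2 > 0" "\<And>y. y \<ge> y2 \<Longrightarrow> \<bar>N (\<lambda>x. - trunc y x)\<bar> \<le> \<epsilon> * ll y / y"
    by auto
  then show ?thesis by (intro exI[of _ "max y1 y2"]) auto
qed

text \<open>If some truncated second moment exceeded 4096 K^2, the cosh argument on doubling blocks
  would give exit weight at least 1 / (2 cosh(ll(2b))), of order 1/k for block k, against the
  summability of exits. The summands are cut at 2R, but the variance term only at the fixed
  \<open>w\<close>.\<close>

lemma variance_le_if_bounded:
  assumes bd: "lil_bounded K n0 l" and w: "0 \<le> w"
  shows "N (\<lambda>x. (trunc w x)\<^sup>2) \<le> 4096 * K\<^sup>2"
proof (rule ccontr)
  let ?A = "\<lambda>x. (trunc w x)\<^sup>2"
  assume "\<not> ?thesis"
  then have NA: "4096 * K\<^sup>2 \<le> N ?A" by simp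
  have K: "0 < K" "1 \<le> n0" using bd by (simp_all add: lil_bounded_def)
  \<comment> \<open>Chosen so that with ll(2R) <= (1 + 8K) L the drift loss \<theta> d is at most
    2L/b, half of the variance gain.\<close>
  define \<epsilon> where "\<epsilon> = 256 * K\<^sup>2 / (1 + 8 * K)"
  have \<epsilon>: "0 < \<epsilon>" using K by (simp add: \<epsilon>_def)
  obtain y0 where y0: "y0 > 0" "\<And>y. y \<ge> y0 \<Longrightarrow> \<bar>N (trunc y)\<bar> \<le> \<epsilon> * ll y / y"
    "\<And>y. y \<ge> y0 \<Longrightarrow> \<bar>N (\<lambda>x. - trunc y x)\<bar> \<le> \<epsilon> * ll y / y"
    using mean_zero_if_bounded[OF bd \<epsilon>] by metis
  \<comment> \<open>The 4 makes 2L/b <= 1; the second entry makes \<theta>^2 w^2 <= 1, so that the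
    quadratic bound for cosh applies.\<close>
  define C where "C = max 4 (w\<^sup>2 / (128 * K\<^sup>2))"
  obtain x0 where x0: "\<And>x. x \<ge> x0 \<Longrightarrow> C * ll x \<le> x"
  proof -
    have "0 < C" by (simp add: C_def less_max_iff_disj)
    then show ?thesis using ll_le_eps[of C] that by blast
  qed
  obtain x1 where x1: "\<And>x. x \<ge> x1 \<Longrightarrow> 2 \<le> ll x"
    using filterlim_ll by (auto simp: filterlim_at_top eventually_at_top_linorder)
  define m0 where "m0 = max n0 (max (nat \<lceil>max x0 x1\<rceil>) (nat \<lceil>(max w y0 / (4 * K))\<^sup>2\<rceil>))"
  define R where "R k = 2 * K * lil_norm (2 * (2 ^ k * m0))" for k
  have m0: "n0 \<le> m0" "1 \<le> m0"
    using K(2) by (auto simp: m0_def)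
  have "real (nat \<lceil>max x0 x1\<rceil>) \<le> real m0"
    unfolding of_nat_le_iff m0_def by (metis max.cobounded1 max.cobounded2 order_trans)
  then have x01: "x0 \<le> real m0" "x1 \<le> real m0"
    using order_trans[OF real_nat_ceiling_ge] max.boundedE by metis+
  have "real (nat \<lceil>(max w y0 / (4 * K))\<^sup>2\<rceil>) \<le> real m0"
    unfolding of_nat_le_iff m0_def by (metis max.cobounded2 order_trans)
  then have m0w: "(max w y0 / (4 * K))\<^sup>2 \<le> real m0"
    by (rule order_trans[OF real_nat_ceiling_ge])
  note m0 = m0 x01 m0w
  let ?f = "\<lambda>k x. 1 - stay (\<lambda>s. ramp (R k) (2 * R k) \<bar>s\<bar>) (trunc (2 * R k)) (2 ^ k * m0) x"
  have p: "1 / (2 * cosh (ll (2 * real (2 ^ k * m0)))) \<le> Er (?f k)" for k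
  proof -
    let ?b = "2 ^ k * m0"
    define b where "b = real ?b"
    define L where "L = ll (2 * b)"
    have bm: "real m0 \<le> b" "1 \<le> b"
      using m0(2) by (auto simp: b_def mult_le_cancel_right1 intro: order_trans[of _ "real m0"])
    have L: "2 \<le> L" "C * L \<le> 2 * b"
      unfolding L_def using bm m0 by (auto intro!: x0 x1)
    have b4: "4 * L \<le> 2 * b" "w\<^sup>2 / (128 * K\<^sup>2) * L \<le> 2 * b"
    proof -
      have "4 \<le> C" "w\<^sup>2 / (128 * K\<^sup>2) \<le> C" by (simp_all add: C_def)
      then have "4 * L \<le> C * L" "w\<^sup>2 / (128 * K\<^sup>2) * L \<le> C * L"
        using L(1) by (auto intro!: mult_right_mono simp del: times_divide_eq_left)
      with L(2) show "4 * L \<le> 2 * b" "w\<^sup>2 / (128 * K\<^sup>2) * L \<le> 2 * b" by linarith+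
    qed
    have "max w y0 \<le> 4 * K * lil_norm (2 * ?b)"
    proof (rule lil_norm_ge_const)
      have "real m0 \<le> real (2 * ?b)"
        using bm unfolding b_def by simp
      with m0(5) show "(max w y0 / (4 * K))\<^sup>2 \<le> real (2 * ?b)" by (rule order_trans)
    qed (use K y0 in auto)
    then have wy: "w \<le> 2 * R k" "y0 \<le> 2 * R k" by (simp_all add: R_def)
    then have Rpos: "0 < R k" using y0(1) by linarith
    have R2: "(R k)\<^sup>2 = 16 * K\<^sup>2 * b * L"
      unfolding R_def power_mult_distrib lil_norm_sq_2 by (simp add: b_def L_def)
    \<comment> \<open>Tuned to R \<theta> = L/4: the exit value of cosh is then cosh(L), while over
      b steps the growth (1 + 2L/b)^b >= exp(L) beats 2 cosh(L/2). The gain \<theta>^2 4096 K^2 / 4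
      equals 4L/b.\<close>
    define \<theta> where "\<theta> = R k / (64 * b * K\<^sup>2)"
    have \<theta>: "0 < \<theta>" using Rpos bm K by (simp add: \<theta>_def)
    have R\<theta>: "R k * \<theta> = L / 4"
      using R2 bm K unfolding \<theta>_def by (simp add: power2_eq_square)
    have \<theta>2: "\<theta>\<^sup>2 = L / (256 * b * K\<^sup>2)"
      using bm K unfolding \<theta>_def power_divide R2 by (simp add: power2_eq_square field_simps)
    define d where "d = \<epsilon> * ll (2 * R k) / (2 * R k)"
    have "1 / (2 * cosh (4 * R k * \<theta>)) \<le> Er (?f k)"
    proof (rule exit_cosh[OF Rpos \<theta>, where A = ?A and d = d and \<gamma> = "2 * L / b"])
      show "LB (trunc (2 * R k))" "LB ?A" by (intro blip_power LB_trunc)+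
      show "\<bar>trunc (2 * R k) x\<bar> \<le> 2 * R k" for x using Rpos by (intro abs_trunc_le) simp
      show "N (trunc (2 * R k)) \<le> d" "N (\<lambda>x. - trunc (2 * R k) x) \<le> d"
        unfolding d_def using y0(2,3)[OF wy(2)] by (auto simp: abs_le_iff)
      show "0 \<le> ?A x" for x by simp
      show "?A x \<le> (trunc (2 * R k) x)\<^sup>2" for x
      proof -
        have "\<bar>trunc w x\<bar> \<le> \<bar>trunc (2 * R k) x\<bar>"
          using wy(1) w unfolding trunc_def by (simp add: max_def min_def)
        then show ?thesis by (simp add: abs_le_square_iff)
      qed
      show "\<theta>\<^sup>2 * ?A x \<le> 1" for x
      proof -
        have "?A x \<le> w\<^sup>2"
          using abs_trunc_le[OF w, of x] w by (simp add: abs_le_square_iff[symmetric])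
        then have "\<theta>\<^sup>2 * ?A x \<le> \<theta>\<^sup>2 * w\<^sup>2" by (intro mult_left_mono) auto
        also have "\<dots> \<le> 1"
          using b4(2) bm K unfolding \<theta>2 by (simp add: field_simps)
        finally show ?thesis .
      qed
      show "0 \<le> 2 * L / b" using L bm by simp
      show "2 * L / b \<le> \<theta>\<^sup>2 * N ?A / 4 - \<theta> * d"
      proof -
        have "\<theta>\<^sup>2 * (4096 * K\<^sup>2) \<le> \<theta>\<^sup>2 * N ?A" by (intro mult_left_mono NA) simp
        moreover have "\<theta>\<^sup>2 * (4096 * K\<^sup>2) = 16 * L / b"
          unfolding \<theta>2 using bm K by (simp add: field_simps)
        moreover have "\<theta> * d \<le> 2 * L / b"
        proof -
          have "2 * R k \<le> (1 + 8 * K) * (2 * b)"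
          proof (rule power2_le_imp_le)
            have "L \<le> 2 * b" unfolding L_def using bm by (intro ll_le_self) simp
            then have "(2 * R k)\<^sup>2 \<le> 64 * K\<^sup>2 * b * (2 * b)"
              unfolding power_mult_distrib R2 using K bm by (simp add: mult_left_mono)
            also have "\<dots> \<le> (8 * K)\<^sup>2 * (2 * b)\<^sup>2"
              using K bm by (simp add: power2_eq_square)
            also have "\<dots> \<le> (1 + 8 * K)\<^sup>2 * (2 * b)\<^sup>2"
              using K by (intro mult_right_mono power_mono) auto
            finally show "(2 * R k)\<^sup>2 \<le> ((1 + 8 * K) * (2 * b))\<^sup>2"
              by (simp add: power_mult_distrib)
          qed (use K bm in auto)
          then have "ll (2 * R k) \<le> ll ((1 + 8 * K) * (2 * b))"
            by (rule ll_mono)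
          also have "\<dots> \<le> (1 + 8 * K) * L"
            unfolding L_def using K by (intro ll_scale_le) simp
          finally have "\<epsilon> * ll (2 * R k) \<le> \<epsilon> * ((1 + 8 * K) * L)"
            using \<epsilon> by (intro mult_left_mono) auto
          also have "\<dots> = 256 * K\<^sup>2 * L"
            unfolding \<epsilon>_def using K by (simp add: field_simps)
          finally have "\<theta> * d \<le> \<theta> * (256 * K\<^sup>2 * L / (2 * R k))"
            unfolding d_def using \<theta> Rpos by (intro mult_left_mono divide_right_mono) auto
          also have "\<dots> = 2 * L / b"
            unfolding \<theta>_def using Rpos bm K by (simp add: field_simps)
          finally show ?thesis .
        qed
        ultimately show ?thesis by (simp add: field_simps)
      qed
      show "2 * cosh (2 * R k * \<theta>) \<le> (1 + 2 * L / b) ^ ?b"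
      proof -
        have g: "2 * L / b \<le> 1" "0 \<le> 2 * L / b" using b4(1) bm L by (auto simp: field_simps)
        have "exp (L / b) \<le> 1 + L / b + (L / b)\<^sup>2"
          using g by (intro exp_bound) auto
        also have "\<dots> \<le> 1 + 2 * L / b"
        proof -
          have "(L / b) * (L / b) \<le> (L / b) * 1"
            using g L(1) bm by (intro mult_left_mono) auto
          then show ?thesis by (simp add: power2_eq_square)
        qed
        finally have "exp (L / b) ^ ?b \<le> (1 + 2 * L / b) ^ ?b"
          by (intro power_mono) auto
        moreover have "exp (L / b) ^ ?b = exp L"
          using m0(2) unfolding exp_of_nat_mult[symmetric] b_def by simp
        moreover have "2 * cosh (2 * R k * \<theta>) \<le> exp L"
        proof -
          have "2 * R k * \<theta> = L / 2" using R\<theta> by simp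
          then have "2 * cosh (2 * R k * \<theta>) \<le> 2 * exp (L / 2)"
            using cosh_le_exp[of "L / 2"] L(1) by (simp only:) simp
          also have "\<dots> \<le> exp (L / 2) * exp (L / 2)"
          proof (rule mult_right_mono)
            show "2 \<le> exp (L / 2)" using exp_ge_add_one_self[of "L / 2"] L(1) by linarith
          qed simp
          also have "\<dots> = exp L" by (simp flip: exp_add)
          finally show ?thesis .
        qed
        ultimately show ?thesis by linarith
      qed
    qed
    moreover have "4 * R k * \<theta> = L" using R\<theta> by simp
    ultimately show ?thesis by (simp only: L_def b_def)
  qed
  \<comment> \<open>cosh(ll x) <= 3 + lg x, and lg x grows by at most 1 per doubling; so it is at
    most k + c and a shifted harmonic series appears.\<close>
  define c where "c = nat \<lceil>lg (real m0)\<rceil> + 4"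
  have harm: "1 / 2 * (1 / real (k + c)) \<le> Er (?f k)" for k
  proof -
    let ?x = "2 * real (2 ^ k * m0)"
    have "cosh (ll ?x) \<le> exp (ll ?x)"
      using ll_ge_1[of ?x] by (intro cosh_le_exp) linarith
    also have "\<dots> \<le> 3 + lg ?x"
      unfolding exp_ll using exp_le lg_ge_1[of ?x] by auto
    also have "lg ?x \<le> real (Suc k) + lg m0"
    proof -
      have "lg (2 ^ Suc k * real m0) \<le> ln (2 ^ Suc k) + lg m0"
        by (intro lg_mult_le one_le_power) simp
      also have "ln (2 ^ Suc k :: real) = real (Suc k) * ln 2"
        by (rule ln_realpow)
      also have "\<dots> \<le> real (Suc k) * 1"
        using ln_le_minus_one[of "2::real"] by (intro mult_left_mono) auto
      finally show ?thesis by (simp add: mult.assoc)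
    qed
    also have "3 + (real (Suc k) + lg m0) \<le> real (k + c)"
      unfolding c_def using real_nat_ceiling_ge[of "lg (real m0)"] by simp
    finally have *: "cosh (ll ?x) \<le> real (k + c)" by simp
    have "1 / 2 * (1 / real (k + c)) = 1 / (2 * real (k + c))" by simp
    also have "\<dots> \<le> 1 / (2 * cosh (ll ?x))"
      using * cosh_real_pos[of "ll ?x"] by (intro divide_left_mono mult_pos_pos) (auto simp: c_def)
    finally show ?thesis using p[of k] by linarith
  qed
  have "(\<Sum>k<r. 1 / 2 * (1 / real (k + c))) \<le> - ln (1 - l)" for r
  proof -
    have "(\<Sum>k<r. 1 / 2 * (1 / real (k + c))) \<le> (\<Sum>k<r. Er (?f k))"
      by (intro sum_mono harm)
    also have "\<dots> \<le> - ln (1 - l)"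
      by (rule doubling_blocks[OF bd m0(1,2) R_def LB_trunc, where c = 1]) (auto simp: trunc_eq)
    finally show ?thesis .
  qed
  then have "summable (\<lambda>k. 1 / 2 * (1 / real (k + c)))"
    by (intro summableI_nonneg_bounded) auto
  then have "summable (\<lambda>k. 1 / real (k + c))"
    using summable_cmult_iff[of "1 / 2 :: real" "\<lambda>k. 1 / real (k + c)"] by simp
  then have "summable (\<lambda>k. 1 / real k)"
    by (subst (asm) summable_iff_shift[of "\<lambda>k. 1 / real k" c])
  then show False
    using not_summable_harmonic[where 'a = real] by (simp add: inverse_eq_divide)
qed

end

section \<open>Exponential inequality and the upper half\<close>

lemma exp_le_cubic:
  fixes w :: real
  assumes "\<bar>w\<bar> \<le> b"
  shows "exp w \<le> 1 + w + w\<^sup>2 / 2 + \<bar>w\<bar> ^ 3 * exp b / 6"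
proof -
  obtain t where t: "\<bar>t\<bar> \<le> \<bar>w\<bar>" "exp w = (\<Sum>m<3. w ^ m / fact m) + exp t / fact 3 * w ^ 3"
    using Maclaurin_exp_le[of w 3] by blast
  have "exp t / fact 3 * w ^ 3 \<le> \<bar>w\<bar> ^ 3 * exp b / 6"
  proof -
    have "exp t / fact 3 * w ^ 3 \<le> exp t / fact 3 * \<bar>w\<bar> ^ 3"
      by (intro mult_left_mono) (auto simp flip: power_abs)
    also have "\<dots> \<le> exp b / 6 * \<bar>w\<bar> ^ 3"
      using t(1) assms by (intro mult_right_mono) (auto simp: fact_numeral)
    finally show ?thesis by (simp add: mult.commute)
  qed
  then show ?thesis
    unfolding t(2) by (simp add: eval_nat_numeral)
qed

lemma cube_le_exp:
  fixes x :: real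
  assumes "0 \<le> x" shows "x ^ 3 / 6 \<le> exp x"
proof -
  obtain t where t: "exp x = (\<Sum>m<4. x ^ m / fact m) + exp t / fact 4 * x ^ 4"
    using Maclaurin_exp_le[of x 4] by blast
  have "0 \<le> exp t / fact 4 * x ^ 4" using assms by simp
  then show ?thesis
    unfolding t using assms by (simp add: eval_nat_numeral)
qed

text \<open>One function for two tasks: it is the normalized third moment in the exponential bound,
  and it equals 1 where |x| >= y, so its sum over a block also dominates the event that some summand
  gets truncated.\<close>

definition cube_ratio :: "real \<Rightarrow> real \<Rightarrow> real" where
  "cube_ratio y x = \<bar>trunc y x / y\<bar> ^ 3"

lemma LB_cube_ratio: "LB (cube_ratio y)"
proof -
  have "LB (\<lambda>x. \<bar>inverse y * trunc y x\<bar> ^ 3)"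
    by (intro blip_power blip_abs blip_cmult LB_trunc)
  then show ?thesis by (simp add: cube_ratio_def[abs_def] divide_inverse mult.commute)
qed

lemma cube_ratio_nonneg: "0 \<le> cube_ratio y x"
  by (simp add: cube_ratio_def)

lemma cube_ratio_eq_1:
  assumes "0 < y" "y \<le> \<bar>x\<bar>" shows "cube_ratio y x = 1"
proof -
  have "\<bar>trunc y x\<bar> = y"
    using assms by (auto simp: trunc_def)
  then show ?thesis
    using assms(1) by (simp add: cube_ratio_def)
qed

text \<open>A dyadic layer decomposition of the cube. It stops after \<open>I\<close> layers with an
  explicit remainder, because \<open>N\<close> is only finitely sub-additive.\<close>

lemma cube_ratio_layers:
  assumes "0 < y"
  shows "cube_ratio y x \<le> (\<Sum>i<I. 8 / 8 ^ i * ramp (y / 2 ^ Suc i) (y / 2 ^ i) \<bar>x\<bar>) + 8 / 8 ^ I"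
proof (induction I)
  case 0
  have "\<bar>trunc y x / y\<bar> \<le> 1" using assms abs_trunc_le[of y x] by simp
  then have "cube_ratio y x \<le> 1"
    unfolding cube_ratio_def by (intro power_le_one) auto
  then show ?case by simp
next
  case (Suc I)
  have nn: "0 \<le> 8 / 8 ^ i * ramp (y / 2 ^ Suc i) (y / 2 ^ i) \<bar>x\<bar>" for i
    using ramp_range by simp
  show ?case
  proof (cases "y / 2 ^ I \<le> \<bar>x\<bar>")
    case True
    have "y / 2 ^ Suc I < y / 2 ^ I" using assms by (simp add: field_simps)
    from ramp_eq_1[OF this True]
    have "(\<Sum>i<Suc I. 8 / 8 ^ i * ramp (y / 2 ^ Suc i) (y / 2 ^ i) \<bar>x\<bar>)
        = (\<Sum>i<I. 8 / 8 ^ i * ramp (y / 2 ^ Suc i) (y / 2 ^ i) \<bar>x\<bar>) + 8 / 8 ^ I"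
      by simp
    moreover have "(0::real) \<le> 8 / 8 ^ Suc I" by simp
    ultimately show ?thesis using Suc by linarith
  next
    case False
    have "\<bar>trunc y x\<bar> \<le> \<bar>x\<bar>" using assms by (auto simp: trunc_def)
    then have "\<bar>trunc y x\<bar> \<le> y / 2 ^ I" using False by linarith
    then have "\<bar>trunc y x / y\<bar> \<le> 1 / 2 ^ I"
      using assms by (simp add: field_simps)
    then have "cube_ratio y x \<le> (1 / 2 ^ I) ^ 3"
      unfolding cube_ratio_def by (intro power_mono) auto
    also have "\<dots> = 8 / 8 ^ Suc I"
    proof -
      have "((2::real) ^ I) ^ 3 = (2 ^ 3) ^ I" by (simp only: power_mult[symmetric] mult.commute)
      then show ?thesis by (simp add: power_divide)
    qed
    finally have "cube_ratio y x \<le> 8 / 8 ^ Suc I" .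
    moreover have "0 \<le> (\<Sum>i<Suc I. 8 / 8 ^ i * ramp (y / 2 ^ Suc i) (y / 2 ^ i) \<bar>x\<bar>)"
      by (intro sum_nonneg nn)
    ultimately show ?thesis by linarith
  qed
qed

text \<open>The lower counterpart of \<open>lil_quot_norm_bound\<close>, with the factor r^2 tracked
  so that the layers at y / 2^i can be summed.\<close>

lemma lil_quot_ge:
  assumes "0 < \<eta>" "1 \<le> n" "0 < r" "r \<le> 1"
  shows "2 * \<eta>\<^sup>2 / (1 + 2 * \<eta>) * r\<^sup>2 * real n \<le> lil_quot (r * (\<eta> * lil_norm n))"
proof -
  have "lil_norm n \<le> 2 * real n"
  proof (rule power2_le_imp_le)
    have "2 * real n * ll n \<le> 2 * real n * real n"
      using assms ll_le_self[of n] by (intro mult_left_mono) auto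
    then show "(lil_norm n)\<^sup>2 \<le> (2 * real n)\<^sup>2"
      unfolding lil_norm_sq by (simp add: power2_eq_square) (smt (verit) mult_nonneg_nonneg of_nat_0_le_iff)
  qed simp
  then have "r * (\<eta> * lil_norm n) \<le> 1 * (\<eta> * (2 * real n))"
    using assms lil_norm_nonneg[of n] by (intro mult_mono) auto
  also have "\<dots> \<le> (1 + 2 * \<eta>) * real n" using assms by (simp add: algebra_simps)
  finally have "ll (r * (\<eta> * lil_norm n)) \<le> ll ((1 + 2 * \<eta>) * real n)"
    by (rule ll_mono)
  also have "\<dots> \<le> (1 + 2 * \<eta>) * ll n" using assms by (intro ll_scale_le) auto
  finally have le: "ll (r * (\<eta> * lil_norm n)) \<le> (1 + 2 * \<eta>) * ll n" .
  have pos: "0 < r * (\<eta> * lil_norm n)" using assms lil_norm_pos[of n] by simp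
  have "2 * \<eta>\<^sup>2 / (1 + 2 * \<eta>) * r\<^sup>2 * real n = (r * (\<eta> * lil_norm n))\<^sup>2 / ((1 + 2 * \<eta>) * ll n)"
  proof -
    define q where "q = 1 + 2 * \<eta>"
    have "0 < q" using assms by (simp add: q_def)
    then show ?thesis
      unfolding power_mult_distrib lil_norm_sq q_def[symmetric] using ll_pos[of n] by (simp add: field_simps)
  qed
  also have "\<dots> \<le> (r * (\<eta> * lil_norm n))\<^sup>2 / ll (r * (\<eta> * lil_norm n))"
    using le ll_pos ll_pos[of n] assms by (intro divide_left_mono) auto
  also have "\<dots> = lil_quot (r * (\<eta> * lil_norm n))"
    using pos by (simp add: lil_quot_def)
  finally show ?thesis .
qed

context iid_seq
begin

definition second_moment_le :: "real \<Rightarrow> bool" where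
  "second_moment_le v \<longleftrightarrow> (\<forall>w\<ge>0. N (\<lambda>x. (trunc w x)\<^sup>2) \<le> v)"

definition mean_zero :: "real \<Rightarrow> bool" where
  "mean_zero c \<longleftrightarrow> ((\<lambda>y. N (\<lambda>x. c * trunc y x)) \<longlongrightarrow> 0) at_top"

lemma second_moment_le_mono: "second_moment_le v \<Longrightarrow> v \<le> v' \<Longrightarrow> second_moment_le v'"
  unfolding second_moment_le_def by (meson order_trans)

lemma second_moment_nonneg: "second_moment_le v \<Longrightarrow> 0 \<le> v"
  using N_bounds(1)[OF blip_power[OF LB_trunc], of 0 0 2]
  unfolding second_moment_le_def by (meson order_refl order_trans zero_le_power2)

text \<open>Where the truncations differ, |x| > a, so the difference is at most the truncated square
  divided by \<open>a\<close>.\<close>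

lemma N_trunc_diff_le:
  assumes "second_moment_le v" "0 < a" "\<bar>c\<bar> = 1"
  shows "\<bar>N (\<lambda>x. c * trunc (2 * a) x) - N (\<lambda>x. c * trunc a x)\<bar> \<le> v / a"
proof -
  let ?t = "trunc (2 * a)"
  have eq: "\<bar>c * ?t x - c * trunc a x\<bar> = \<bar>?t x - trunc a x\<bar>"
    "\<bar>c * trunc a x - c * ?t x\<bar> = \<bar>?t x - trunc a x\<bar>" for x
    using assms(3) by (simp_all add: abs_mult abs_minus_commute flip: right_diff_distrib)
  have "N (\<lambda>x. \<bar>?t x - trunc a x\<bar>) \<le> N (\<lambda>x. 1 / a * (?t x)\<^sup>2)"
  proof (rule N_mono)
    fix x
    show "\<bar>?t x - trunc a x\<bar> \<le> 1 / a * (?t x)\<^sup>2"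
    proof (cases "\<bar>x\<bar> \<le> a")
      case True
      then show ?thesis using assms(2) by (simp add: trunc_eq)
    next
      case False
      have "\<bar>?t x - trunc a x\<bar> \<le> \<bar>?t x\<bar>" "a \<le> \<bar>?t x\<bar>"
        using False assms(2) unfolding trunc_def max_def min_def by (simp_all split: if_splits)
      then have "a * \<bar>?t x - trunc a x\<bar> \<le> \<bar>?t x\<bar> * \<bar>?t x\<bar>"
        using assms(2) by (intro mult_mono) auto
      then show ?thesis
        using assms(2) by (simp add: field_simps power2_eq_square)
    qed
  qed (intro blip_abs blip_diff blip_cmult blip_power LB_trunc)+
  also have "\<dots> = 1 / a * N (\<lambda>x. (?t x)\<^sup>2)"
    using assms(2) by (intro N_cmult blip_power LB_trunc) auto
  also have "\<dots> \<le> 1 / a * v"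
    using assms unfolding second_moment_le_def by (intro mult_left_mono) auto
  finally have "N (\<lambda>x. \<bar>?t x - trunc a x\<bar>) \<le> v / a" by simp
  then show ?thesis
    using N_diff_le[OF blip_cmult[OF LB_trunc] blip_cmult[OF LB_trunc], of c "2 * a" c a]
      N_diff_le[OF blip_cmult[OF LB_trunc] blip_cmult[OF LB_trunc], of c a c "2 * a"]
    unfolding eq by linarith
qed

text \<open>Telescoping over doublings of the level up to infinity, where the mean vanishes. With a
  finite second moment the rate improves to 1/a.\<close>

lemma N_trunc_drift:
  assumes "second_moment_le v" "mean_zero c" "0 < a" "\<bar>c\<bar> = 1"
  shows "\<bar>N (\<lambda>x. c * trunc a x)\<bar> \<le> 2 * v / a"
proof -
  let ?m = "\<lambda>y. N (\<lambda>x. c * trunc y x)"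
  have v: "0 \<le> v" using second_moment_nonneg[OF assms(1)] .
  \<comment> \<open>Subtracting the remaining geometric tail is what makes the induction
    close.\<close>
  have le': "\<bar>?m (2 ^ n * a) - ?m a\<bar> \<le> 2 * v / a - 2 * (v / (2 ^ n * a))" for n
  proof (induction n)
    case (Suc n)
    have tri: "\<bar>p - r\<bar> \<le> s - u" if "\<bar>p - q\<bar> \<le> u" "\<bar>q - r\<bar> \<le> s - 2 * u" for p q r s u :: real
      using that by linarith
    have "\<bar>?m (2 * (2 ^ n * a)) - ?m (2 ^ n * a)\<bar> \<le> v / (2 ^ n * a)"
      using assms by (intro N_trunc_diff_le) auto
    from tri[OF this Suc] show ?case by (simp add: mult.assoc)
  qed simp
  have le: "\<bar>?m (2 ^ n * a) - ?m a\<bar> \<le> 2 * v / a" for n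
  proof (rule order_trans[OF le'])
    have "0 \<le> v / (2 ^ n * a)" using v assms(3) by simp
    then show "2 * v / a - 2 * (v / (2 ^ n * a)) \<le> 2 * v / a" by linarith
  qed
  have "filterlim (\<lambda>n. (2::real) ^ n) at_top sequentially"
    using filterlim_realpow_sequentially_gt1[of "2::real"] filterlim_at_infinity_imp_filterlim_at_top[of "\<lambda>n. (2::real) ^ n"]
    by (simp add: always_eventually)
  then have "filterlim (\<lambda>n. 2 ^ n * a) at_top sequentially"
    using assms(3) by (intro filterlim_at_top_mult_tendsto_pos[OF tendsto_const]) auto
  then have "(\<lambda>n. ?m (2 ^ n * a)) \<longlonglongrightarrow> 0"
    using assms(2) unfolding mean_zero_def by (rule filterlim_compose[rotated])
  then have "(\<lambda>n. \<bar>?m (2 ^ n * a) - ?m a\<bar>) \<longlonglongrightarrow> \<bar>0 - ?m a\<bar>"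
    by (intro tendsto_intros)
  then have "\<bar>0 - ?m a\<bar> \<le> 2 * v / a"
    by (rule LIMSEQ_le_const2) (use le in auto)
  then show ?thesis by simp
qed

text \<open>Surviving paths carry exp(t S), crossed ones the constant exp(t x1), which is no more
  than exp(t S) at the crossing. Each step multiplies the potential by at most \<open>c\<close>;
  \<open>c >= 1\<close> covers the crossed part as well.\<close>

lemma crossing_le_exp:
  assumes \<xi>: "LB \<xi>" and h: "LB h" "\<And>s. 0 \<le> h s" "\<And>s. h s \<le> 1" "\<And>s. 0 < h s \<Longrightarrow> x1 \<le> s"
    and t: "0 \<le> t" "N (\<lambda>x. exp (t * \<xi> x)) \<le> c" "1 \<le> c"
  shows "Er (\<lambda>x. 1 - stay h \<xi> n x) \<le> c ^ n * exp (- t * x1)"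
proof -
  let ?P = "stay h \<xi>" and ?S = "wsum \<xi>"
  define B where "B = exp (t * x1)"
  have P0: "0 \<le> ?P n x" "?P n x \<le> 1" for n x
    using stay_range[of h] h by auto
  define u where "u n x = (1 - ?P n x) * B + ?P n x * exp (t * ?S n x)" for n x
  have BLu: "BL n (u n)" for n
    unfolding u_def[abs_def]
    by (intro blip_add blip_mult blip_diff_const blip_exp BL_stay BL_wsum h \<xi> order_refl BL_const)
  have LBe: "LB (\<lambda>y. exp (t * \<xi> y))"
    by (intro blip_exp blip_cmult \<xi>)
  have step: "N (\<lambda>y. u (Suc n) (x(n := y))) \<le> c * u n x" for n x
  proof -
    let ?p = "?P n x" and ?s = "?S n x"
    have "N (\<lambda>y. u (Suc n) (x(n := y))) \<le> N (\<lambda>y. (?p * exp (t * ?s)) * exp (t * \<xi> y) + (1 - ?p) * B)"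
    proof (rule N_mono)
      show "LB (\<lambda>y. u (Suc n) (x(n := y)))" by (intro BL_section BLu)
      show "LB (\<lambda>y. (?p * exp (t * ?s)) * exp (t * \<xi> y) + (1 - ?p) * B)"
        by (intro blip_add_const blip_cmult LBe)
      fix y
      let ?r = "?s + \<xi> y"
      have "?p * (h ?r * (exp (t * ?r) - B)) \<ge> 0"
      proof (cases "h ?r = 0")
        case False
        then have "x1 \<le> ?r" using h(2)[of ?r] h(4)[of ?r] by linarith
        then have "0 \<le> exp (t * ?r) - B" unfolding B_def using t(1) by (simp add: mult_left_mono)
        then show ?thesis by (intro mult_nonneg_nonneg P0 h)
      qed simp
      then show "u (Suc n) (x(n := y)) \<le> (?p * exp (t * ?s)) * exp (t * \<xi> y) + (1 - ?p) * B"
        by (simp add: u_def stay_Suc stay_upd wsum_Suc_upd algebra_simps exp_add)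
    qed
    also have "\<dots> = (?p * exp (t * ?s)) * N (\<lambda>y. exp (t * \<xi> y)) + (1 - ?p) * B"
      using P0[of n x] N_add_const[OF blip_cmult[OF LBe], of "?p * exp (t * ?s)" "(1 - ?p) * B"]
        N_cmult[OF LBe, of "?p * exp (t * ?s)"] by simp
    also have "\<dots> \<le> (?p * exp (t * ?s)) * c + c * ((1 - ?p) * B)"
    proof (rule add_mono)
      show "(?p * exp (t * ?s)) * N (\<lambda>y. exp (t * \<xi> y)) \<le> (?p * exp (t * ?s)) * c"
        using P0 t by (intro mult_left_mono) auto
      have "0 \<le> (1 - ?p) * B" using P0[of n x] by (simp add: B_def)
      then show "(1 - ?p) * B \<le> c * ((1 - ?p) * B)"
        using t(3) mult_right_mono[of 1 c "(1 - ?p) * B"] by simp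
    qed
    also have "\<dots> = c * u n x" by (simp add: u_def algebra_simps)
    finally show ?thesis .
  qed
  have "Er (u n) \<le> c ^ n"
  proof (induction n)
    case (Suc n)
    have "Er (u (Suc n)) \<le> Er (\<lambda>x. c * u n x)"
      by (rule Er_le_step[OF BLu blip_cmult[OF BLu] step])
    also have "\<dots> = c * Er (u n)" using t(3) by (intro Er_cmult[OF BLu]) auto
    also have "\<dots> \<le> c * c ^ n" using t(3) Suc by (intro mult_left_mono) auto
    finally show ?case by simp
  qed (simp add: u_def)
  moreover have "Er (\<lambda>x. B * (1 - ?P n x)) \<le> Er (u n)"
  proof (rule Er_mono[OF _ BLu])
    show "BL n (\<lambda>x. B * (1 - ?P n x))"
      by (intro blip_cmult blip_diff_const BL_stay h \<xi> order_refl)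
    show "B * (1 - ?P n x) \<le> u n x" for x
      using P0[of n x] by (simp add: u_def mult.commute)
  qed
  moreover have "Er (\<lambda>x. B * (1 - ?P n x)) = B * Er (\<lambda>x. 1 - ?P n x)"
    by (intro Er_cmult[where k = n] blip_diff_const BL_stay h \<xi> order_refl) (simp add: B_def)
  ultimately have "B * Er (\<lambda>x. 1 - ?P n x) \<le> c ^ n" by linarith
  then show ?thesis
    unfolding B_def by (simp add: exp_minus field_simps)
qed

text \<open>A Fuk-Nagaev type bound: a Gaussian term with variance n v, plus \<open>m\<close> for
  the cubic tail. The part of \<open>x1\<close> beyond \<open>X\<close> pays for the drift.\<close>

lemma crossing_le:
  assumes v: "second_moment_le v" "0 < v" and c: "\<bar>c\<bar> = 1" and y: "0 < y"
    and \<mu>: "N (\<lambda>x. c * trunc y x) \<le> \<mu>" "0 \<le> \<mu>"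
    and m: "real n * N (cube_ratio y) \<le> m" "0 < m" "m \<le> 1"
    and X: "4 * y \<le> X" "X + real n * \<mu> \<le> x1" and n: "1 \<le> n"
    and h: "LB h" "\<And>s. 0 \<le> h s" "\<And>s. h s \<le> 1" "\<And>s. 0 < h s \<Longrightarrow> x1 \<le> s"
  shows "Er (\<lambda>x. 1 - stay h (\<lambda>x. c * trunc y x) n x) \<le> 3 * (exp (- (X\<^sup>2 / (2 * real n * v))) + m)"
proof -
  let ?\<xi> = "\<lambda>x. c * trunc y x"
  \<comment> \<open>The first entry is the Gaussian optimizer. The second keeps exp(2 t y) at most
    1/m, so the cubic contribution over n steps is at most 1; when it is the smaller one, X >= 4y
    still yields a bound by \<open>m\<close>.\<close>
  define t where "t = min (X / (real n * v)) (ln (1 / m) / (2 * y))"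
  have X0: "0 < X" using X y by linarith
  have t0: "0 \<le> t" using X0 n v y m by (simp add: t_def)
  define g where "g = N (cube_ratio y)"
  have g0: "0 \<le> g" unfolding g_def by (intro N_bounds LB_cube_ratio cube_ratio_nonneg)
  define d where "d = t * \<mu> + t\<^sup>2 * v / 2 + exp (2 * t * y) * g"
  have d0: "0 \<le> d" using t0 \<mu> v g0 by (simp add: d_def)
  have LB\<xi>: "LB ?\<xi>" by (intro blip_cmult LB_trunc)
  have "N (\<lambda>x. exp (t * ?\<xi> x)) \<le> N (\<lambda>x. t * ?\<xi> x + (t\<^sup>2 / 2 * (trunc y x)\<^sup>2 + (exp (2 * t * y) * cube_ratio y x + 1)))"
  proof (rule N_mono)
    show "LB (\<lambda>x. exp (t * ?\<xi> x))" by (intro blip_exp blip_cmult LB\<xi>)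
    show "LB (\<lambda>x. t * ?\<xi> x + (t\<^sup>2 / 2 * (trunc y x)\<^sup>2 + (exp (2 * t * y) * cube_ratio y x + 1)))"
      by (intro blip_add blip_cmult blip_power LB_trunc LB_cube_ratio LB_const)
    fix x
    have ab: "\<bar>t * ?\<xi> x\<bar> = t * \<bar>trunc y x\<bar>" using t0 c by (simp add: abs_mult)
    have "\<bar>t * ?\<xi> x\<bar> \<le> t * y"
      unfolding ab using abs_trunc_le[of y x] y t0 by (intro mult_left_mono) auto
    then have "exp (t * ?\<xi> x) \<le> 1 + t * ?\<xi> x + (t * ?\<xi> x)\<^sup>2 / 2 + \<bar>t * ?\<xi> x\<bar> ^ 3 * exp (t * y) / 6"
      by (rule exp_le_cubic)
    also have "(t * ?\<xi> x)\<^sup>2 = t\<^sup>2 * (trunc y x)\<^sup>2"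
      unfolding power2_abs[of "t * ?\<xi> x", symmetric] ab by (simp add: power_mult_distrib)
    also have "\<bar>t * ?\<xi> x\<bar> ^ 3 * exp (t * y) / 6 = (t * y) ^ 3 / 6 * (exp (t * y) * cube_ratio y x)"
      unfolding ab cube_ratio_def using y by (simp add: power_mult_distrib power_divide abs_div)
    also have "\<dots> \<le> exp (t * y) * (exp (t * y) * cube_ratio y x)"
      using t0 y cube_ratio_nonneg by (intro mult_right_mono cube_le_exp) auto
    also have "\<dots> = exp (2 * t * y) * cube_ratio y x"
      by (simp add: mult.assoc flip: exp_add)
    finally show "exp (t * ?\<xi> x) \<le> t * ?\<xi> x + (t\<^sup>2 / 2 * (trunc y x)\<^sup>2 + (exp (2 * t * y) * cube_ratio y x + 1))"
      by simp
  qed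
  also have "\<dots> \<le> N (\<lambda>x. t * ?\<xi> x) + (N (\<lambda>x. t\<^sup>2 / 2 * (trunc y x)\<^sup>2) + (N (\<lambda>x. exp (2 * t * y) * cube_ratio y x) + 1))"
  proof -
    have "N (\<lambda>x. exp (2 * t * y) * cube_ratio y x + 1) = N (\<lambda>x. exp (2 * t * y) * cube_ratio y x) + 1"
      by (intro N_add_const blip_cmult LB_cube_ratio)
    moreover have "N (\<lambda>x. t\<^sup>2 / 2 * (trunc y x)\<^sup>2 + (exp (2 * t * y) * cube_ratio y x + 1))
        \<le> N (\<lambda>x. t\<^sup>2 / 2 * (trunc y x)\<^sup>2) + N (\<lambda>x. exp (2 * t * y) * cube_ratio y x + 1)"
      by (intro N_add blip_add blip_cmult blip_power LB_trunc LB_cube_ratio LB_const)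
    moreover have "N (\<lambda>x. t * ?\<xi> x + (t\<^sup>2 / 2 * (trunc y x)\<^sup>2 + (exp (2 * t * y) * cube_ratio y x + 1)))
        \<le> N (\<lambda>x. t * ?\<xi> x) + N (\<lambda>x. t\<^sup>2 / 2 * (trunc y x)\<^sup>2 + (exp (2 * t * y) * cube_ratio y x + 1))"
      by (intro N_add blip_add blip_cmult blip_power LB_trunc LB_cube_ratio LB_const)
    ultimately show ?thesis by linarith
  qed
  also have "\<dots> \<le> t * \<mu> + (t\<^sup>2 / 2 * v + (exp (2 * t * y) * g + 1))"
  proof (intro add_mono order_refl)
    show "N (\<lambda>x. t * ?\<xi> x) \<le> t * \<mu>"
      unfolding N_cmult[OF LB\<xi> t0] using \<mu> t0 by (intro mult_left_mono)
    have "N (\<lambda>x. t\<^sup>2 / 2 * (trunc y x)\<^sup>2) = t\<^sup>2 / 2 * N (\<lambda>x. (trunc y x)\<^sup>2)"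
      by (intro N_cmult blip_power LB_trunc) auto
    also have "\<dots> \<le> t\<^sup>2 / 2 * v"
      using v(1) y unfolding second_moment_le_def by (intro mult_left_mono) auto
    finally show "N (\<lambda>x. t\<^sup>2 / 2 * (trunc y x)\<^sup>2) \<le> t\<^sup>2 / 2 * v" .
    show "N (\<lambda>x. exp (2 * t * y) * cube_ratio y x) \<le> exp (2 * t * y) * g"
      unfolding g_def by (subst N_cmult[OF LB_cube_ratio]) auto
  qed
  also have "\<dots> = 1 + d" by (simp add: d_def)
  finally have mgf: "N (\<lambda>x. exp (t * ?\<xi> x)) \<le> 1 + d" .
  have "Er (\<lambda>x. 1 - stay h ?\<xi> n x) \<le> (1 + d) ^ n * exp (- t * x1)"
    using d0 by (intro crossing_le_exp[OF LB\<xi> h t0 mgf]) auto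
  also have "\<dots> \<le> exp d ^ n * exp (- t * x1)"
    using d0 exp_ge_add_one_self[of d] by (intro mult_right_mono power_mono) auto
  also have "\<dots> = exp (real n * d - t * x1)"
    by (simp add: exp_diff exp_minus divide_inverse flip: exp_of_nat_mult)
  also have "\<dots> \<le> exp (1 + (t\<^sup>2 * (real n * v) / 2 - t * X))"
  proof -
    have "exp (2 * t * y) * (real n * g) \<le> (1 / m) * m"
    proof (rule mult_mono)
      have "2 * t * y \<le> ln (1 / m)"
        using y unfolding t_def by (simp add: min_def field_simps)
      then show "exp (2 * t * y) \<le> 1 / m"
        using m(2) by (subst (asm) exp_le_cancel_iff[symmetric], subst (asm) exp_ln) auto
    qed (use m g0 in \<open>auto simp: g_def\<close>)
    then have "exp (2 * t * y) * (real n * g) \<le> 1" using m by simp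
    moreover have "t * (X + real n * \<mu>) \<le> t * x1" using X t0 by (intro mult_left_mono)
    ultimately have "real n * d - t * x1 \<le> 1 + (t\<^sup>2 * (real n * v) / 2 - t * X)"
      by (simp add: d_def algebra_simps)
    then show ?thesis by simp
  qed
  also have "\<dots> = exp 1 * exp (t\<^sup>2 * (real n * v) / 2 - t * X)" by (rule exp_add)
  also have "\<dots> \<le> 3 * exp (t\<^sup>2 * (real n * v) / 2 - t * X)"
    using exp_le by (intro mult_right_mono) auto
  also have "\<dots> \<le> 3 * (exp (- (X\<^sup>2 / (2 * real n * v))) + m)"
  proof (intro mult_left_mono)
    have nv: "0 < real n * v" using n v by simp
    show "exp (t\<^sup>2 * (real n * v) / 2 - t * X) \<le> exp (- (X\<^sup>2 / (2 * real n * v))) + m"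
    proof (cases "X / (real n * v) \<le> ln (1 / m) / (2 * y)")
      case True
      then have "t = X / (real n * v)" by (simp add: t_def)
      then have "t\<^sup>2 * (real n * v) / 2 - t * X = - (X\<^sup>2 / (2 * real n * v))"
        using nv by (simp add: field_simps power2_eq_square)
      then show ?thesis using m by simp
    next
      case False
      then have t: "t = ln (1 / m) / (2 * y)" "t \<le> X / (real n * v)" by (simp_all add: t_def)
      then have "t * (real n * v) \<le> X" using nv by (simp add: field_simps)
      then have "t * (t * (real n * v)) \<le> t * X" using t0 by (intro mult_left_mono)
      then have "t\<^sup>2 * (real n * v) / 2 - t * X \<le> - (t * X) / 2"
        by (simp add: power2_eq_square mult.assoc)
      also have "\<dots> \<le> - (t * (4 * y)) / 2" using mult_left_mono[OF X(1) t0] by simp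
      also have "\<dots> = ln m" using t(1) y m by (simp add: ln_div)
      finally have "exp (t\<^sup>2 * (real n * v) / 2 - t * X) \<le> exp (ln m)" by simp
      then show ?thesis using m by (simp add: add_increasing)
    qed
  qed auto
  finally show ?thesis .
qed

end

lemma BL_sum_coord: "LB \<phi> \<Longrightarrow> BL n (\<lambda>x. \<Sum>i<n. \<phi> (x i))"
  by (intro BL_sum BL_coord) auto

lemma block_cover:
  fixes n :: "nat \<Rightarrow> nat"
  assumes "mono n" "k1 < k2" "n k1 \<le> m" "m \<le> n k2"
  shows "\<exists>k\<in>{k1..<k2}. n k \<le> m \<and> m \<le> n (Suc k)"
  using assms(2,4)
proof (induction k2)
  case (Suc k2)
  show ?case
  proof (cases "n k2 \<le> m")
    case True
    then show ?thesis using Suc.prems by (intro bexI[of _ k2]) auto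
  next
    case False
    then have "k1 \<noteq> k2" using assms(3) by auto
    then have "k1 < k2" using Suc.prems by simp
    with False Suc.IH show ?thesis by force
  qed
qed simp

lemma stay_eq_0:
  assumes "1 \<le> m" "m \<le> n" "h (wsum \<xi> m x) = 1" shows "stay h \<xi> n x = 0"
  unfolding stay_def using assms by (intro prod_zero bexI[of _ "m - 1"]) auto

context lil_setting
begin

lemma N_cube_ratio_le:
  assumes "0 < y"
  shows "N (cube_ratio y) \<le> (\<Sum>i<I. 8 / 8 ^ i * G (y / 2 ^ Suc i)) + 8 / 8 ^ I"
proof -
  let ?r = "\<lambda>i x. ramp (y / 2 ^ Suc i) (y / 2 ^ i) \<bar>x\<bar>"
  have lt: "y / 2 ^ Suc i < y / 2 ^ i" for i using assms by (simp add: field_simps)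
  have LBr: "LB (?r i)" for i by (intro LB_ramp_abs lt)
  have LBs: "LB (\<lambda>x. \<Sum>i<I. 8 / 8 ^ i * ?r i x)"
    by (rule blip_sum[OF _ _ blip_cmult[OF LBr]]) auto
  have "N (cube_ratio y) \<le> N (\<lambda>x. (\<Sum>i<I. 8 / 8 ^ i * ?r i x) + 8 / 8 ^ I)"
    by (intro N_mono LB_cube_ratio blip_add_const LBs cube_ratio_layers assms)
  also have "\<dots> = N (\<lambda>x. \<Sum>i<I. 8 / 8 ^ i * ?r i x) + 8 / 8 ^ I"
    by (rule N_add_const[OF LBs])
  also have "N (\<lambda>x. \<Sum>i<I. 8 / 8 ^ i * ?r i x) \<le> (\<Sum>i<I. N (\<lambda>x. 8 / 8 ^ i * ?r i x))"
    by (intro N_sum_le blip_cmult LBr) auto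
  also have "\<dots> \<le> (\<Sum>i<I. 8 / 8 ^ i * G (y / 2 ^ Suc i))"
  proof (rule sum_mono)
    fix i
    have "N (\<lambda>x. 8 / 8 ^ i * ?r i x) = 8 / 8 ^ i * N (?r i)"
      by (intro N_cmult LBr) auto
    also have "\<dots> \<le> 8 / 8 ^ i * G (y / 2 ^ Suc i)"
    proof (intro mult_left_mono N_le_G LBr ramp_range)
      fix x assume "0 < ?r i x"
      from ramp_pos[OF lt this] show "y / 2 ^ Suc i \<le> \<bar>x\<bar>" by simp
    qed auto
    finally show "N (\<lambda>x. 8 / 8 ^ i * ?r i x) \<le> 8 / 8 ^ i * G (y / 2 ^ Suc i)" .
  qed
  finally show ?thesis by simp
qed

text \<open>Lower Riemann sum on the points D \<Lambda>^(k-1), whose gaps are (1 - 1/\<Lambda>) D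
  \<Lambda>^k.\<close>

lemma geometric_tail_sum:
  assumes J: "0 \<le> J" "(\<integral>\<^sup>+ t \<in> {0..}. ennreal (F t) \<partial>lborel) = ennreal J"
    and "1 < \<Lambda>" "0 < D"
  shows "(\<Sum>k<r. \<Lambda> ^ k * F (D * \<Lambda> ^ k)) \<le> J / ((1 - 1 / \<Lambda>) * D)"
proof -
  define \<tau> where "\<tau> k = D * \<Lambda> ^ k / \<Lambda>" for k
  have q: "0 < (1 - 1 / \<Lambda>) * D" using assms by simp
  have "(\<Sum>k<r. (\<tau> (Suc k) - \<tau> k) * F (\<tau> (Suc k))) \<le> J"
    using assms by (intro antimono_integral_sum_le[OF F_antimono F_nonneg J(2,1)])
      (auto simp: \<tau>_def incseq_Suc_iff field_simps)
  moreover have "(\<tau> (Suc k) - \<tau> k) * F (\<tau> (Suc k)) = ((1 - 1 / \<Lambda>) * D) * (\<Lambda> ^ k * F (D * \<Lambda> ^ k))" for k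
  proof -
    have "\<tau> (Suc k) = D * \<Lambda> ^ k" using assms by (simp add: \<tau>_def)
    then show ?thesis using assms by (simp add: \<tau>_def field_simps)
  qed
  ultimately have "((1 - 1 / \<Lambda>) * D) * (\<Sum>k<r. \<Lambda> ^ k * F (D * \<Lambda> ^ k)) \<le> J"
    by (simp add: sum_distrib_left)
  then show ?thesis using q by (simp add: field_simps)
qed

text \<open>Here condition (1) controls third moments. Layer i compares with \<open>F\<close> at D
  \<Lambda>^k / 4^(i+1), so its sum over k costs 4^(i+1), while its weight is 8 / 8^i; the product
  decays like 2^(-i).\<close>

lemma summable_cube_ratio:
  assumes choquet_fin "0 < \<eta>" "1 < \<Lambda>" and n: "\<And>k. \<Lambda> ^ k \<le> real (n k)"
  shows "summable (\<lambda>k. \<Lambda> ^ k * N (cube_ratio (\<eta> * lil_norm (n k))))"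
proof -
  obtain J where J: "0 \<le> J" "(\<integral>\<^sup>+ t \<in> {0..}. ennreal (F t) \<partial>lborel) = ennreal J"
    using choquet_finE[OF assms(1)] by metis
  define D where "D = 2 * \<eta>\<^sup>2 / (1 + 2 * \<eta>)"
  have D: "0 < D" using assms by (simp add: D_def)
  define J' where "J' = J / ((1 - 1 / \<Lambda>) * D)"
  have J': "0 \<le> J'" unfolding J'_def using J D assms by simp
  define y where "y k = \<eta> * lil_norm (n k)" for k
  have n1: "1 \<le> n k" for k
  proof -
    have "1 \<le> \<Lambda> ^ k" using assms by (intro one_le_power) simp
    then have "1 \<le> real (n k)" using n[of k] by linarith
    then show ?thesis by simp
  qed
  have y: "0 < y k" for k unfolding y_def using assms lil_norm_pos[OF n1] by simp
  have GF: "G (y k / 2 ^ Suc i) \<le> F (D / 4 ^ Suc i * \<Lambda> ^ k)" for k i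
  proof -
    define r :: real where "r = 1 / 2 ^ Suc i"
    have "((2::real) ^ Suc i)\<^sup>2 = 4 ^ Suc i"
      using power_mult_distrib[of "2::real" 2 "Suc i"] by (simp add: power2_eq_square)
    then have r: "0 < r" "r \<le> 1" "r\<^sup>2 = 1 / 4 ^ Suc i"
      using one_le_power[of "2::real" "Suc i"] by (simp_all add: r_def power_divide)
    have "D * r\<^sup>2 * \<Lambda> ^ k \<le> D * r\<^sup>2 * real (n k)"
      using n D by (intro mult_left_mono) auto
    also have "\<dots> \<le> lil_quot (r * y k)"
      unfolding D_def y_def using assms n1 r by (intro lil_quot_ge)
    finally have "F (lil_quot (r * y k)) \<le> F (D * r\<^sup>2 * \<Lambda> ^ k)"
      using F_antimono unfolding antimono_def by blast
    moreover have "G (r * y k) \<le> F (lil_quot (r * y k))"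
      using r y[of k] by (intro G_le_F) auto
    ultimately show ?thesis using r(3) by (simp add: r_def)
  qed
  have "(\<Sum>k<K. \<Lambda> ^ k * N (cube_ratio (y k))) \<le> 64 * J' + 1" for K
  proof -
    define S where "S = (\<Sum>k<K. \<Lambda> ^ k)"
    have S: "0 \<le> S" unfolding S_def using assms by (intro sum_nonneg) auto
    \<comment> \<open>The number of layers depends on the partial sum, so that the remainder
      contributes at most 1; the resulting bound does not depend on \<open>K\<close>.\<close>
    obtain I where I: "8 * S < 8 ^ I" using real_arch_pow[of "8::real" "8 * S"] by auto
    have "(\<Sum>k<K. \<Lambda> ^ k * N (cube_ratio (y k)))
        \<le> (\<Sum>k<K. \<Lambda> ^ k * ((\<Sum>i<I. 8 / 8 ^ i * F (D / 4 ^ Suc i * \<Lambda> ^ k)) + 8 / 8 ^ I))"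
    proof (intro sum_mono mult_left_mono)
      fix k
      have "N (cube_ratio (y k)) \<le> (\<Sum>i<I. 8 / 8 ^ i * G (y k / 2 ^ Suc i)) + 8 / 8 ^ I"
        by (rule N_cube_ratio_le[OF y])
      also have "\<dots> \<le> (\<Sum>i<I. 8 / 8 ^ i * F (D / 4 ^ Suc i * \<Lambda> ^ k)) + 8 / 8 ^ I"
        by (intro add_mono sum_mono mult_left_mono GF order_refl) auto
      finally show "N (cube_ratio (y k)) \<le> (\<Sum>i<I. 8 / 8 ^ i * F (D / 4 ^ Suc i * \<Lambda> ^ k)) + 8 / 8 ^ I" .
    qed (use assms in auto)
    also have "\<dots> = (\<Sum>i<I. 8 / 8 ^ i * (\<Sum>k<K. \<Lambda> ^ k * F (D / 4 ^ Suc i * \<Lambda> ^ k))) + 8 / 8 ^ I * S"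
    proof -
      have "(\<Sum>k<K. \<Lambda> ^ k * ((\<Sum>i<I. 8 / 8 ^ i * F (D / 4 ^ Suc i * \<Lambda> ^ k)) + 8 / 8 ^ I))
          = (\<Sum>k<K. \<Sum>i<I. 8 / 8 ^ i * (\<Lambda> ^ k * F (D / 4 ^ Suc i * \<Lambda> ^ k))) + 8 / 8 ^ I * S"
        by (simp add: S_def sum_distrib_left sum_distrib_right sum_divide_distrib distrib_left sum.distrib mult.left_commute mult.commute)
      also have "(\<Sum>k<K. \<Sum>i<I. 8 / 8 ^ i * (\<Lambda> ^ k * F (D / 4 ^ Suc i * \<Lambda> ^ k)))
          = (\<Sum>i<I. \<Sum>k<K. 8 / 8 ^ i * (\<Lambda> ^ k * F (D / 4 ^ Suc i * \<Lambda> ^ k)))"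
        by (rule sum.swap)
      finally show ?thesis by (simp only: sum_distrib_left)
    qed
    also have "\<dots> \<le> (\<Sum>i<I. 32 * J' * (1 / 2) ^ i) + 1"
    proof (intro add_mono sum_mono)
      fix i
      have "(\<Sum>k<K. \<Lambda> ^ k * F (D / 4 ^ Suc i * \<Lambda> ^ k)) \<le> J / ((1 - 1 / \<Lambda>) * (D / 4 ^ Suc i))"
        using D assms by (intro geometric_tail_sum[OF J]) auto
      also have "\<dots> = J' * 4 ^ Suc i" by (simp add: J'_def)
      finally have "8 / 8 ^ i * (\<Sum>k<K. \<Lambda> ^ k * F (D / 4 ^ Suc i * \<Lambda> ^ k)) \<le> 8 / 8 ^ i * (J' * 4 ^ Suc i)"
        by (intro mult_left_mono) auto
      also have "\<dots> = 32 * J' * (4 / 8) ^ i" unfolding power_divide by simp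
      finally show "8 / 8 ^ i * (\<Sum>k<K. \<Lambda> ^ k * F (D / 4 ^ Suc i * \<Lambda> ^ k)) \<le> 32 * J' * (1 / 2) ^ i"
        by simp
      show "8 / 8 ^ I * S \<le> 1" using I by (simp add: field_simps)
    qed
    also have "(\<Sum>i<I. 32 * J' * (1 / 2) ^ i) \<le> 32 * J' * 2"
    proof -
      have "(\<Sum>i<I. (1 / 2 :: real) ^ i) = 2 - 2 * (1 / 2) ^ I"
        by (induction I) (auto simp: field_simps)
      also have "\<dots> \<le> 2" by simp
      finally show ?thesis unfolding sum_distrib_left[symmetric] using J' by (intro mult_left_mono) auto
    qed
    finally show ?thesis by simp
  qed
  then have "summable (\<lambda>k. \<Lambda> ^ k * N (cube_ratio (y k)))"
    using assms(3) N_bounds(1)[OF LB_cube_ratio cube_ratio_nonneg]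
    by (intro summableI_nonneg_bounded[where x = "64 * J' + 1"]) auto
  then show ?thesis by (simp add: y_def)
qed

text \<open>Three levels: \<open>s0\<close> carries the exponent, the gap to \<open>s1\<close>
  absorbs the drift, and the gap to \<open>s\<close> is the width of the ramp. The witness adds to
  the truncated crossing the sum of cube ratios, which covers paths with a truncated
  summand.\<close>

lemma block_bound:
  assumes v: "second_moment_le v" "0 < v" and c: "\<bar>c\<bar> = 1" "mean_zero c"
    and n: "1 \<le> n" "n \<le> n'" and s: "0 < s0" "s0 < s1" "s1 < s" and a: "a = lil_norm n"
    and m: "real n' * N (cube_ratio (s0 / 4 * a)) \<le> m" "0 < m" "m \<le> 1"
    and drift: "real n' * (2 * v / (s0 / 4 * a)) \<le> (s1 - s0) * a"
  shows "\<exists>f. BL n' f \<and> (\<forall>x. 0 \<le> f x) \<and> Er f \<le> 3 * exp (- ((s0 * a)\<^sup>2 / (2 * real n' * v))) + 4 * m \<and>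
    (\<forall>x k. n \<le> k \<longrightarrow> k \<le> n' \<longrightarrow> s * lil_norm k \<le> c * (\<Sum>i<k. x i) \<longrightarrow> 1 \<le> f x)"
proof -
  have apos: "0 < a" unfolding a by (rule lil_norm_pos[OF n(1)])
  \<comment> \<open>Makes 4y equal to X = s0 a, the largest cut-off that the crossing bound
    allows.\<close>
  define y where "y = s0 / 4 * a"
  have y: "0 < y" using apos s by (simp add: y_def)
  let ?h = "ramp (s1 * a) (s * a)"
  let ?\<xi> = "\<lambda>x. c * trunc y x"
  have lt: "s1 * a < s * a" using apos s by simp
  have LBh: "LB ?h" by (rule LB_ramp[OF lt])
  have LB\<xi>: "LB ?\<xi>" by (intro blip_cmult LB_trunc)
  have bound3: "e \<le> 3 * z + 4 * w" if "p \<le> 3 * (z + w)" "q \<le> w" "e \<le> p + q" for e p q w z :: real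
    using add_mono[OF that(1,2)] that(3) by (simp add: algebra_simps)
  let ?g = "\<lambda>x. 1 - stay ?h ?\<xi> n' x"
  let ?q = "\<lambda>x. \<Sum>i<n'. cube_ratio y (x i)"
  have BLg: "BL n' ?g" by (intro blip_diff_const BL_stay LB\<xi> LBh order_refl)
  have BLq: "BL n' ?q" by (intro BL_sum_coord LB_cube_ratio)
  have mean: "N ?\<xi> \<le> 2 * v / y"
    using N_trunc_drift[OF v(1) c(2) y c(1)] by linarith
  have "Er ?g \<le> 3 * (exp (- ((s0 * a)\<^sup>2 / (2 * real n' * v))) + m)"
  proof (rule crossing_le[OF v c(1) y mean, where ?x1.0 = "s1 * a"])
    show "real n' * N (cube_ratio y) \<le> m" using m(1) by (simp add: y_def)
    show "s0 * a + real n' * (2 * v / y) \<le> s1 * a"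
      using drift by (simp add: y_def algebra_simps)
    show "s1 * a \<le> r" if "0 < ?h r" for r using ramp_pos[OF lt that] by simp
  qed (use y v m n LBh in \<open>auto simp: y_def ramp_range\<close>)
  moreover have "Er ?q \<le> m"
  proof -
    have "Er ?q \<le> (\<Sum>i<n'. Er (\<lambda>x. cube_ratio y (x i)))"
      by (intro Er_sum_le[where k = n'] BL_coord LB_cube_ratio) auto
    also have "\<dots> = real n' * N (cube_ratio y)" by (simp add: Er_coord[OF LB_cube_ratio])
    finally show ?thesis using m(1) by (simp add: y_def)
  qed
  moreover have "Er (\<lambda>x. ?g x + ?q x) \<le> Er ?g + Er ?q" by (rule Er_add[OF BLg BLq])
  ultimately have "Er (\<lambda>x. ?g x + ?q x) \<le> 3 * exp (- ((s0 * a)\<^sup>2 / (2 * real n' * v))) + 4 * m"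
    using bound3 by blast
  moreover have g0: "0 \<le> ?g x" for x using stay_range[of ?h ?\<xi> n' x] ramp_range by auto
  moreover have q0: "0 \<le> ?q x" for x by (intro sum_nonneg cube_ratio_nonneg)
  moreover have "1 \<le> ?g x + ?q x" if k: "n \<le> k" "k \<le> n'" "s * lil_norm k \<le> c * (\<Sum>i<k. x i)" for x k
  proof (cases "\<exists>i<n'. y \<le> \<bar>x i\<bar>")
    case True
    then obtain i where i: "i < n'" "y \<le> \<bar>x i\<bar>" by blast
    have "1 = cube_ratio y (x i)" using cube_ratio_eq_1[OF y i(2)] by simp
    also have "\<dots> \<le> ?q x" using i by (intro member_le_sum) (auto simp: cube_ratio_nonneg)
    finally show ?thesis using g0[of x] by linarith
  next
    case False
    then have "wsum ?\<xi> k x = c * (\<Sum>i<k. x i)"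
      unfolding wsum_def sum_distrib_left using k(2)
      by (intro sum.cong refl) (metis lessThan_iff less_le_trans linear trunc_eq)
    moreover have "s * a \<le> s * lil_norm k"
      unfolding a using k s by (intro mult_left_mono lil_norm_mono) auto
    ultimately have "?h (wsum ?\<xi> k x) = 1"
      using k(3) by (intro ramp_eq_1[OF lt]) linarith
    then have "stay ?h ?\<xi> n' x = 0" using n k by (intro stay_eq_0[of k]) auto
    then show ?thesis using q0[of x] by simp
  qed
  ultimately show ?thesis
    by (intro exI[of _ "\<lambda>x. ?g x + ?q x"]) (auto intro: blip_add BLg BLq)
qed

lemma exp_neg_ll_le:
  assumes "1 < \<Lambda>" "1 \<le> k" "\<Lambda> ^ k \<le> x" "0 \<le> p"
  shows "exp (- (p * ll x)) \<le> (real k * ln \<Lambda>) powr (- p)"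
proof -
  have pos: "0 < real k * ln \<Lambda>" using assms by simp
  have "real k * ln \<Lambda> = ln (\<Lambda> ^ k)" using assms by (simp add: ln_realpow)
  also have "\<dots> \<le> ln (max (exp 1) x)"
    using assms by (subst ln_le_cancel_iff) auto
  also have "\<dots> = lg x" by (simp add: lg_def)
  also have "\<dots> \<le> exp (ll x)" by (simp add: exp_ll)
  finally have "exp (ll x) powr (- p) \<le> (real k * ln \<Lambda>) powr (- p)"
    using pos assms by (intro powr_mono2') auto
  then show ?thesis by (simp add: powr_def)
qed

text \<open>Packages the upper half as functions with summable expectations, so that
  \<open>V\<close> and the outer capacity can be treated from the same data.\<close>

lemma upper_blocks:
  assumes fin: choquet_fin and v: "second_moment_le v" and mz: "mean_zero 1" "mean_zero (- 1)"
    and s: "0 < s" "v < s\<^sup>2"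
  obtains n :: "nat \<Rightarrow> nat" and e :: "nat \<Rightarrow> real" and k0 :: nat
    and f :: "nat \<Rightarrow> (nat \<Rightarrow> real) \<Rightarrow> real"
  where "mono n" "filterlim n at_top sequentially" "summable e" "\<And>k. 0 \<le> e k"
    "\<And>k. k \<ge> k0 \<Longrightarrow> BL (n (Suc k)) (f k)" "\<And>k x. k \<ge> k0 \<Longrightarrow> 0 \<le> f k x"
    "\<And>k. k \<ge> k0 \<Longrightarrow> Er (f k) \<le> e k"
    "\<And>k x m. k \<ge> k0 \<Longrightarrow> n k \<le> m \<Longrightarrow> m \<le> n (Suc k) \<Longrightarrow> s * lil_norm m \<le> \<bar>\<Sum>i<m. x i\<bar> \<Longrightarrow> 1 \<le> f k x"
proof -
  \<comment> \<open>Strictly between v and s^2; unlike \<open>v\<close> it is certainly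
    positive.\<close>
  define u where "u = (v + s\<^sup>2) / 2"
  have "0 \<le> v" by (rule second_moment_nonneg[OF v])
  then have u: "0 < u" "u < s\<^sup>2" "v \<le> u" using s by (auto simp: u_def)
  have um: "second_moment_le u" by (rule second_moment_le_mono[OF v u(3)])
  have "sqrt u < s" using u s by (simp add: real_less_lsqrt)
  then obtain s1 where s1: "sqrt u < s1" "s1 < s" using dense by blast
  then obtain s0 where s0: "sqrt u < s0" "s0 < s1" using dense by blast
  have s0pos: "0 < s0" using s0(1) u(1) by (meson less_trans real_sqrt_gt_zero)
  have "(sqrt u)\<^sup>2 < s0\<^sup>2" using s0 u by (intro power_strict_mono) auto
  then have us0: "u < s0\<^sup>2" using u by simp
  \<comment> \<open>\<Lambda>^4 = s0^2 / u: two powers are lost since n(k+1) <= \<Lambda>^2 n(k),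
    and the remaining exponent \<Lambda>^2 > 1 makes the series over k converge.\<close>
  define \<Lambda> where "\<Lambda> = sqrt (sqrt (s0\<^sup>2 / u))"
  have \<Lambda>: "1 < \<Lambda>" "\<Lambda>\<^sup>2 * \<Lambda>\<^sup>2 = s0\<^sup>2 / u"
    using us0 u by (auto simp: \<Lambda>_def)
  define n where "n k = nat \<lceil>\<Lambda> ^ k\<rceil>" for k :: nat
  have n_ge: "\<Lambda> ^ k \<le> real (n k)" for k unfolding n_def by (rule real_nat_ceiling_ge)
  have n_le: "real (n k) \<le> \<Lambda> ^ k + 1" for k
  proof -
    have "0 \<le> \<Lambda> ^ k" using \<Lambda> by simp
    then show ?thesis unfolding n_def by linarith
  qed
  have n_mono: "mono n"
    unfolding mono_def n_def using \<Lambda>(1) by (intro allI impI nat_mono ceiling_mono power_increasing) auto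
  have pow_lim: "filterlim (\<lambda>k. \<Lambda> ^ k) at_top sequentially"
    using \<Lambda> filterlim_realpow_sequentially_gt1[of \<Lambda>] filterlim_at_infinity_imp_filterlim_at_top[of "\<lambda>k. \<Lambda> ^ k"]
    by (simp add: always_eventually)
  then have "filterlim (\<lambda>k. real (n k)) at_top sequentially"
    by (rule filterlim_at_top_mono) (simp add: n_ge)
  then have n_lim: "filterlim n at_top sequentially"
    unfolding filterlim_at_top
  proof (intro allI)
    fix Z
    assume "\<forall>Z. \<forall>\<^sub>F k in sequentially. Z \<le> real (n k)"
    then have "\<forall>\<^sub>F k in sequentially. real Z \<le> real (n k)" by blast
    then show "\<forall>\<^sub>F k in sequentially. Z \<le> n k" by simp
  qed
  have n1: "1 \<le> n k" for k
  proof -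
    have "1 \<le> \<Lambda> ^ k" using \<Lambda> by (intro one_le_power) simp
    then have "1 \<le> real (n k)" using n_ge[of k] by linarith
    then show ?thesis by simp
  qed
  define a where "a k = lil_norm (n k)" for k
  \<comment> \<open>The term (1/2)^k only keeps \<open>m k\<close> positive, so that ln (1 / m k)
    makes sense.\<close>
  define m where "m k = \<Lambda>\<^sup>2 * (\<Lambda> ^ k * N (cube_ratio (s0 / 4 * a k))) + (1 / 2) ^ k" for k :: nat
  have g0: "0 \<le> N (cube_ratio y)" for y by (intro N_bounds LB_cube_ratio cube_ratio_nonneg)
  have m_pos: "0 < m k" for k
    unfolding m_def using \<Lambda> g0 by (intro add_nonneg_pos mult_nonneg_nonneg) auto
  have m_sum: "summable m"
    unfolding m_def[abs_def] a_def
    by (intro summable_add summable_mult summable_geometric summable_cube_ratio[OF fin _ \<Lambda>(1) n_ge])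
       (use s0pos in auto)
  \<comment> \<open>Twice the block bound, one copy for each sign of the sum.\<close>
  define e where "e k = 6 * (real k * ln \<Lambda>) powr (- \<Lambda>\<^sup>2) + 8 * m k" for k
  have e0: "0 \<le> e k" for k unfolding e_def using m_pos[of k] by (intro add_nonneg_nonneg) auto
  have "summable (\<lambda>k. real k powr (- \<Lambda>\<^sup>2))"
    using \<Lambda>(1) by (subst summable_real_powr_iff) (simp add: one_less_power)
  then have "summable (\<lambda>k. 6 * ((ln \<Lambda>) powr (- \<Lambda>\<^sup>2) * real k powr (- \<Lambda>\<^sup>2)) + 8 * m k)"
    by (intro summable_add summable_mult m_sum)
  then have e_sum: "summable e"
    unfolding e_def[abs_def] using \<Lambda>(1) by (simp add: powr_mult mult.commute)
  have "filterlim (\<lambda>k. ll (real (n k))) at_top sequentially"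
    by (rule filterlim_compose[OF filterlim_ll]) fact
  then have ev1: "\<forall>\<^sub>F k in sequentially. \<Lambda>\<^sup>2 * u / (s0 / 4 * (s1 - s0)) \<le> ll (real (n k))"
    by (simp add: filterlim_at_top)
  \<comment> \<open>Absorbs the rounding of \<Lambda>^(k+1) up to an integer into one more factor
    \<Lambda>.\<close>
  have ev2: "\<forall>\<^sub>F k in sequentially. 1 / (\<Lambda>\<^sup>2 - \<Lambda>) \<le> \<Lambda> ^ k"
    using pow_lim by (simp add: filterlim_at_top)
  have ev3: "\<forall>\<^sub>F k in sequentially. m k < 1"
    using summable_LIMSEQ_zero[OF m_sum] by (rule order_tendstoD) simp
  obtain k0 where k0: "\<And>k. k \<ge> k0 \<Longrightarrow> \<Lambda>\<^sup>2 * u / (s0 / 4 * (s1 - s0)) \<le> ll (real (n k)) \<and>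
      1 / (\<Lambda>\<^sup>2 - \<Lambda>) \<le> \<Lambda> ^ k \<and> m k < 1 \<and> 1 \<le> k"
    using eventually_conj[OF ev1 eventually_conj[OF ev2 eventually_conj[OF ev3 eventually_ge_at_top[of 1]]]]
    by (auto simp: eventually_sequentially)
  have main: "\<exists>f. BL (n (Suc k)) f \<and> (\<forall>x. 0 \<le> f x) \<and> Er f \<le> e k / 2 \<and>
      (\<forall>x j. n k \<le> j \<longrightarrow> j \<le> n (Suc k) \<longrightarrow> s * lil_norm j \<le> c * (\<Sum>i<j. x i) \<longrightarrow> 1 \<le> f x)"
    if k: "k \<ge> k0" and c: "\<bar>c\<bar> = 1" "mean_zero c" for k c
  proof -
    note kk = k0[OF k]
    have pos: "0 < \<Lambda>\<^sup>2 - \<Lambda>" using \<Lambda>(1) by (simp add: power2_eq_square)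
    have "1 \<le> \<Lambda> ^ k * (\<Lambda>\<^sup>2 - \<Lambda>)" using kk pos by (simp add: field_simps)
    then have n_Suc: "real (n (Suc k)) \<le> \<Lambda>\<^sup>2 * \<Lambda> ^ k"
      using n_le[of "Suc k"] by (simp add: algebra_simps)
    also have "\<dots> \<le> \<Lambda>\<^sup>2 * real (n k)" by (intro mult_left_mono n_ge) simp
    finally have n_Suc': "real (n (Suc k)) \<le> \<Lambda>\<^sup>2 * real (n k)" .
    have apos: "0 < a k" unfolding a_def by (rule lil_norm_pos[OF n1])
    have a2: "(a k)\<^sup>2 = 2 * real (n k) * ll (real (n k))" unfolding a_def by (rule lil_norm_sq)
    have ex: "\<exists>f. BL (n (Suc k)) f \<and> (\<forall>x. 0 \<le> f x) \<and>
        Er f \<le> 3 * exp (- ((s0 * a k)\<^sup>2 / (2 * real (n (Suc k)) * u))) + 4 * m k \<and>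
        (\<forall>x j. n k \<le> j \<longrightarrow> j \<le> n (Suc k) \<longrightarrow> s * lil_norm j \<le> c * (\<Sum>i<j. x i) \<longrightarrow> 1 \<le> f x)"
    proof (rule block_bound[OF um u(1) c n1 _ s0pos s0(2) s1(2) a_def])
      show "n k \<le> n (Suc k)" using n_mono by (simp add: mono_def)
      have "real (n (Suc k)) * N (cube_ratio (s0 / 4 * a k)) \<le> \<Lambda>\<^sup>2 * \<Lambda> ^ k * N (cube_ratio (s0 / 4 * a k))"
        by (intro mult_right_mono n_Suc g0)
      also have "\<dots> \<le> m k" by (simp add: m_def mult.assoc)
      finally show "real (n (Suc k)) * N (cube_ratio (s0 / 4 * a k)) \<le> m k" .
      show "0 < m k" "m k \<le> 1" using m_pos kk by auto
      have sd: "0 < s0 / 4 * (s1 - s0)" using s0 s0pos by simp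
      have "real (n (Suc k)) * (2 * u) \<le> \<Lambda>\<^sup>2 * real (n k) * (2 * u)"
        using u by (intro mult_right_mono n_Suc') auto
      also have "\<dots> = 2 * real (n k) * (\<Lambda>\<^sup>2 * u)" by simp
      also have "\<dots> \<le> 2 * real (n k) * (ll (real (n k)) * (s0 / 4 * (s1 - s0)))"
        using kk sd by (intro mult_left_mono) (auto simp: pos_divide_le_eq)
      also have "\<dots> = (s1 - s0) * a k * (s0 / 4 * a k)"
        using a2 by (simp add: power2_eq_square)
      finally show "real (n (Suc k)) * (2 * u / (s0 / 4 * a k)) \<le> (s1 - s0) * a k"
        using apos s0pos by (simp add: pos_divide_le_eq)
    qed
    have "exp (- ((s0 * a k)\<^sup>2 / (2 * real (n (Suc k)) * u))) \<le> (real k * ln \<Lambda>) powr (- \<Lambda>\<^sup>2)"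
    proof -
      have "\<Lambda>\<^sup>2 * ll (real (n k)) * (2 * real (n (Suc k)) * u)
          \<le> \<Lambda>\<^sup>2 * ll (real (n k)) * (2 * (\<Lambda>\<^sup>2 * real (n k)) * u)"
        using n_Suc' u ll_pos[of "n k"] by (intro mult_left_mono mult_right_mono) auto
      also have "\<dots> = (\<Lambda>\<^sup>2 * \<Lambda>\<^sup>2) * u * (2 * real (n k) * ll (real (n k)))" by simp
      also have "\<dots> = (s0 * a k)\<^sup>2"
        unfolding \<Lambda>(2) power_mult_distrib a2 using u by simp
      finally have "\<Lambda>\<^sup>2 * ll (real (n k)) \<le> (s0 * a k)\<^sup>2 / (2 * real (n (Suc k)) * u)"
        using n1[of "Suc k"] u by (subst pos_le_divide_eq) auto
      then have "exp (- ((s0 * a k)\<^sup>2 / (2 * real (n (Suc k)) * u))) \<le> exp (- (\<Lambda>\<^sup>2 * ll (real (n k))))"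
        by simp
      also have "\<dots> \<le> (real k * ln \<Lambda>) powr (- \<Lambda>\<^sup>2)"
        using kk \<Lambda> by (intro exp_neg_ll_le n_ge) auto
      finally show ?thesis .
    qed
    then have "3 * exp (- ((s0 * a k)\<^sup>2 / (2 * real (n (Suc k)) * u))) + 4 * m k \<le> e k / 2"
      unfolding e_def by (simp add: add_divide_distrib)
    then have "Er f \<le> e k / 2"
      if "Er f \<le> 3 * exp (- ((s0 * a k)\<^sup>2 / (2 * real (n (Suc k)) * u))) + 4 * m k" for f
      using that by (rule order_trans[rotated])
    with ex show ?thesis by (elim ex_forward conjE) (intro conjI; assumption | blast)+
  qed
  have "\<exists>f. BL (n (Suc k)) f \<and> (\<forall>x. 0 \<le> f x) \<and> Er f \<le> e k \<and>
      (\<forall>x j. n k \<le> j \<longrightarrow> j \<le> n (Suc k) \<longrightarrow> s * lil_norm j \<le> \<bar>\<Sum>i<j. x i\<bar> \<longrightarrow> 1 \<le> f x)"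
    if k: "k \<ge> k0" for k
  proof -
    obtain f where f: "BL (n (Suc k)) f" "\<And>x. 0 \<le> f x" "Er f \<le> e k / 2"
      "\<And>x j. n k \<le> j \<Longrightarrow> j \<le> n (Suc k) \<Longrightarrow> s * lil_norm j \<le> 1 * (\<Sum>i<j. x i) \<Longrightarrow> 1 \<le> f x"
      using main[OF k, of 1] mz by (auto simp: mean_zero_def)
    obtain g where g: "BL (n (Suc k)) g" "\<And>x. 0 \<le> g x" "Er g \<le> e k / 2"
      "\<And>x j. n k \<le> j \<Longrightarrow> j \<le> n (Suc k) \<Longrightarrow> s * lil_norm j \<le> (- 1) * (\<Sum>i<j. x i) \<Longrightarrow> 1 \<le> g x"
      using main[OF k, of "- 1"] mz by (auto simp: mean_zero_def)
    have "1 \<le> f x + g x" if j: "n k \<le> j" "j \<le> n (Suc k)" "s * lil_norm j \<le> \<bar>\<Sum>i<j. x i\<bar>" for x j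
    proof (cases "0 \<le> (\<Sum>i<j. x i)")
      case True
      then show ?thesis using f(4)[OF j(1,2), of x] j(3) g(2)[of x] by simp
    next
      case False
      then show ?thesis using g(4)[OF j(1,2), of x] j(3) f(2)[of x] by simp
    qed
    moreover have "Er (\<lambda>x. f x + g x) \<le> e k"
      using Er_add[OF f(1) g(1)] f(3) g(3) by linarith
    ultimately show ?thesis
      using f(2) g(2) by (intro exI[of _ "\<lambda>x. f x + g x"]) (auto intro: blip_add f(1) g(1))
  qed
  then have "\<forall>k\<in>{k0..}. \<exists>f. BL (n (Suc k)) f \<and> (\<forall>x. 0 \<le> f x) \<and> Er f \<le> e k \<and>
      (\<forall>x j. n k \<le> j \<longrightarrow> j \<le> n (Suc k) \<longrightarrow> s * lil_norm j \<le> \<bar>\<Sum>i<j. x i\<bar> \<longrightarrow> 1 \<le> f x)"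
    by (intro ballI) (simp only: atLeast_iff)
  from bchoice[OF this] obtain f where f: "\<forall>k\<in>{k0..}. BL (n (Suc k)) (f k) \<and> (\<forall>x. 0 \<le> f k x) \<and> Er (f k) \<le> e k \<and>
      (\<forall>x j. n k \<le> j \<longrightarrow> j \<le> n (Suc k) \<longrightarrow> s * lil_norm j \<le> \<bar>\<Sum>i<j. x i\<bar> \<longrightarrow> 1 \<le> f k x)" ..
  show ?thesis
  proof (rule that[OF n_mono n_lim e_sum e0])
    fix k assume "k0 \<le> k"
    then have k: "k \<in> {k0..}" by simp
    note fk = bspec[OF f k]
    show "BL (n (Suc k)) (f k)" by (rule conjunct1[OF fk])
    show "0 \<le> f k x" for x
      using conjunct1[OF conjunct2[OF fk]] by (rule spec)
    show "Er (f k) \<le> e k" by (rule conjunct1[OF conjunct2[OF conjunct2[OF fk]]])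
    show "1 \<le> f k x" if "n k \<le> m" "m \<le> n (Suc k)" "s * lil_norm m \<le> \<bar>\<Sum>i<m. x i\<bar>" for x m
      using conjunct2[OF conjunct2[OF conjunct2[OF fk]]] that by (elim allE impE)
  qed
qed

end

lemma summable_tail_sum_le:
  fixes e :: "nat \<Rightarrow> real"
  assumes "summable e" "\<And>k. 0 \<le> e k" "0 < \<epsilon>"
  shows "\<exists>k1\<ge>k0. \<forall>r. (\<Sum>i<r. e (k1 + i)) \<le> \<epsilon>"
proof -
  obtain K where K: "\<And>n. n \<ge> K \<Longrightarrow> norm (\<Sum>i. e (i + n)) < \<epsilon>"
    using suminf_exist_split[OF assms(3,1)] by blast
  define k1 where "k1 = max k0 K"
  have "(\<Sum>i<r. e (k1 + i)) \<le> \<epsilon>" for r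
  proof -
    have "(\<Sum>i<r. e (i + k1)) \<le> (\<Sum>i. e (i + k1))"
      using assms by (intro sum_le_suminf) (auto simp: summable_iff_shift)
    also have "\<dots> \<le> \<epsilon>" using K[of k1] by (simp add: k1_def)
    finally show ?thesis by (simp add: add.commute)
  qed
  then show ?thesis by (intro exI[of _ k1]) (auto simp: k1_def)
qed

context lil_setting
begin

lemma V_hat_le_Er:
  assumes "BL k f" "\<And>\<omega>. \<omega> \<in> space M \<Longrightarrow> indicator A \<omega> \<le> f (path \<omega>)"
  shows "V_hat M H E A \<le> ereal (Er f)"
proof -
  have "V_hat M H E A \<le> E (\<lambda>\<omega>. f (path \<omega>))"
    unfolding V_hat_def using BL_path_in_H[OF assms(1)] assms(2)
    by (intro INF_lower) auto
  then show ?thesis using Er_eq[OF assms(1)] by simp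
qed

lemma V_hat_nonneg: "0 \<le> V_hat M H E A"
  unfolding V_hat_def
proof (rule INF_greatest)
  fix \<xi> assume \<xi>: "\<xi> \<in> {\<xi> \<in> H. \<forall>\<omega>\<in>space M. indicator A \<omega> \<le> \<xi> \<omega>}"
  have "E (\<lambda>_. 0) \<le> E \<xi>"
  proof (rule E_mono)
    fix \<omega> assume "\<omega> \<in> space M"
    then have "indicator A \<omega> \<le> \<xi> \<omega>" using \<xi> by blast
    then show "0 \<le> \<xi> \<omega>" by (rule order_trans[OF indicator_pos_le])
  qed (use \<xi> const_in_H in auto)
  then show "0 \<le> E \<xi>" unfolding E_const zero_ereal_def[symmetric] .
qed

lemma V_hat_empty: "V_hat M H E {} \<le> 0"
  using V_hat_le_Er[OF BL_const[of 0 0], of "{}"] by (simp add: zero_ereal_def)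

lemma V_hat_star_nonneg: "0 \<le> V_hat_star M H E A"
  unfolding V_hat_star_def by (intro INF_greatest suminf_0_le V_hat_nonneg)

lemma V_hat_star_empty: "V_hat_star M H E {} = 0"
proof (rule antisym)
  have "V_hat_star M H E {} \<le> (\<Sum>n::nat. V_hat M H E {})"
    unfolding V_hat_star_def by (rule INF_lower2[of "\<lambda>_. {}"]) auto
  also have "\<dots> = 0"
    using V_hat_empty V_hat_nonneg[of "{}"] by (simp add: antisym)
  finally show "V_hat_star M H E {} \<le> 0" .
qed (rule V_hat_star_nonneg)

text \<open>Each horizon meets finitely many blocks, so finite sub-additivity suffices, and the tail
  of the summable bound makes the estimate uniform in the horizon.\<close>

lemma upper_V:
  assumes "choquet_fin" "second_moment_le v" "mean_zero 1" "mean_zero (- 1)" "0 < s" "v < s\<^sup>2" "0 < \<epsilon>"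
  shows "\<exists>n1. \<forall>n\<ge>n1. \<forall>N. V {\<omega> \<in> space M. \<exists>m\<in>{n..N}. s * lil_norm m \<le> \<bar>partial_sum Y m \<omega>\<bar>} \<le> \<epsilon>"
proof -
  obtain n e k0 f where n: "mono n" "filterlim n at_top sequentially"
    and e: "summable e" "\<And>k. 0 \<le> (e k::real)"
    and f: "\<And>k. k \<ge> k0 \<Longrightarrow> BL (n (Suc k)) (f k)" "\<And>k x. k \<ge> k0 \<Longrightarrow> 0 \<le> f k x"
      "\<And>k. k \<ge> k0 \<Longrightarrow> Er (f k) \<le> e k"
      "\<And>k x m. k \<ge> k0 \<Longrightarrow> n k \<le> m \<Longrightarrow> m \<le> n (Suc k) \<Longrightarrow> s * lil_norm m \<le> \<bar>\<Sum>i<m. x i\<bar> \<Longrightarrow> 1 \<le> f k x"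
  proof (rule upper_blocks[OF assms(1-6)], goal_cases)
    case (1 n e k0 f)
    from 1(2-) show ?case by (rule 1(1))
  qed
  obtain k1 where k1: "k1 \<ge> k0" "\<And>r. (\<Sum>i<r. e (k1 + i)) \<le> \<epsilon>"
    using summable_tail_sum_le[OF e assms(7)] by blast
  have "V {\<omega> \<in> space M. \<exists>m\<in>{p..N}. s * lil_norm m \<le> \<bar>partial_sum Y m \<omega>\<bar>} \<le> \<epsilon>" if p: "n k1 \<le> p" for p N
  proof -
    let ?A = "{\<omega> \<in> space M. \<exists>m\<in>{p..N}. s * lil_norm m \<le> \<bar>partial_sum Y m \<omega>\<bar>}"
    have "\<forall>\<^sub>F k in sequentially. N \<le> n k" using n(2) by (simp add: filterlim_at_top)
    then obtain K where K: "\<And>k. k \<ge> K \<Longrightarrow> N \<le> n k" by (auto simp: eventually_sequentially)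
    define r where "r = Suc K"
    have r: "0 < r" "N \<le> n (k1 + r)" using K[of "k1 + r"] by (auto simp: r_def)
    let ?g = "\<lambda>x. \<Sum>i<r. f (k1 + i) x"
    have BLf: "BL (n (k1 + r)) (f (k1 + i))" if "i < r" for i
    proof (rule BL_mono)
      show "BL (n (Suc (k1 + i))) (f (k1 + i))" using k1(1) by (intro f) simp
      show "n (Suc (k1 + i)) \<le> n (k1 + r)" using that by (intro monoD[OF n(1)]) simp
    qed
    have "V ?A \<le> Er ?g"
    proof (rule V_le_Er)
      show "BL (n (k1 + r)) ?g" by (rule BL_sum) (auto intro: BLf)
      fix \<omega> assume \<omega>: "\<omega> \<in> space M"
      have nn: "0 \<le> f (k1 + i) (path \<omega>)" for i using k1(1) by (intro f) simp
      show "indicator ?A \<omega> \<le> ?g (path \<omega>)"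
      proof (cases "\<omega> \<in> ?A")
        case True
        then obtain m where m: "m \<in> {p..N}" "s * lil_norm m \<le> \<bar>partial_sum Y m \<omega>\<bar>" by blast
        have "n k1 \<le> m" "m \<le> n (k1 + r)" using m(1) p r(2) by auto
        then obtain k where k: "k \<in> {k1..<k1 + r}" "n k \<le> m" "m \<le> n (Suc k)"
          using block_cover[OF n(1), of k1 "k1 + r" m] r(1) by auto
        then have "1 \<le> f k (path \<omega>)"
          using k1(1) m(2) by (intro f(4)[of k m]) (auto simp: partial_sum_path)
        also have "\<dots> = f (k1 + (k - k1)) (path \<omega>)" using k(1) by simp
        also have "\<dots> \<le> ?g (path \<omega>)"
          using k(1) by (intro member_le_sum[where f = "\<lambda>i. f (k1 + i) (path \<omega>)"] nn) auto
        finally show ?thesis using True by simp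
      next
        case False
        then show ?thesis using nn by (simp add: sum_nonneg)
      qed
    qed (rule sets_exceed)
    also have "\<dots> \<le> (\<Sum>i<r. Er (f (k1 + i)))"
      by (intro Er_sum_le[where k = "n (k1 + r)"] BLf) auto
    also have "\<dots> \<le> (\<Sum>i<r. e (k1 + i))" using k1(1) by (intro sum_mono f) auto
    also have "\<dots> \<le> \<epsilon>" by (rule k1(2))
    finally show ?thesis .
  qed
  then show ?thesis by blast
qed

text \<open>The real majorants \<open>b\<close> with bounded partial sums let countably many such
  covers be merged without manipulating extended-real double series.\<close>

lemma hat_cover:
  assumes "choquet_fin" "second_moment_le v" "mean_zero 1" "mean_zero (- 1)" "0 < s" "v < s\<^sup>2" "0 < \<epsilon>"
  shows "\<exists>A b. (\<forall>i::nat. A i \<in> sets M \<and> V_hat M H E (A i) \<le> ereal (b i) \<and> 0 \<le> b i) \<and>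
    (\<forall>r. (\<Sum>i<r. b i) \<le> \<epsilon>) \<and>
    (\<forall>\<omega>\<in>space M. (\<exists>\<^sub>F m in sequentially. s * lil_norm m \<le> \<bar>partial_sum Y m \<omega>\<bar>) \<longrightarrow> \<omega> \<in> (\<Union>i. A i))"
proof -
  obtain n e k0 f where n: "mono n" "filterlim n at_top sequentially"
    and e: "summable e" "\<And>k. 0 \<le> (e k::real)"
    and f: "\<And>k. k \<ge> k0 \<Longrightarrow> BL (n (Suc k)) (f k)" "\<And>k x. k \<ge> k0 \<Longrightarrow> 0 \<le> f k x"
      "\<And>k. k \<ge> k0 \<Longrightarrow> Er (f k) \<le> e k"
      "\<And>k x m. k \<ge> k0 \<Longrightarrow> n k \<le> m \<Longrightarrow> m \<le> n (Suc k) \<Longrightarrow> s * lil_norm m \<le> \<bar>\<Sum>i<m. x i\<bar> \<Longrightarrow> 1 \<le> f k x"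
  proof (rule upper_blocks[OF assms(1-6)], goal_cases)
    case (1 n e k0 f)
    from 1(2-) show ?case by (rule 1(1))
  qed
  obtain k1 where k1: "k1 \<ge> k0" "\<And>r. (\<Sum>i<r. e (k1 + i)) \<le> \<epsilon>"
    using summable_tail_sum_le[OF e assms(7)] by blast
  define A where "A i = {\<omega> \<in> space M. \<exists>m\<in>{n (k1 + i)..n (Suc (k1 + i))}. s * lil_norm m \<le> \<bar>partial_sum Y m \<omega>\<bar>}" for i
  have "V_hat M H E (A i) \<le> ereal (e (k1 + i))" for i
  proof -
    have k: "k1 + i \<ge> k0" using k1(1) by simp
    have "V_hat M H E (A i) \<le> ereal (Er (f (k1 + i)))"
    proof (rule V_hat_le_Er[OF f(1)[OF k]])
      fix \<omega> assume "\<omega> \<in> space M"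
      show "indicator (A i) \<omega> \<le> f (k1 + i) (path \<omega>)"
      proof (cases "\<omega> \<in> A i")
        case True
        then obtain m where "n (k1 + i) \<le> m" "m \<le> n (Suc (k1 + i))" "s * lil_norm m \<le> \<bar>partial_sum Y m \<omega>\<bar>"
          by (auto simp: A_def)
        then have "1 \<le> f (k1 + i) (path \<omega>)"
          using f(4)[OF k, of m "path \<omega>"] by (simp add: partial_sum_path)
        then show ?thesis using True by simp
      qed (simp add: f(2)[OF k])
    qed
    also have "\<dots> \<le> ereal (e (k1 + i))" using f(3)[OF k] by simp
    finally show ?thesis .
  qed
  moreover have "A i \<in> sets M" for i unfolding A_def by (rule sets_exceed)
  moreover have "\<omega> \<in> (\<Union>i. A i)"
    if \<omega>: "\<omega> \<in> space M" "\<exists>\<^sub>F m in sequentially. s * lil_norm m \<le> \<bar>partial_sum Y m \<omega>\<bar>" for \<omega>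
  proof -
    obtain m where m: "n k1 \<le> m" "s * lil_norm m \<le> \<bar>partial_sum Y m \<omega>\<bar>"
      using \<omega>(2) unfolding frequently_sequentially by blast
    have "\<forall>\<^sub>F k in sequentially. m \<le> n k" using n(2) by (simp add: filterlim_at_top)
    then obtain K where K: "\<And>k. k \<ge> K \<Longrightarrow> m \<le> n k" by (auto simp: eventually_sequentially)
    then have "m \<le> n (k1 + Suc K)" by simp
    then obtain k where k: "k1 \<le> k" "n k \<le> m" "m \<le> n (Suc k)"
      using block_cover[OF n(1), of k1 "k1 + Suc K" m] m(1) by auto
    then have "\<omega> \<in> A (k - k1)"
      using m(2) \<omega>(1) by (auto simp: A_def)
    then show ?thesis by blast
  qed
  ultimately show ?thesis
    using k1(2) e(2) by (intro exI[of _ A] exI[of _ "\<lambda>i. e (k1 + i)"]) auto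
qed

text \<open>The event is a countable union over levels s_j decreasing to \<sigma>. Level j gets a
  cover of total size \<epsilon> 2^(-j-1), and all covers are enumerated together through
  \<open>prod_decode\<close>.\<close>

lemma V_hat_star_limsup:
  assumes "choquet_fin" "second_moment_le v" "mean_zero 1" "mean_zero (- 1)" "v \<le> \<sigma>\<^sup>2" "0 \<le> \<sigma>"
  shows "V_hat_star M H E
    {\<omega> \<in> space M. limsup (\<lambda>n. ereal (\<bar>partial_sum Y n \<omega>\<bar> / lil_norm n)) > ereal \<sigma>} = 0"
    (is "V_hat_star M H E ?L = 0")
proof (rule antisym)
  define s where "s j = \<sigma> + 1 / (real j + 1)" for j :: nat
  have s: "\<sigma> < s j" "0 < s j" for j using assms(6) by (auto simp: s_def add_nonneg_pos)
  have vs: "v < (s j)\<^sup>2" for j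
    using assms(5,6) power_strict_mono[of \<sigma> "s j" 2] s(1)[of j] by simp
  show "V_hat_star M H E ?L \<le> 0"
  proof (rule ereal_le_epsilon2)
    fix \<epsilon> :: real assume \<epsilon>: "0 < \<epsilon>"
    have "\<forall>j::nat. \<exists>Ab. (\<forall>i::nat. fst Ab i \<in> sets M \<and> V_hat M H E (fst Ab i) \<le> ereal (snd Ab i) \<and> 0 \<le> snd Ab i) \<and>
      (\<forall>r. (\<Sum>i<r. snd Ab i) \<le> \<epsilon> * (1 / 2) ^ Suc j) \<and>
      (\<forall>\<omega>\<in>space M. (\<exists>\<^sub>F m in sequentially. s j * lil_norm m \<le> \<bar>partial_sum Y m \<omega>\<bar>) \<longrightarrow> \<omega> \<in> (\<Union>i. fst Ab i))"
    proof
      fix j :: nat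
      have "0 < \<epsilon> * (1 / 2) ^ Suc j" using \<epsilon> by simp
      from hat_cover[OF assms(1-4) s(2)[of j] vs[of j] this]
      show "\<exists>Ab. (\<forall>i::nat. fst Ab i \<in> sets M \<and> V_hat M H E (fst Ab i) \<le> ereal (snd Ab i) \<and> 0 \<le> snd Ab i) \<and>
        (\<forall>r. (\<Sum>i<r. snd Ab i) \<le> \<epsilon> * (1 / 2) ^ Suc j) \<and>
        (\<forall>\<omega>\<in>space M. (\<exists>\<^sub>F m in sequentially. s j * lil_norm m \<le> \<bar>partial_sum Y m \<omega>\<bar>) \<longrightarrow> \<omega> \<in> (\<Union>i. fst Ab i))"
        by (simp only: split_paired_Ex fst_conv snd_conv)
    qed
    from choice[OF this] obtain Ab where Ab0: "\<forall>j. (\<forall>i::nat. fst (Ab j) i \<in> sets M \<and>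
        V_hat M H E (fst (Ab j) i) \<le> ereal (snd (Ab j) i) \<and> 0 \<le> snd (Ab j) i) \<and>
      (\<forall>r. (\<Sum>i<r. snd (Ab j) i) \<le> \<epsilon> * (1 / 2) ^ Suc j) \<and>
      (\<forall>\<omega>\<in>space M. (\<exists>\<^sub>F m in sequentially. s j * lil_norm m \<le> \<bar>partial_sum Y m \<omega>\<bar>) \<longrightarrow> \<omega> \<in> (\<Union>i. fst (Ab j) i))" ..
    have Ab: "fst (Ab j) i \<in> sets M" "V_hat M H E (fst (Ab j) i) \<le> ereal (snd (Ab j) i)" "0 \<le> snd (Ab j) i" for j i
      using Ab0 by blast+
    have Ab4: "(\<Sum>i<r. snd (Ab j) i) \<le> \<epsilon> * (1 / 2) ^ Suc j" for j r
      using Ab0 by blast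
    have Ab5: "\<omega> \<in> (\<Union>i. fst (Ab j) i)" if "\<omega> \<in> space M" "\<exists>\<^sub>F m in sequentially. s j * lil_norm m \<le> \<bar>partial_sum Y m \<omega>\<bar>" for j \<omega>
      using conjunct2[OF conjunct2[OF spec[OF Ab0, of j]]] that by blast
    define B where "B p = fst (Ab (fst (prod_decode p))) (snd (prod_decode p))" for p
    define b where "b jk = snd (Ab (fst jk)) (snd jk)" for jk :: "nat \<times> nat"
    have "V_hat_star M H E ?L \<le> (\<Sum>p. V_hat M H E (B p))"
      unfolding V_hat_star_def
    proof (rule INF_lower, intro CollectI conjI)
      show "range B \<subseteq> sets M" using Ab(1) by (auto simp: B_def)
      show "?L \<subseteq> (\<Union>p. B p)"
      proof
        fix \<omega> assume "\<omega> \<in> ?L"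
        then have \<omega>: "\<omega> \<in> space M" "ereal \<sigma> < limsup (\<lambda>n. ereal (\<bar>partial_sum Y n \<omega>\<bar> / lil_norm n))" by auto
        obtain t where t: "ereal \<sigma> < ereal t" "ereal t < limsup (\<lambda>n. ereal (\<bar>partial_sum Y n \<omega>\<bar> / lil_norm n))"
          using ereal_dense2[OF \<omega>(2)] by auto
        obtain j where j: "1 / (real j + 1) < t - \<sigma>"
          using reals_Archimedean[of "t - \<sigma>"] t(1) by (auto simp: inverse_eq_divide add.commute)
        then have "s j < t" by (simp add: s_def)
        have "\<exists>\<^sub>F m in sequentially. s j * lil_norm m \<le> \<bar>partial_sum Y m \<omega>\<bar>"
        proof (rule ccontr)
          assume "\<not> ?thesis"
          then have "\<forall>\<^sub>F m in sequentially. \<bar>partial_sum Y m \<omega>\<bar> < s j * lil_norm m"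
            by (simp add: not_frequently not_le)
          then have "\<forall>\<^sub>F m in sequentially. ereal (\<bar>partial_sum Y m \<omega>\<bar> / lil_norm m) \<le> ereal t"
            using eventually_ge_at_top[of 1]
          proof eventually_elim
            case (elim m)
            have "\<bar>partial_sum Y m \<omega>\<bar> / lil_norm m \<le> s j"
              using elim lil_norm_pos[of m] by (simp add: divide_le_eq)
            then show ?case using \<open>s j < t\<close> by simp
          qed
          then have "limsup (\<lambda>n. ereal (\<bar>partial_sum Y n \<omega>\<bar> / lil_norm n)) \<le> ereal t"
            by (rule Limsup_bounded)
          with t(2) show False by simp
        qed
        then obtain i where "\<omega> \<in> fst (Ab j) i" using Ab5[OF \<omega>(1)] by blast
        then have "\<omega> \<in> B (prod_encode (j, i))" by (simp add: B_def)
        then show "\<omega> \<in> (\<Union>p. B p)" by blast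
      qed
    qed
    also have "\<dots> \<le> ereal \<epsilon>"
    proof (rule suminf_bound[rule_format])
      show "0 \<le> V_hat M H E (B p)" for p by (rule V_hat_nonneg)
      fix P :: nat
      have "(\<Sum>p<P. V_hat M H E (B p)) \<le> (\<Sum>p<P. ereal (b (prod_decode p)))"
        unfolding B_def b_def by (intro sum_mono Ab)
      also have "\<dots> = ereal (\<Sum>p<P. b (prod_decode p))" by simp
      also have "(\<Sum>p<P. b (prod_decode p)) = (\<Sum>jk\<in>prod_decode ` {..<P}. b jk)"
        by (subst sum.reindex) (auto intro: inj_on_subset[OF inj_prod_decode])
      also have "\<dots> \<le> (\<Sum>jk\<in>{..<P} \<times> {..<P}. b jk)"
      proof (rule sum_mono2)
        \<comment> \<open>Pair coding dominates both components, so the first P codes lie in a P by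
          P square.\<close>
        show "prod_decode ` {..<P} \<subseteq> {..<P} \<times> {..<P}"
        proof
          fix jk assume "jk \<in> prod_decode ` {..<P}"
          then have "prod_encode jk < P" by auto
          then show "jk \<in> {..<P} \<times> {..<P}"
            using le_prod_encode_1[of "fst jk" "snd jk"] le_prod_encode_2[of "snd jk" "fst jk"]
            by (cases jk) auto
        qed
      qed (auto simp: b_def Ab(3))
      also have "\<dots> = (\<Sum>j<P. \<Sum>i<P. snd (Ab j) i)"
        by (simp add: sum.cartesian_product b_def case_prod_beta)
      also have "\<dots> \<le> (\<Sum>j<P. \<epsilon> * (1 / 2) ^ Suc j)" by (intro sum_mono Ab4)
      also have "\<dots> \<le> \<epsilon>"
      proof -
        have "(\<Sum>j<P. (1 / 2 :: real) ^ Suc j) = 1 - (1 / 2) ^ P"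
          by (induction P) (auto simp: field_simps)
        also have "\<dots> \<le> 1" by simp
        finally show ?thesis unfolding sum_distrib_left[symmetric] using \<epsilon> by (simp add: mult_left_le)
      qed
      finally show "(\<Sum>p<P. V_hat M H E (B p)) \<le> ereal \<epsilon>" by simp
    qed
    finally show "V_hat_star M H E ?L \<le> 0 + ereal \<epsilon>" by simp
  qed
qed (rule V_hat_star_nonneg)

end

section \<open>A moving window and the lower half\<close>

lemma taylor3:
  fixes f :: "real \<Rightarrow> real"
  assumes d: "\<And>x. (f has_real_derivative f1 x) (at x)" "\<And>x. (f1 has_real_derivative f2 x) (at x)"
      "\<And>x. (f2 has_real_derivative f3 x) (at x)"
    and bd: "\<And>u. \<bar>u\<bar> \<le> K \<Longrightarrow> \<bar>f3 u\<bar> \<le> C" and x: "\<bar>x\<bar> + \<bar>z\<bar> \<le> K"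
  shows "\<bar>f (x + z) - (f x + f1 x * z + f2 x * z\<^sup>2 / 2)\<bar> \<le> C * \<bar>z\<bar> ^ 3 / 6"
proof -
  define D where "D m s = (if m = 0 then f else if m = 1 then f1 else if m = 2 then f2 else f3) (x + s)" for m :: nat and s
  have "\<exists>t. \<bar>t\<bar> \<le> \<bar>z\<bar> \<and> f (x + z) = (\<Sum>m<3. D m 0 / fact m * z ^ m) + D 3 t / fact 3 * z ^ 3"
  proof (rule Maclaurin_bi_le)
    show "D 0 = (\<lambda>s. f (x + s))" by (simp add: D_def[abs_def])
    show "\<forall>m t. m < 3 \<and> \<bar>t\<bar> \<le> \<bar>z\<bar> \<longrightarrow> (D m has_real_derivative D (Suc m) t) (at t)"
    proof (intro allI impI)
      fix m :: nat and t :: real assume "m < 3 \<and> \<bar>t\<bar> \<le> \<bar>z\<bar>"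
      then consider "m = 0" | "m = 1" | "m = 2" by linarith
      then show "(D m has_real_derivative D (Suc m) t) (at t)"
      proof cases
        case 1
        have "((\<lambda>s. f (x + s)) has_real_derivative f1 (x + t)) (at t)"
          using d(1)[of "x + t"] by (simp add: DERIV_shift add.commute)
        then show ?thesis by (simp add: 1 D_def[abs_def])
      next
        case 2
        have "((\<lambda>s. f1 (x + s)) has_real_derivative f2 (x + t)) (at t)"
          using d(2)[of "x + t"] by (simp add: DERIV_shift add.commute)
        then show ?thesis by (simp add: 2 D_def[abs_def])
      next
        case 3
        have "((\<lambda>s. f2 (x + s)) has_real_derivative f3 (x + t)) (at t)"
          using d(3)[of "x + t"] by (simp add: DERIV_shift add.commute)
        then show ?thesis by (simp add: 3 D_def[abs_def])
      qed
    qed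
  qed
  then obtain t where t: "\<bar>t\<bar> \<le> \<bar>z\<bar>" "f (x + z) = (\<Sum>m<3. D m 0 / fact m * z ^ m) + D 3 t / fact 3 * z ^ 3"
    by blast
  have "(\<Sum>m<3. D m 0 / fact m * z ^ m) = f x + f1 x * z + f2 x * z\<^sup>2 / 2"
    by (simp add: D_def eval_nat_numeral)
  then have "f (x + z) - (f x + f1 x * z + f2 x * z\<^sup>2 / 2) = f3 (x + t) * z ^ 3 / 6"
    using t(2) by (simp add: D_def fact_numeral)
  also have "\<bar>\<dots>\<bar> = \<bar>f3 (x + t)\<bar> * \<bar>z\<bar> ^ 3 / 6" by (simp add: abs_mult power_abs)
  also have "\<dots> \<le> C * \<bar>z\<bar> ^ 3 / 6"
    using t(1) x by (intro divide_right_mono mult_right_mono bd) auto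
  finally show ?thesis .
qed

text \<open>The window profile: \<open>(L\<^sup>2 - x\<^sup>2)\<^sup>2 - L ^ 4 / 8\<close> tilted by \<open>exp (\<kappa> x)\<close>.  The constant
  makes it negative at \<open>\<plusminus>L\<close> while it is a strict subsolution up to the zeros, which absorbs all
  errors of the one-step estimate.\<close>

definition win :: "real \<Rightarrow> real \<Rightarrow> real \<Rightarrow> real" where
  "win L \<kappa> x = ((L\<^sup>2 - x\<^sup>2)\<^sup>2 - L ^ 4 / 8) * exp (\<kappa> * x)"

definition win1 :: "real \<Rightarrow> real \<Rightarrow> real \<Rightarrow> real" where
  "win1 L \<kappa> x = (- 4 * x * (L\<^sup>2 - x\<^sup>2) + \<kappa> * ((L\<^sup>2 - x\<^sup>2)\<^sup>2 - L ^ 4 / 8)) * exp (\<kappa> * x)"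

definition win2 :: "real \<Rightarrow> real \<Rightarrow> real \<Rightarrow> real" where
  "win2 L \<kappa> x = (12 * x\<^sup>2 - 4 * L\<^sup>2 - 8 * \<kappa> * x * (L\<^sup>2 - x\<^sup>2)
     + \<kappa>\<^sup>2 * ((L\<^sup>2 - x\<^sup>2)\<^sup>2 - L ^ 4 / 8)) * exp (\<kappa> * x)"

definition win3 :: "real \<Rightarrow> real \<Rightarrow> real \<Rightarrow> real" where
  "win3 L \<kappa> x = (24 * x + 3 * \<kappa> * (12 * x\<^sup>2 - 4 * L\<^sup>2) - 12 * \<kappa>\<^sup>2 * x * (L\<^sup>2 - x\<^sup>2)
     + \<kappa> ^ 3 * ((L\<^sup>2 - x\<^sup>2)\<^sup>2 - L ^ 4 / 8)) * exp (\<kappa> * x)"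

lemma win_deriv:
  "(win L \<kappa> has_real_derivative win1 L \<kappa> x) (at x)"
  "(win1 L \<kappa> has_real_derivative win2 L \<kappa> x) (at x)"
  "(win2 L \<kappa> has_real_derivative win3 L \<kappa> x) (at x)"
  unfolding win_def[abs_def] win1_def[abs_def] win2_def[abs_def] win3_def
  by (auto intro!: derivative_eq_intros simp: algebra_simps power2_eq_square power3_eq_cube)

lemma win_bound:
  "\<exists>C>0. \<forall>x. \<bar>x\<bar> \<le> K \<longrightarrow> \<bar>win L \<kappa> x\<bar> \<le> C \<and> \<bar>win1 L \<kappa> x\<bar> \<le> C \<and> \<bar>win2 L \<kappa> x\<bar> \<le> C \<and> \<bar>win3 L \<kappa> x\<bar> \<le> C"
proof -
  have bd: "\<exists>C. \<forall>x\<in>{- K..K}. \<bar>f x\<bar> \<le> C" if "continuous_on {- K..K} f" for f :: "real \<Rightarrow> real"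
  proof -
    have "bounded (f ` {- K..K})"
      by (intro compact_imp_bounded compact_continuous_image that) simp
    then show ?thesis unfolding bounded_iff by auto
  qed
  have "continuous_on {- K..K} (win L \<kappa>)" "continuous_on {- K..K} (win1 L \<kappa>)"
    "continuous_on {- K..K} (win2 L \<kappa>)" "continuous_on {- K..K} (win3 L \<kappa>)"
    unfolding win_def[abs_def] win1_def[abs_def] win2_def[abs_def] win3_def[abs_def]
    by (intro continuous_intros)+
  note cont = this
  obtain C0 where C0: "\<forall>x\<in>{- K..K}. \<bar>win L \<kappa> x\<bar> \<le> C0" using bd[OF cont(1)] ..
  obtain C1 where C1: "\<forall>x\<in>{- K..K}. \<bar>win1 L \<kappa> x\<bar> \<le> C1" using bd[OF cont(2)] ..
  obtain C2 where C2: "\<forall>x\<in>{- K..K}. \<bar>win2 L \<kappa> x\<bar> \<le> C2" using bd[OF cont(3)] ..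
  obtain C3 where C3: "\<forall>x\<in>{- K..K}. \<bar>win3 L \<kappa> x\<bar> \<le> C3" using bd[OF cont(4)] ..
  have "\<bar>win L \<kappa> x\<bar> \<le> max 1 (max (max C0 C1) (max C2 C3)) \<and> \<bar>win1 L \<kappa> x\<bar> \<le> max 1 (max (max C0 C1) (max C2 C3)) \<and>
      \<bar>win2 L \<kappa> x\<bar> \<le> max 1 (max (max C0 C1) (max C2 C3)) \<and> \<bar>win3 L \<kappa> x\<bar> \<le> max 1 (max (max C0 C1) (max C2 C3))"
    if "\<bar>x\<bar> \<le> K" for x
  proof -
    have "x \<in> {- K..K}" using that by auto
    from bspec[OF C0 this] bspec[OF C1 this] bspec[OF C2 this] bspec[OF C3 this] show ?thesis by linarith
  qed
  then show ?thesis by (intro exI[of _ "max 1 (max (max C0 C1) (max C2 C3))"]) auto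
qed

text \<open>With \<kappa> = \<beta> / \<sigma>^2 the tilt cancels the first-order term, and the part
  \<beta>^2 / (2 \<sigma>^2) of \<open>c\<close> the zero-order one. What remains is the untilted
  profile with rate 8 \<sigma>^2 / L^2, a quadratic in u = x^2 / L^2 equal to 8 (u - 5/8)^2 +
  15/8.\<close>

lemma win_subsolution:
  assumes "0 < \<sigma>" "0 < L" and \<kappa>: "\<kappa> = \<beta> / \<sigma>\<^sup>2" and c: "c = \<beta>\<^sup>2 / (2 * \<sigma>\<^sup>2) + 8 * \<sigma>\<^sup>2 / L\<^sup>2"
    and "0 \<le> \<beta>" "\<bar>x\<bar> \<le> 2 * L"
  shows "L\<^sup>2 * \<sigma>\<^sup>2 * exp (- (2 * \<kappa> * L)) \<le> \<sigma>\<^sup>2 / 2 * win2 L \<kappa> x - \<beta> * win1 L \<kappa> x + c * win L \<kappa> x"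
proof -
  have \<beta>: "\<beta> = \<kappa> * \<sigma>\<^sup>2" using assms(1) by (simp add: \<kappa>)
  have c': "c = \<kappa>\<^sup>2 * \<sigma>\<^sup>2 / 2 + 8 * \<sigma>\<^sup>2 / L\<^sup>2"
    unfolding c \<beta> using assms(1) by (simp add: power2_eq_square)
  define u where "u = x\<^sup>2 / L\<^sup>2"
  have xu: "x\<^sup>2 = u * L\<^sup>2" using assms(2) by (simp add: u_def)
  define g where "g = (L\<^sup>2 - x\<^sup>2)\<^sup>2 - L ^ 4 / 8"
  define q where "q = x * (L\<^sup>2 - x\<^sup>2)"
  have w: "win L \<kappa> x = g * exp (\<kappa> * x)" "win1 L \<kappa> x = (- 4 * q + \<kappa> * g) * exp (\<kappa> * x)"
    "win2 L \<kappa> x = (12 * x\<^sup>2 - 4 * L\<^sup>2 - 8 * \<kappa> * q + \<kappa>\<^sup>2 * g) * exp (\<kappa> * x)"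
    by (simp_all add: win_def win1_def win2_def g_def q_def)
  have "\<sigma>\<^sup>2 / 2 * win2 L \<kappa> x - \<beta> * win1 L \<kappa> x + c * win L \<kappa> x
      = (\<sigma>\<^sup>2 / 2 * (12 * x\<^sup>2 - 4 * L\<^sup>2) + 8 * \<sigma>\<^sup>2 / L\<^sup>2 * g) * exp (\<kappa> * x)"
    unfolding w \<beta> c' by (simp add: field_simps power2_eq_square)
  also have "\<sigma>\<^sup>2 / 2 * (12 * x\<^sup>2 - 4 * L\<^sup>2) + 8 * \<sigma>\<^sup>2 / L\<^sup>2 * g = L\<^sup>2 * \<sigma>\<^sup>2 * (6 * u - 2 + 8 * (1 - u)\<^sup>2 - 1)"
    unfolding g_def xu using assms(2) by (simp add: field_simps power2_eq_square power4_eq_xxxx)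
  finally have eq: "\<sigma>\<^sup>2 / 2 * win2 L \<kappa> x - \<beta> * win1 L \<kappa> x + c * win L \<kappa> x
      = L\<^sup>2 * \<sigma>\<^sup>2 * (6 * u - 2 + 8 * (1 - u)\<^sup>2 - 1) * exp (\<kappa> * x)" .
  have "1 \<le> 6 * u - 2 + 8 * (1 - u)\<^sup>2 - 1"
  proof -
    have "6 * u - 2 + 8 * (1 - u)\<^sup>2 - 1 = 8 * (u - 5 / 8)\<^sup>2 + 15 / 8"
      by (simp add: power2_eq_square field_simps)
    then show ?thesis using zero_le_power2[of "u - 5 / 8"] by linarith
  qed
  moreover have "exp (- (2 * \<kappa> * L)) \<le> exp (\<kappa> * x)"
  proof -
    have "0 \<le> \<kappa>" using assms(1,5) by (simp add: \<kappa>)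
    then have "\<kappa> * (- x) \<le> \<kappa> * (2 * L)" using assms(6) by (intro mult_left_mono) auto
    then show ?thesis by (simp add: algebra_simps)
  qed
  ultimately have "L\<^sup>2 * \<sigma>\<^sup>2 * 1 * exp (- (2 * \<kappa> * L)) \<le> L\<^sup>2 * \<sigma>\<^sup>2 * (6 * u - 2 + 8 * (1 - u)\<^sup>2 - 1) * exp (\<kappa> * x)"
    by (intro mult_mono mult_left_mono) auto
  then show ?thesis unfolding eq by simp
qed

text \<open>Freezing the argument at \<plusminus>L, where \<open>win\<close> is negative, makes the
  positive part bounded, Lipschitz and zero outside the window.\<close>

definition wpos :: "real \<Rightarrow> real \<Rightarrow> real \<Rightarrow> real" where
  "wpos L \<kappa> x = max 0 (win L \<kappa> (trunc L x))"

lemma blip_pos_part: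
  assumes "blip d f" shows "blip d (\<lambda>x. max 0 (f x))"
proof -
  have "blip d (\<lambda>x. 1 / 2 * (f x + \<bar>f x\<bar>))"
    by (intro blip_cmult blip_add blip_abs assms)
  moreover have "(\<lambda>x. 1 / 2 * (f x + \<bar>f x\<bar>)) = (\<lambda>x. max 0 (f x))"
    by (auto simp: fun_eq_iff max_def abs_if)
  ultimately show ?thesis by simp
qed

lemma LB_wpos: "LB (wpos L \<kappa>)"
  unfolding wpos_def[abs_def] win_def
  by (intro blip_pos_part blip_mult blip_diff blip_power blip_exp blip_cmult LB_trunc LB_const)

lemma wpos_nonneg: "0 \<le> wpos L \<kappa> x"
  by (simp add: wpos_def)

text \<open>Slightly beyond the edge the profile is still negative, since 0.21^2 < 1/8. This margin
  lets the Taylor expansion of \<open>win\<close> bound \<open>wpos\<close> from below for small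
  jumps across the edge.\<close>

lemma win_outside:
  assumes "0 < L" "L \<le> \<bar>x\<bar>" "\<bar>x\<bar> \<le> 11 / 10 * L" shows "win L \<kappa> x < 0"
proof -
  have "L\<^sup>2 \<le> x\<^sup>2" using power_mono[OF assms(2), of 2] assms(1) by simp
  moreover have "x\<^sup>2 \<le> (11 / 10 * L)\<^sup>2" using power_mono[OF assms(3), of 2] by simp
  moreover have "(11 / 10 * L)\<^sup>2 = 121 / 100 * L\<^sup>2" by (simp add: power2_eq_square)
  ultimately have "0 \<le> x\<^sup>2 - L\<^sup>2" "x\<^sup>2 - L\<^sup>2 \<le> 21 / 100 * L\<^sup>2" by linarith+
  then have "(x\<^sup>2 - L\<^sup>2)\<^sup>2 \<le> (21 / 100 * L\<^sup>2)\<^sup>2" by (intro power_mono)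
  also have "\<dots> = 441 / 10000 * L ^ 4" by (simp add: power2_eq_square power4_eq_xxxx)
  also have "\<dots> < L ^ 4 / 8" using assms(1) by simp
  finally have "(L\<^sup>2 - x\<^sup>2)\<^sup>2 - L ^ 4 / 8 < 0" by (simp add: power2_commute)
  then show ?thesis unfolding win_def by (intro mult_neg_pos) auto
qed

lemma wpos_ge_win:
  assumes "0 < L" "\<bar>x\<bar> \<le> 11 / 10 * L" shows "win L \<kappa> x \<le> wpos L \<kappa> x"
proof (cases "\<bar>x\<bar> \<le> L")
  case True
  then show ?thesis by (simp add: wpos_def trunc_eq)
next
  case False
  then show ?thesis using win_outside[of L x \<kappa>] assms wpos_nonneg[of L \<kappa> x] by simp
qed

lemma wpos_pos:
  assumes "0 < L" "0 < wpos L \<kappa> x" shows "\<bar>x\<bar> < L" "wpos L \<kappa> x = win L \<kappa> x"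
proof -
  show *: "\<bar>x\<bar> < L"
  proof (rule ccontr)
    assume "\<not> ?thesis"
    then have "\<bar>trunc L x\<bar> = L" using assms(1) by (auto simp: trunc_def)
    then have "win L \<kappa> (trunc L x) < 0" using assms(1) by (intro win_outside) auto
    with assms(2) show False by (simp add: wpos_def)
  qed
  then show "wpos L \<kappa> x = win L \<kappa> x"
    using assms(2) by (auto simp: wpos_def trunc_eq max_def split: if_splits)
qed

text \<open>Two cut-offs are used: \<rho> for the linear term, where a large level makes the mean
  small, and the small \<open>a\<close> for the quadratic term. Their discrepancy appears only as a
  multiple of a difference of two truncated squares, and large jumps are absorbed there as
  well.\<close>

lemma wpos_expansion:
  assumes L: "0 < L" and z0: "0 < z0" "20 * z0 \<le> L" and a: "0 < a" "2 * a \<le> z0" and \<rho>: "z0 \<le> \<rho>"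
    and x: "\<bar>x\<bar> \<le> 105 / 100 * L"
    and C: "0 < C" "\<And>u. \<bar>u\<bar> \<le> 2 * L \<Longrightarrow> \<bar>win L \<kappa> u\<bar> \<le> C \<and> \<bar>win1 L \<kappa> u\<bar> \<le> C \<and> \<bar>win2 L \<kappa> u\<bar> \<le> C \<and> \<bar>win3 L \<kappa> u\<bar> \<le> C"
    and C1: "C1 = 2 * C * (1 / z0\<^sup>2 + 1 / z0 + 1 + z0)"
  shows "win L \<kappa> x + win1 L \<kappa> x * trunc \<rho> z + win2 L \<kappa> x / 2 * (trunc a z)\<^sup>2
    - C1 * ((trunc \<rho> z)\<^sup>2 - (trunc a z)\<^sup>2) - C1 * a ^ 3 \<le> wpos L \<kappa> (x + z)"
proof -
  let ?t = "trunc \<rho> z" and ?r = "trunc a z"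
  have Cx: "\<bar>win L \<kappa> x\<bar> \<le> C" "\<bar>win1 L \<kappa> x\<bar> \<le> C" "\<bar>win2 L \<kappa> x\<bar> \<le> C"
    using C(2)[of x] x L by auto
  have a\<rho>: "a \<le> \<rho>" using a \<rho> z0 by linarith
  have "\<bar>?r\<bar> \<le> \<bar>?t\<bar>" using a a\<rho> unfolding trunc_def by (simp add: max_def min_def)
  then have r_le_t: "?r\<^sup>2 \<le> ?t\<^sup>2" by (simp add: abs_le_square_iff)
  define B where "B = ?t\<^sup>2 - ?r\<^sup>2"
  have B0: "0 \<le> B" using r_le_t by (simp add: B_def)
  have C1_ge: "2 * C * (1 / z0\<^sup>2 + 1 / z0 + 1) \<le> C1" "2 * C + 2 * C * z0 \<le> C1"
    unfolding C1 using C(1) z0(1) by (simp_all add: distrib_left)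
  have C1_pos: "0 \<le> C1" using C1_ge(2) C(1) z0(1) by (smt (verit) mult_pos_pos)
  \<comment> \<open>Beyond 2a the \<rho>-truncated jump is at least twice the a-truncated one, so
    the penalty controls its full square.\<close>
  have big: "3 / 4 * ?t\<^sup>2 \<le> B" if "2 * a < \<bar>z\<bar>"
  proof -
    have "2 * a \<le> \<bar>?t\<bar>" "\<bar>?r\<bar> \<le> a"
      using that a \<rho> unfolding trunc_def by (auto simp: max_def min_def)
    then have "2 * \<bar>?r\<bar> \<le> \<bar>?t\<bar>" by linarith
    then have "(2 * \<bar>?r\<bar>)\<^sup>2 \<le> \<bar>?t\<bar>\<^sup>2" by (intro power_mono) auto
    then show ?thesis by (simp add: B_def power_mult_distrib)
  qed
  have "win L \<kappa> x + win1 L \<kappa> x * ?t + win2 L \<kappa> x / 2 * ?r\<^sup>2 - C1 * B - C1 * a ^ 3 \<le> wpos L \<kappa> (x + z)"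
  proof (cases "\<bar>z\<bar> \<le> z0")
    case True
    have t: "?t = z" using True \<rho> by (intro trunc_eq) simp
    have "\<bar>win L \<kappa> (x + z) - (win L \<kappa> x + win1 L \<kappa> x * z + win2 L \<kappa> x * z\<^sup>2 / 2)\<bar> \<le> C * \<bar>z\<bar> ^ 3 / 6"
    proof (rule taylor3[where K = "2 * L", OF win_deriv])
      show "\<bar>win3 L \<kappa> u\<bar> \<le> C" if "\<bar>u\<bar> \<le> 2 * L" for u using C(2)[OF that] by simp
      show "\<bar>x\<bar> + \<bar>z\<bar> \<le> 2 * L" using x True z0 L by linarith
    qed
    moreover have "win L \<kappa> (x + z) \<le> wpos L \<kappa> (x + z)"
      using x True z0 L by (intro wpos_ge_win) linarith+
    moreover have "win2 L \<kappa> x / 2 * ?r\<^sup>2 - C / 2 * B \<le> win2 L \<kappa> x * z\<^sup>2 / 2"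
    proof -
      have "- C * B \<le> win2 L \<kappa> x * B" using Cx(3) B0 by (intro mult_right_mono) auto
      then show ?thesis unfolding B_def t by (simp add: algebra_simps)
    qed
    moreover have "C * \<bar>z\<bar> ^ 3 / 6 \<le> C * z0 * B + C1 * a ^ 3"
    proof (cases "2 * a < \<bar>z\<bar>")
      case big_z: True
      have "\<bar>z\<bar> ^ 3 = \<bar>z\<bar> * z\<^sup>2" by (simp add: power2_eq_square power3_eq_cube)
      also have "\<dots> \<le> z0 * (4 / 3 * B)"
        using True big[OF big_z] unfolding t by (intro mult_mono) auto
      finally have "C * \<bar>z\<bar> ^ 3 \<le> C * (z0 * (4 / 3 * B))" using C(1) by (intro mult_left_mono) auto
      moreover have "0 \<le> C * z0 * B" "0 \<le> C1 * a ^ 3"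
        using C(1) z0(1) B0 C1_pos a(1) by simp_all
      ultimately show ?thesis by simp
    next
      case False
      then have "\<bar>z\<bar> ^ 3 \<le> (2 * a) ^ 3" by (intro power_mono) auto
      then have "C * \<bar>z\<bar> ^ 3 \<le> C * (8 * a ^ 3)"
        using C(1) by (intro mult_left_mono) (auto simp: power_mult_distrib)
      moreover have "2 * C * a ^ 3 \<le> C1 * a ^ 3"
      proof (intro mult_right_mono)
        have "0 \<le> 2 * C * z0" using C(1) z0(1) by simp
        then show "2 * C \<le> C1" using C1_ge(2) by linarith
      qed (use a in simp)
      moreover have "0 \<le> C * z0 * B" "0 \<le> C * a ^ 3" using C(1) z0(1) B0 a(1) by simp_all
      ultimately show ?thesis by linarith
    qed
    moreover have "C / 2 * B + C * z0 * B \<le> C1 * B"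
    proof -
      have "0 \<le> C * z0" using C(1) z0(1) by simp
      then have "C / 2 + C * z0 \<le> C1" using C1_ge(2) C(1) by linarith
      then have "(C / 2 + C * z0) * B \<le> C1 * B" using B0 by (intro mult_right_mono)
      then show ?thesis by (simp add: distrib_right)
    qed
    ultimately show ?thesis unfolding t by linarith
  next
    case False
    \<comment> \<open>For large jumps no smoothness is used: every term of the expansion is bounded
      by a multiple of the truncated square, and the left side becomes nonpositive.\<close>
    have tz: "z0 \<le> \<bar>?t\<bar>" using False \<rho> z0(1) unfolding trunc_def by (auto simp: max_def min_def)
    have Bt: "3 / 4 * ?t\<^sup>2 \<le> B" using False a by (intro big) linarith
    have "win1 L \<kappa> x * ?t \<le> C * \<bar>?t\<bar>"
    proof -
      have "win1 L \<kappa> x * ?t \<le> \<bar>win1 L \<kappa> x\<bar> * \<bar>?t\<bar>" by (metis abs_ge_self abs_mult)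
      also have "\<dots> \<le> C * \<bar>?t\<bar>" using Cx(2) by (intro mult_right_mono) auto
      finally show ?thesis .
    qed
    moreover have "win2 L \<kappa> x / 2 * ?r\<^sup>2 \<le> C / 2 * ?t\<^sup>2"
    proof -
      have "win2 L \<kappa> x * ?r\<^sup>2 \<le> C * ?r\<^sup>2" using Cx(3) by (intro mult_right_mono) auto
      also have "\<dots> \<le> C * ?t\<^sup>2" using C(1) r_le_t by (intro mult_left_mono) auto
      finally show ?thesis by simp
    qed
    moreover have "C * \<bar>?t\<bar> \<le> C * (1 / z0 * ?t\<^sup>2)"
    proof (intro mult_left_mono)
      have "z0 * \<bar>?t\<bar> \<le> \<bar>?t\<bar> * \<bar>?t\<bar>" using tz by (intro mult_right_mono) auto
      then show "\<bar>?t\<bar> \<le> 1 / z0 * ?t\<^sup>2" using z0(1) by (simp add: field_simps power2_eq_square)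
    qed (use C(1) in simp)
    moreover have "C \<le> C * (1 / z0\<^sup>2 * ?t\<^sup>2)"
    proof -
      have "z0\<^sup>2 \<le> \<bar>?t\<bar>\<^sup>2" using tz z0(1) by (intro power_mono) auto
      then have "1 \<le> 1 / z0\<^sup>2 * ?t\<^sup>2" using z0(1) by (simp add: field_simps)
      then have "C * 1 \<le> C * (1 / z0\<^sup>2 * ?t\<^sup>2)" using C(1) by (intro mult_left_mono) auto
      then show ?thesis by simp
    qed
    moreover have "C * (1 / z0\<^sup>2 * ?t\<^sup>2) + C * (1 / z0 * ?t\<^sup>2) + C / 2 * ?t\<^sup>2 \<le> C1 * B"
    proof -
      define K where "K = 2 * C * (1 / z0\<^sup>2 + 1 / z0 + 1)"
      have K: "0 \<le> K" "K \<le> C1" unfolding K_def using C(1) z0(1) C1_ge(1) by simp_all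
      have "C * (1 / z0\<^sup>2 * ?t\<^sup>2) + C * (1 / z0 * ?t\<^sup>2) + C / 2 * ?t\<^sup>2 \<le> K / 2 * ?t\<^sup>2"
        unfolding K_def using C(1) by (simp add: algebra_simps)
      also have "\<dots> \<le> K * (3 / 4 * ?t\<^sup>2)" using K(1) by simp
      also have "\<dots> \<le> C1 * B" using K Bt B0 by (intro mult_mono) auto
      finally show ?thesis .
    qed
    moreover have "win L \<kappa> x \<le> C" using Cx(1) by linarith
    moreover have "0 \<le> C1 * a ^ 3" using C1_pos a(1) by simp
    moreover have "0 \<le> wpos L \<kappa> (x + z)" by (rule wpos_nonneg)
    ultimately show ?thesis by linarith
  qed
  then show ?thesis by (simp add: B_def)
qed

lemma small_step:
  assumes "0 < K" "0 < r"
  shows "\<exists>h0>0. \<forall>h. 0 < h \<longrightarrow> h \<le> h0 \<longrightarrow> K * h \<le> r \<and> K * sqrt h \<le> (r :: real)"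
proof (intro exI[of _ "min (r / K) ((r / K)\<^sup>2)"] conjI allI impI)
  fix h assume h: "0 < h" "h \<le> min (r / K) ((r / K)\<^sup>2)"
  then show "K * h \<le> r" using assms by (simp add: field_simps)
  have "sqrt h \<le> r / K" using h assms by (intro real_le_lsqrt) auto
  then show "K * sqrt h \<le> r" using assms by (simp add: field_simps)
qed (use assms in simp)

lemma trunc_scale:
  assumes "0 < a" shows "trunc (a * W) (a * y) = a * trunc W y"
proof -
  have "a * trunc W y = max (a * - W) (min (a * y) (a * W))"
    using assms by (simp add: trunc_def max_mult_distrib_left min_mult_distrib_left)
  then show ?thesis by (simp add: trunc_def)
qed

context iid_seq
begin

definition second_moment :: "real \<Rightarrow> bool" where
  "second_moment v \<longleftrightarrow> second_moment_le v \<and> (\<forall>\<delta>>0. \<exists>w>0. v - \<delta> \<le> N (\<lambda>x. (trunc w x)\<^sup>2))"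

text \<open>The slack \<open>e0\<close> of the subsolution is spent in eighths: on the cubic
  remainder, the deficit of the second moment at level \<open>w\<close>, the drift of the truncated
  linear term, and the terms of order h^2.\<close>

lemma window_step:
  assumes v: "second_moment (\<sigma>\<^sup>2)" and mz: "mean_zero 1" "mean_zero (- 1)"
    and \<sigma>: "0 < \<sigma>" and \<beta>: "0 \<le> \<beta>" and L: "0 < L"
    and \<kappa>: "\<kappa> = \<beta> / \<sigma>\<^sup>2" and c: "c = \<beta>\<^sup>2 / (2 * \<sigma>\<^sup>2) + 8 * \<sigma>\<^sup>2 / L\<^sup>2"
  shows "\<exists>h0>0. \<forall>h. 0 < h \<longrightarrow> h \<le> h0 \<longrightarrow> c * h \<le> 1 \<and>
    (\<forall>x. (1 - c * h) * wpos L \<kappa> x \<le> N (\<lambda>y. wpos L \<kappa> (x - \<beta> * h + sqrt h * y)))"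
proof -
  have vle: "second_moment_le (\<sigma>\<^sup>2)" using v by (simp add: second_moment_def)
  obtain C where C: "0 < C" "\<And>u. \<bar>u\<bar> \<le> 2 * L \<Longrightarrow> \<bar>win L \<kappa> u\<bar> \<le> C \<and> \<bar>win1 L \<kappa> u\<bar> \<le> C \<and> \<bar>win2 L \<kappa> u\<bar> \<le> C \<and> \<bar>win3 L \<kappa> u\<bar> \<le> C"
    using win_bound[of "2 * L" L \<kappa>] by blast
  define z0 where "z0 = L / 20"
  define C1 where "C1 = 2 * C * (1 / z0\<^sup>2 + 1 / z0 + 1 + z0)"
  define e0 where "e0 = L\<^sup>2 * \<sigma>\<^sup>2 * exp (- (2 * \<kappa> * L))"
  have z0: "0 < z0" "20 * z0 \<le> L" using L by (auto simp: z0_def)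
  have C_le: "C \<le> C1"
  proof -
    have "C * 1 \<le> C * (2 * (1 / z0\<^sup>2 + 1 / z0 + 1 + z0))"
      using C(1) z0(1) by (intro mult_left_mono) (auto intro: add_nonneg_nonneg)
    then show ?thesis by (simp only: C1_def mult_1_right mult.assoc mult.left_commute)
  qed
  then have C1: "0 < C1" using C(1) by linarith
  have e0: "0 < e0" using L \<sigma> by (simp add: e0_def)
  have c0: "0 \<le> c" unfolding c by simp
  \<comment> \<open>The quadratic coefficient will be at most 2 C1 h, so this deficit costs at most
    h e0 / 8.\<close>
  obtain w where w: "0 < w" "\<sigma>\<^sup>2 - e0 / (16 * C1) \<le> N (\<lambda>x. (trunc w x)\<^sup>2)"
    using v e0 C1 unfolding second_moment_def by (meson divide_pos_pos mult_pos_pos zero_less_numeral)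
  define \<rho> where "\<rho> = max z0 (16 * C * \<sigma>\<^sup>2 / e0)"
  have \<rho>: "z0 \<le> \<rho>" "0 < \<rho>" using z0 by (auto simp: \<rho>_def)
  have \<rho>e: "2 * C * \<sigma>\<^sup>2 / \<rho> \<le> e0 / 8"
  proof -
    have "16 * C * \<sigma>\<^sup>2 / e0 \<le> \<rho>" by (simp add: \<rho>_def)
    then have "16 * C * \<sigma>\<^sup>2 \<le> \<rho> * e0" using e0 by (simp add: pos_divide_le_eq)
    then show ?thesis using \<rho>(2) by (simp add: pos_divide_le_eq mult_ac)
  qed
  define C2 where "C2 = C * \<beta>\<^sup>2 + c * \<beta> * C"
  have C2: "0 \<le> C2" using C(1) \<beta> c0 by (simp add: C2_def)
  define K where "K = 1 + \<beta> + 2 * w + C1 * w ^ 3 + C2 + c"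
  define r where "r = min 1 (min z0 (e0 / 8))"
  have parts: "0 \<le> C1 * w ^ 3" using C1 w by simp
  have K: "0 < K" "\<beta> \<le> K" "2 * w \<le> K" "C1 * w ^ 3 \<le> K" "C2 \<le> K" "c \<le> K"
    using parts \<beta> w C2 c0 by (auto simp: K_def)
  have r: "0 < r" "r \<le> 1" "r \<le> z0" "r \<le> e0 / 8" using z0 e0 by (auto simp: r_def)
  obtain h0 where h0: "0 < h0" "\<And>h. 0 < h \<Longrightarrow> h \<le> h0 \<Longrightarrow> K * h \<le> r \<and> K * sqrt h \<le> r"
    using small_step[OF K(1) r(1)] by blast
  have "c * h \<le> 1 \<and> (1 - c * h) * wpos L \<kappa> x \<le> N (\<lambda>y. wpos L \<kappa> (x - \<beta> * h + sqrt h * y))"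
    if h: "0 < h" "h \<le> h0" for h x
  proof
    have le_r: "k * h \<le> r" "k * sqrt h \<le> r" if "k \<le> K" for k
    proof -
      have "k * h \<le> K * h" "k * sqrt h \<le> K * sqrt h" using that h by (simp_all add: mult_right_mono)
      then show "k * h \<le> r" "k * sqrt h \<le> r" using h0(2)[OF h] by linarith+
    qed
    show ch: "c * h \<le> 1" using le_r(1)[OF K(6)] r by linarith
    have bh: "\<beta> * h \<le> z0" "\<beta> * h \<le> 1" using le_r(1)[OF K(2)] r by linarith+
    have bh0: "0 \<le> \<beta> * h" using \<beta> h by simp
    define a where "a = sqrt h * w"
    have a: "0 < a" "2 * a \<le> z0" using h w le_r(2)[OF K(3)] r by (auto simp: a_def mult.commute mult.left_commute)
    have ah: "C1 * a ^ 3 \<le> h * (e0 / 8)"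
    proof -
      have "a ^ 3 = h * (sqrt h * w ^ 3)"
        using h by (simp add: a_def power_mult_distrib power3_eq_cube)
      moreover have "C1 * w ^ 3 * sqrt h \<le> e0 / 8" using le_r(2)[OF K(4)] r by linarith
      ultimately show ?thesis using mult_left_mono[of "C1 * w ^ 3 * sqrt h" "e0 / 8" h] h
        by (simp add: algebra_simps)
    qed
    have LBf: "LB (\<lambda>y. wpos L \<kappa> (u + sqrt h * y))" for u
      by (rule blip_LB_comp[OF LB_wpos, where L = "\<bar>sqrt h\<bar>"]) (auto simp: abs_mult simp flip: right_diff_distrib)
    show "(1 - c * h) * wpos L \<kappa> x \<le> N (\<lambda>y. wpos L \<kappa> (x - \<beta> * h + sqrt h * y))"
    proof (cases "0 < wpos L \<kappa> x")
      case False
      then have "wpos L \<kappa> x = 0" using wpos_nonneg[of L \<kappa> x] by linarith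
      moreover have "0 \<le> N (\<lambda>y. wpos L \<kappa> (x - \<beta> * h + sqrt h * y))"
        by (intro N_bounds LBf wpos_nonneg)
      ultimately show ?thesis by simp
    next
      case True
      note xL = wpos_pos[OF L True]
      define x1 where "x1 = x - \<beta> * h"
      have x1: "\<bar>x1\<bar> \<le> 105 / 100 * L" "\<bar>x1\<bar> \<le> 2 * L" "\<bar>x1\<bar> + \<bar>\<beta> * h\<bar> \<le> 2 * L"
        using xL(1) bh(1) bh0 z0 L unfolding x1_def by linarith+
      define g where "g = win L \<kappa> x1"
      define g1 where "g1 = win1 L \<kappa> x1"
      define g2 where "g2 = win2 L \<kappa> x1"
      have gC: "\<bar>g\<bar> \<le> C" "\<bar>g1\<bar> \<le> C" "\<bar>g2\<bar> \<le> C" using C(2)[OF x1(2)] by (simp_all add: g_def g1_def g2_def)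
      \<comment> \<open>After scaling by sqrt h the cut-off is the constant \<rho>. The drift bound
        2 \<sigma>^2 / W then costs 2 \<sigma>^2 h / \<rho> per step, proportional to h and small
        for large \<rho>.\<close>
      define W where "W = \<rho> / sqrt h"
      have W: "0 < W" "sqrt h * W = \<rho>" using \<rho> h by (auto simp: W_def)
      let ?\<xi> = "trunc W" and ?A = "\<lambda>y. (trunc w y)\<^sup>2"
      \<comment> \<open>Adding C1 makes the coefficient nonnegative even where \<open>g2\<close> is
        negative. The surplus C1 h N(A), close to C1 h \<sigma>^2, compensates the loss of at most
        C1 h \<sigma>^2 from the penalty on the larger truncation.\<close>
      define k where "k = (g2 / 2 + C1) * h"
      have k0: "0 \<le> k" unfolding k_def using gC(3) C_le C(1) h by (intro mult_nonneg_nonneg) auto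
      have step: "(g - C1 * a ^ 3) + (g1 * sqrt h) * ?\<xi> y + k * ?A y + - (C1 * h) * (?\<xi> y)\<^sup>2
          \<le> wpos L \<kappa> (x1 + sqrt h * y)" for y
      proof -
        have t: "trunc \<rho> (sqrt h * y) = sqrt h * ?\<xi> y" "trunc a (sqrt h * y) = sqrt h * trunc w y"
          unfolding W(2)[symmetric] a_def using h by (auto intro!: trunc_scale)
        have t2: "(sqrt h * u)\<^sup>2 = h * u\<^sup>2" for u using h by (simp add: power_mult_distrib)
        have "g + g1 * (sqrt h * ?\<xi> y) + g2 / 2 * (h * (trunc w y)\<^sup>2)
            - C1 * (h * (?\<xi> y)\<^sup>2 - h * (trunc w y)\<^sup>2) - C1 * a ^ 3 \<le> wpos L \<kappa> (x1 + sqrt h * y)"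
          using wpos_expansion[OF L z0 a \<rho>(1) x1(1) C C1_def, of "sqrt h * y"]
          unfolding t t2 g_def g1_def g2_def .
        then show ?thesis by (simp add: k_def algebra_simps)
      qed
      define d where "d = 2 * \<sigma>\<^sup>2 / W"
      have drift: "N ?\<xi> \<le> d" "N (\<lambda>y. - ?\<xi> y) \<le> d"
        using N_trunc_drift[OF vle mz(1) W(1)] N_trunc_drift[OF vle mz(2) W(1)] by (auto simp: d_def)
      have LBs: "LB ?\<xi>" "LB ?A" "LB (\<lambda>y. (?\<xi> y)\<^sup>2)" by (intro blip_power LB_trunc)+
      let ?p = "\<lambda>y. (g - C1 * a ^ 3) + (g1 * sqrt h) * ?\<xi> y + k * ?A y"
      have LBp: "LB ?p" by (intro blip_add blip_cmult LBs LB_const)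
      have "(g - C1 * a ^ 3) + k * N ?A - \<bar>g1 * sqrt h\<bar> * d \<le> N ?p"
        by (intro N_linear_quadratic_ge LBs k0 drift)
      moreover have "N ?p - N (\<lambda>y. - (- (C1 * h) * (?\<xi> y)\<^sup>2)) \<le> N (\<lambda>y. ?p y + - (C1 * h) * (?\<xi> y)\<^sup>2)"
        by (intro N_add_ge LBp blip_cmult LBs)
      moreover have "N (\<lambda>y. ?p y + - (C1 * h) * (?\<xi> y)\<^sup>2) \<le> N (\<lambda>y. wpos L \<kappa> (x1 + sqrt h * y))"
        by (intro N_mono LBf blip_add LBp blip_cmult LBs step)
      moreover have "N (\<lambda>y. - (- (C1 * h) * (?\<xi> y)\<^sup>2)) \<le> C1 * h * \<sigma>\<^sup>2"
      proof -
        have "N (\<lambda>y. (C1 * h) * (?\<xi> y)\<^sup>2) = (C1 * h) * N (\<lambda>y. (?\<xi> y)\<^sup>2)"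
          using C1 h by (intro N_cmult LBs) auto
        also have "\<dots> \<le> (C1 * h) * \<sigma>\<^sup>2"
          using vle W(1) C1 h unfolding second_moment_le_def by (intro mult_left_mono) auto
        finally show ?thesis by simp
      qed
      ultimately have lower: "(g - C1 * a ^ 3) + k * N ?A - \<bar>g1 * sqrt h\<bar> * d - C1 * h * \<sigma>\<^sup>2
          \<le> N (\<lambda>y. wpos L \<kappa> (x1 + sqrt h * y))" by linarith
      have kN: "g2 / 2 * h * \<sigma>\<^sup>2 + C1 * h * \<sigma>\<^sup>2 - h * (e0 / 8) \<le> k * N ?A"
      proof -
        have "k * (\<sigma>\<^sup>2 - e0 / (16 * C1)) \<le> k * N ?A" using k0 w(2) by (intro mult_left_mono)
        moreover have "k * (e0 / (16 * C1)) \<le> (2 * C1 * h) * (e0 / (16 * C1))"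
        proof (rule mult_right_mono)
          show "k \<le> 2 * C1 * h" unfolding k_def using gC(3) C_le C(1) h by (intro mult_right_mono) auto
        qed (use e0 C1 in simp)
        moreover have "(2 * C1 * h) * (e0 / (16 * C1)) = h * (e0 / 8)" using C1 by simp
        moreover have "k * (\<sigma>\<^sup>2 - e0 / (16 * C1)) = g2 / 2 * h * \<sigma>\<^sup>2 + C1 * h * \<sigma>\<^sup>2 - k * (e0 / (16 * C1))"
          by (simp add: k_def algebra_simps)
        ultimately show ?thesis by linarith
      qed
      have gd: "\<bar>g1 * sqrt h\<bar> * d \<le> h * (e0 / 8)"
      proof -
        have "sqrt h * d = 2 * \<sigma>\<^sup>2 * h / \<rho>"
          unfolding d_def W_def using h by (simp add: field_simps)
        moreover have "\<bar>g1 * sqrt h\<bar> * d = \<bar>g1\<bar> * (sqrt h * d)"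
          using h by (simp add: abs_mult)
        ultimately have "\<bar>g1 * sqrt h\<bar> * d = \<bar>g1\<bar> * (2 * \<sigma>\<^sup>2 * h / \<rho>)" by simp
        also have "\<dots> \<le> C * (2 * \<sigma>\<^sup>2 * h / \<rho>)" using gC(2) h \<rho> by (intro mult_right_mono) auto
        also have "\<dots> = h * (2 * C * \<sigma>\<^sup>2 / \<rho>)" by simp
        also have "\<dots> \<le> h * (e0 / 8)" using \<rho>e h by (intro mult_left_mono) auto
        finally show ?thesis .
      qed
      have A1: "g + g2 / 2 * h * \<sigma>\<^sup>2 - 3 * (h * (e0 / 8)) \<le> N (\<lambda>y. wpos L \<kappa> (x1 + sqrt h * y))"
        using lower kN gd ah by linarith
      \<comment> \<open>The expansion so far is at the shifted point x1 = x - \<beta> h; going back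
        to x produces the drift term of the subsolution inequality.\<close>
      have taylor: "win L \<kappa> x \<le> g + g1 * (\<beta> * h) + C * (\<beta> * h)\<^sup>2"
      proof -
        have "\<bar>win L \<kappa> (x1 + \<beta> * h) - (g + g1 * (\<beta> * h) + g2 * (\<beta> * h)\<^sup>2 / 2)\<bar> \<le> C * \<bar>\<beta> * h\<bar> ^ 3 / 6"
          unfolding g_def g1_def g2_def
          by (rule taylor3[where K = "2 * L", OF win_deriv _ x1(3)]) (use C(2) in blast)
        moreover have "C * \<bar>\<beta> * h\<bar> ^ 3 \<le> C * (\<beta> * h)\<^sup>2"
        proof -
          have "\<bar>\<beta> * h\<bar> ^ 3 = \<beta> * h * (\<beta> * h)\<^sup>2" using bh0 by (simp add: power2_eq_square power3_eq_cube)
          also have "\<dots> \<le> 1 * (\<beta> * h)\<^sup>2" using bh(2) by (intro mult_right_mono) auto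
          finally show ?thesis using C(1) by (simp add: mult_left_mono)
        qed
        moreover have "g2 * (\<beta> * h)\<^sup>2 \<le> C * (\<beta> * h)\<^sup>2" using gC(3) by (intro mult_right_mono) auto
        moreover have "0 \<le> C * (\<beta> * h)\<^sup>2" using C(1) by simp
        moreover have "v1 \<le> p + d" if "\<bar>v1 - (p + r1 / 2)\<bar> \<le> q / 6" "q \<le> d" "r1 \<le> d" "0 \<le> d"
          for v1 p r1 q d :: real
          using that by linarith
        ultimately have "win L \<kappa> (x1 + \<beta> * h) \<le> g + g1 * (\<beta> * h) + C * (\<beta> * h)\<^sup>2" by blast
        then show ?thesis by (simp add: x1_def)
      qed
      have "(1 - c * h) * wpos L \<kappa> x \<le> (1 - c * h) * (g + g1 * (\<beta> * h) + C * (\<beta> * h)\<^sup>2)"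
        unfolding xL(2) using ch by (intro mult_left_mono taylor) auto
      also have "\<dots> = g + \<beta> * g1 * h - c * g * h + (C * (\<beta> * h)\<^sup>2 - c * h * (g1 * (\<beta> * h)) - c * h * (C * (\<beta> * h)\<^sup>2))"
        by (simp add: algebra_simps)
      also have "\<dots> \<le> g + \<beta> * g1 * h - c * g * h + C2 * h * h"
      proof -
        have "- g1 * (c * h * (\<beta> * h)) \<le> C * (c * h * (\<beta> * h))"
          using gC(2) c0 h \<beta> by (intro mult_right_mono) auto
        moreover have "0 \<le> c * h * (C * (\<beta> * h)\<^sup>2)" using c0 h C(1) by simp
        ultimately show ?thesis by (simp add: C2_def algebra_simps power2_eq_square)
      qed
      also have "\<dots> \<le> g + \<beta> * g1 * h - c * g * h + e0 / 8 * h"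
      proof -
        have "C2 * h \<le> e0 / 8" using le_r(1)[OF K(5)] r by linarith
        then have "C2 * h * h \<le> e0 / 8 * h" using h by (intro mult_right_mono) auto
        then show ?thesis by simp
      qed
      also have "\<dots> \<le> g + g2 / 2 * h * \<sigma>\<^sup>2 - 3 * (h * (e0 / 8))"
      proof -
        have "e0 \<le> \<sigma>\<^sup>2 / 2 * g2 - \<beta> * g1 + c * g"
          unfolding e0_def g_def g1_def g2_def by (rule win_subsolution[OF \<sigma> L \<kappa> c \<beta> x1(2)])
        then have "e0 * h \<le> (\<sigma>\<^sup>2 / 2 * g2 - \<beta> * g1 + c * g) * h" using h by (intro mult_right_mono) auto
        moreover have "0 \<le> e0 * h" using e0 h by simp
        ultimately show ?thesis by (simp add: algebra_simps)
      qed
      also have "\<dots> \<le> N (\<lambda>y. wpos L \<kappa> (x1 + sqrt h * y))" by (rule A1)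
      finally show ?thesis by (simp add: x1_def)
    qed
  qed
  then show ?thesis using h0(1) by blast
qed

text \<open>In the rescaled walk the window moves with speed \<beta>; the weight of paths ending in
  it decays no faster than rate \<open>c\<close>.\<close>

lemma window_iterate:
  assumes step: "\<And>x. (1 - c * h) * wpos L \<kappa> x \<le> N (\<lambda>y. wpos L \<kappa> (x - \<beta> * h + sqrt h * y))"
    and "c * h \<le> 1"
  shows "(1 - c * h) ^ n * wpos L \<kappa> 0 \<le> Er (\<lambda>x. wpos L \<kappa> (sqrt h * (\<Sum>i<n. x i) + - (\<beta> * h * real n)))"
proof (induction n)
  case (Suc n)
  let ?f = "\<lambda>n x. wpos L \<kappa> (sqrt h * (\<Sum>i<n. x i) + - (\<beta> * h * real n))"
  have BLf: "BL n (?f n)" for n by (intro BL_linear LB_wpos order_refl)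
  have "(1 - c * h) ^ Suc n * wpos L \<kappa> 0 = (1 - c * h) * ((1 - c * h) ^ n * wpos L \<kappa> 0)" by simp
  also have "\<dots> \<le> (1 - c * h) * Er (?f n)" using Suc assms(2) by (intro mult_left_mono) auto
  also have "\<dots> = Er (\<lambda>x. (1 - c * h) * ?f n x)" using assms(2) by (intro Er_cmult[OF BLf, symmetric]) auto
  also have "\<dots> \<le> Er (?f (Suc n))"
  proof (rule Er_ge_step[OF BLf blip_cmult[OF BLf]])
    fix x :: "nat \<Rightarrow> real"
    have "sqrt h * (\<Sum>i<Suc n. (x(n := y)) i) + - (\<beta> * h * real (Suc n))
        = sqrt h * (\<Sum>i<n. x i) + - (\<beta> * h * real n) - \<beta> * h + sqrt h * y" for y
    proof -
      have "(\<Sum>i<n. (x(n := y)) i) = (\<Sum>i<n. x i)" by (intro sum.cong) auto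
      then show ?thesis by (simp add: algebra_simps)
    qed
    then show "(1 - c * h) * ?f n x \<le> N (\<lambda>y. ?f (Suc n) (x(n := y)))"
      using step[of "sqrt h * (\<Sum>i<n. x i) + - (\<beta> * h * real n)"] by simp
  qed
  finally show ?case .
qed simp

end

lemma not_summable_shifted_harmonic:
  fixes p :: "nat \<Rightarrow> real"
  assumes "0 < q" "\<And>k. q / real (k + m) \<le> p k" "\<And>k. 0 \<le> p k" "1 \<le> m"
  shows "\<exists>r. T < (\<Sum>k<r. p k)"
proof (rule ccontr)
  assume "\<not> ?thesis"
  then have "(\<Sum>k<r. p k) \<le> T" for r by (simp add: not_less)
  then have "summable p" by (intro summableI_nonneg_bounded assms(3))
  then have "summable (\<lambda>k. q / real (k + m))"
    by (rule summable_comparison_test'[where N = 0]) (use assms(1,2) in auto)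
  then have "summable (\<lambda>k. inverse q * (q / real (k + m)))"
    by (rule summable_mult)
  then have "summable (\<lambda>k. 1 / real (k + m))"
    using assms(1) by simp
  then have "summable (\<lambda>k. 1 / real k)"
    by (subst (asm) summable_iff_shift[of "\<lambda>k. 1 / real k" m])
  then show False
    using not_summable_harmonic[where 'a = real] by (simp add: inverse_eq_divide)
qed

text \<open>The room between c and 1 absorbs the second-order error of the exponential, so the block
  weight compares with exp(-h) exactly.\<close>

lemma one_minus_ge_exp:
  fixes h c :: real
  assumes "0 \<le> h" "0 \<le> c" "c \<le> 1" "c * h \<le> 1 - c" shows "exp (- h) \<le> 1 - c * h"
proof -
  have "0 \<le> h * (1 - c - c * h)" using assms by (intro mult_nonneg_nonneg) auto
  then have "1 \<le> (1 - c * h) * (1 + h)" by (simp add: algebra_simps)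
  also have "\<dots> \<le> (1 - c * h) * exp h"
    using exp_ge_add_one_self[of h] assms by (intro mult_left_mono) auto
  finally have "exp (- h) * 1 \<le> exp (- h) * ((1 - c * h) * exp h)" by (intro mult_left_mono) auto
  then show ?thesis by (simp add: exp_minus field_simps)
qed

context lil_setting
begin

lemma sets_exceed_above [measurable]:
  "{\<omega> \<in> space M. \<exists>m\<in>{a..b}. c m \<le> partial_sum Y m \<omega>} \<in> sets M"
  unfolding partial_sum_path by measurable

text \<open>In block k the window reaches about s' \<open>lil_norm (t (Suc k))\<close> with weight
  at least a constant over k. Diverging weights make some block succeed, and the past before that
  block is controlled by the upper half at level 2 \<sigma>.\<close>

lemma lower_V:
  assumes fin: choquet_fin and v: "second_moment (\<sigma>\<^sup>2)" and mz: "mean_zero 1" "mean_zero (- 1)"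
    and s: "0 < s" "s < \<sigma>" and \<epsilon>: "0 < \<epsilon>"
  shows "\<exists>n1. \<forall>n\<ge>n1. \<exists>K\<ge>n. 1 - \<epsilon> \<le> V {\<omega> \<in> space M. \<exists>m\<in>{n..K}. s * lil_norm m \<le> partial_sum Y m \<omega>}"
proof -
  have \<sigma>: "0 < \<sigma>" using s by linarith
  have vle: "second_moment_le (\<sigma>\<^sup>2)" using v by (simp add: second_moment_def)
  obtain s' where s': "s < s'" "s' < \<sigma>" using dense[OF s(2)] by blast
  \<comment> \<open>The gap from s' to s2 pays for the past and the missing first part of the block;
    the gap from s2 to s pays for the width of the window.\<close>
  define s2 where "s2 = (s + s') / 2"
  have s2: "s < s2" "s2 < s'" using s' by (auto simp: s2_def)
  define \<beta> where "\<beta> = sqrt 2 * s'"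
  have \<beta>: "0 \<le> \<beta>" "\<beta>\<^sup>2 = 2 * s'\<^sup>2" using s s' by (auto simp: \<beta>_def power_mult_distrib)
  define u where "u = s'\<^sup>2 / \<sigma>\<^sup>2"
  have "s'\<^sup>2 < \<sigma>\<^sup>2" using s s' by (intro power_strict_mono) auto
  then have u: "0 \<le> u" "u < 1" using \<sigma> by (auto simp: u_def)
  \<comment> \<open>Wide enough that 8 \<sigma>^2 / L^2 = (1 - u) / 2, which puts the rate c halfway
    between u and 1.\<close>
  define L where "L = sqrt (16 * \<sigma>\<^sup>2 / (1 - u))"
  have L: "0 < L" "L\<^sup>2 = 16 * \<sigma>\<^sup>2 / (1 - u)" using \<sigma> u by (auto simp: L_def)
  define c where "c = (1 + u) / 2"
  have c: "0 < c" "c < 1" using u by (auto simp: c_def)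
  have c_eq: "c = \<beta>\<^sup>2 / (2 * \<sigma>\<^sup>2) + 8 * \<sigma>\<^sup>2 / L\<^sup>2"
  proof -
    have "\<beta>\<^sup>2 / (2 * \<sigma>\<^sup>2) = u" unfolding \<beta>(2) u_def by simp
    moreover have "8 * \<sigma>\<^sup>2 / L\<^sup>2 = (1 - u) / 2" unfolding L(2) using \<sigma> by simp
    ultimately show ?thesis by (simp add: c_def field_simps)
  qed
  define \<kappa> where "\<kappa> = \<beta> / \<sigma>\<^sup>2"
  obtain h0 where h0: "0 < h0" "\<And>h. 0 < h \<Longrightarrow> h \<le> h0 \<Longrightarrow> c * h \<le> 1 \<and>
      (\<forall>x. (1 - c * h) * wpos L \<kappa> x \<le> N (\<lambda>y. wpos L \<kappa> (x - \<beta> * h + sqrt h * y)))"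
    using window_step[OF v mz \<sigma> \<beta>(1) L(1) \<kappa>_def c_eq] by blast
  obtain B where B: "0 < B" "\<And>x. \<bar>wpos L \<kappa> x\<bar> \<le> B"
    using blipE[OF LB_wpos] by metis
  have w0: "0 < wpos L \<kappa> 0"
  proof -
    have "wpos L \<kappa> 0 = L ^ 4 * (7 / 8)"
      using L(1) by (simp add: wpos_def trunc_eq win_def power_mult[symmetric] flip: power_mult)
    moreover have "0 < L ^ 4" using L(1) by simp
    ultimately show ?thesis by linarith
  qed
  define q where "q = wpos L \<kappa> 0 / B"
  have q: "0 < q" using w0 B(1) by (simp add: q_def)
  obtain \<Lambda> :: nat where \<Lambda>: "2 \<le> \<Lambda>" "s2 \<le> s' * (1 - 1 / real \<Lambda>) - 2 * \<sigma> * sqrt (1 / real \<Lambda>)"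
  proof -
    have "(\<lambda>n. s' * (1 - 1 / real n) - 2 * \<sigma> * sqrt (1 / real n)) \<longlonglongrightarrow> s' * (1 - 0) - 2 * \<sigma> * sqrt 0"
      by (intro tendsto_intros lim_1_over_n)
    then have "\<forall>\<^sub>F n in sequentially. s2 < s' * (1 - 1 / real n) - 2 * \<sigma> * sqrt (1 / real n)"
      using s2(2) by (intro order_tendstoD(1)) auto
    then have "\<forall>\<^sub>F n in sequentially. 2 \<le> n \<and> s2 < s' * (1 - 1 / real n) - 2 * \<sigma> * sqrt (1 / real n)"
      using eventually_ge_at_top[of 2] by eventually_elim simp
    then show ?thesis using that by (auto simp: eventually_sequentially intro: less_imp_le)
  qed
  \<comment> \<open>Meets both smallness conditions: one for the window step, one for comparing 1 -
    c h with exp(-h).\<close>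
  define h1 where "h1 = min h0 (1 - c)"
  have h1: "0 < h1" using h0 c by (simp add: h1_def)
  obtain x0 where x0: "x0 \<ge> 1" "\<And>x. x \<ge> x0 \<Longrightarrow> 1 / h1 * ll x \<le> x"
    using ll_le_eps[of "1 / h1"] h1 by auto
  obtain x1 where x1: "\<And>x. x \<ge> x1 \<Longrightarrow> L / (sqrt 2 * (s2 - s)) \<le> ll x"
    using filterlim_ll by (auto simp: filterlim_at_top eventually_at_top_linorder)
  have "\<sigma>\<^sup>2 < (2 * \<sigma>)\<^sup>2" "0 < 2 * \<sigma>" "0 < \<epsilon> / 2" using \<sigma> \<epsilon> by (auto simp: power_mult_distrib)
  then obtain n0 where n0: "\<And>n K. n \<ge> n0 \<Longrightarrow> V {\<omega> \<in> space M. \<exists>m\<in>{n..K}. 2 * \<sigma> * lil_norm m \<le> \<bar>partial_sum Y m \<omega>\<bar>} \<le> \<epsilon> / 2"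
    using upper_V[OF fin vle mz, of "2 * \<sigma>" "\<epsilon> / 2"] by blast
  have "\<exists>K\<ge>n. 1 - \<epsilon> \<le> V {\<omega> \<in> space M. \<exists>m\<in>{n..K}. s * lil_norm m \<le> partial_sum Y m \<omega>}"
    if n: "n \<ge> max n0 (max (nat \<lceil>x0\<rceil>) (nat \<lceil>x1\<rceil>))" for n
  proof -
    have nx: "n0 \<le> n" "x0 \<le> real n" "x1 \<le> real n" using n by linarith+
    define t where "t k = \<Lambda> ^ (n + k)" for k :: nat
    define b where "b k = t (Suc k) - t k" for k
    have t_Suc: "t (Suc k) = \<Lambda> * t k" for k by (simp add: t_def)
    have tt: "t k \<le> t (Suc k)" for k unfolding t_Suc using \<Lambda>(1) by simp
    have n_less: "n \<le> t k" for k
    proof -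
      have "n < 2 ^ n" by (rule less_exp)
      also have "\<dots> \<le> 2 ^ (n + k)" by (intro power_increasing) auto
      also have "\<dots> \<le> \<Lambda> ^ (n + k)" using \<Lambda>(1) by (intro power_mono) auto
      finally show ?thesis by (simp add: t_def)
    qed
    have mono_t: "t i \<le> t j" if "i \<le> j" for i j
      using that \<Lambda>(1) unfolding t_def by (intro power_increasing) auto
    \<comment> \<open>The time scale for which moving at speed \<beta> = sqrt 2 s' through the whole
      time \<open>t (Suc k)\<close> means reaching s' times the norm there, at cost at most
      exp(-ll).\<close>
    define H where "H k = ll (real (t (Suc k))) / real (t (Suc k))" for k
    have tpos: "1 \<le> real (t k)" for k using n_less[of k] nx(2) x0(1) by linarith
    have H: "0 < H k" "H k \<le> h0" "H k \<le> 1 - c" for k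
    proof -
      have "x0 \<le> real (t (Suc k))" using n_less[of "Suc k"] nx(2) by linarith
      then have "1 / h1 * ll (real (t (Suc k))) \<le> real (t (Suc k))" by (rule x0(2))
      then have "H k \<le> h1" unfolding H_def using h1 tpos[of "Suc k"] by (simp add: field_simps)
      then show "H k \<le> h0" "H k \<le> 1 - c" by (simp_all add: h1_def)
      show "0 < H k" unfolding H_def using ll_pos tpos[of "Suc k"] by simp
    qed
    have bt: "real (b k) = real (t (Suc k)) * (1 - 1 / real \<Lambda>)" for k
    proof -
      have "real (b k) = real (t (Suc k)) - real (t k)" unfolding b_def using tt[of k] by (simp add: of_nat_diff)
      moreover have "real \<Lambda> * real (t k) * (1 - 1 / real \<Lambda>) = real \<Lambda> * real (t k) - real (t k)"
        using \<Lambda>(1) by (simp add: field_simps)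
      ultimately show ?thesis by (simp add: t_Suc)
    qed
    have Hb: "H k * real (b k) = ll (real (t (Suc k))) * (1 - 1 / real \<Lambda>)" for k
      unfolding bt H_def using tpos[of "Suc k"] by simp
    define \<phi> where "\<phi> k x = 1 / B * wpos L \<kappa> (sqrt (H k) * (\<Sum>i<b k. x i) + - (\<beta> * H k * real (b k)))" for k and x :: "nat \<Rightarrow> real"
    have BLw: "BL (b k) (\<lambda>x. wpos L \<kappa> (sqrt (H k) * (\<Sum>i<b k. x i) + - (\<beta> * H k * real (b k))))" for k
      by (intro BL_linear LB_wpos order_refl)
    have BL\<phi>: "BL (b k) (\<phi> k)" for k unfolding \<phi>_def[abs_def] by (intro blip_cmult BLw)
    have \<phi>01: "0 \<le> \<phi> k x" "\<phi> k x \<le> 1" for k x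
      unfolding \<phi>_def using B wpos_nonneg[of L \<kappa>] by (auto simp: divide_le_eq abs_le_iff)
    have p_ge: "q * exp (- ll (real (t (Suc k)))) \<le> Er (\<phi> k)" for k
    proof -
      have "exp (- ll (real (t (Suc k)))) \<le> exp (- (H k * real (b k)))"
        unfolding Hb using ll_pos[of "real (t (Suc k))"] \<Lambda>(1) by (simp add: mult_left_le)
      also have "\<dots> = exp (- H k) ^ b k" by (simp add: mult.commute flip: exp_of_nat_mult)
      also have "\<dots> \<le> (1 - c * H k) ^ b k"
      proof (intro power_mono one_minus_ge_exp)
        have "c * H k \<le> 1 * H k" using c H(1)[of k] by (intro mult_right_mono) auto
        then show "c * H k \<le> 1 - c" using H(3)[of k] by linarith
      qed (use c H(1)[of k] in auto)
      finally have "q * exp (- ll (real (t (Suc k)))) \<le> q * (1 - c * H k) ^ b k"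
        using q by (intro mult_left_mono) auto
      also have "\<dots> = 1 / B * ((1 - c * H k) ^ b k * wpos L \<kappa> 0)" by (simp add: q_def)
      also have "\<dots> \<le> 1 / B * Er (\<lambda>x. wpos L \<kappa> (sqrt (H k) * (\<Sum>i<b k. x i) + - (\<beta> * H k * real (b k))))"
        using h0(2)[OF H(1,2)] B(1) by (intro mult_left_mono window_iterate) auto
      also have "\<dots> = Er (\<phi> k)"
        unfolding \<phi>_def[abs_def] using B(1) by (intro Er_cmult[OF BLw, symmetric]) auto
      finally show ?thesis .
    qed
    have p_harm: "(q / (4 + ln (real \<Lambda>))) / real (k + (n + 2)) \<le> Er (\<phi> k)" for k
    proof -
      have l0: "0 \<le> ln (real \<Lambda>)" using \<Lambda>(1) by simp
      have "lg (real (t (Suc k)) * 1) \<le> ln (real (t (Suc k))) + lg 1"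
        by (rule lg_mult_le[OF tpos])
      also have "lg 1 = 1" by (simp add: lg_def max_def)
      also have "ln (real (t (Suc k))) = real (n + Suc k) * ln (real \<Lambda>)"
        using \<Lambda>(1) by (simp add: t_def ln_realpow flip: power_Suc)
      finally have lg_le: "lg (real (t (Suc k))) \<le> real (n + Suc k) * ln (real \<Lambda>) + 1" by simp
      have "exp (ll (real (t (Suc k)))) \<le> 4 + real (n + Suc k) * ln (real \<Lambda>)"
        unfolding exp_ll
      proof (rule max.boundedI)
        have "0 \<le> real (n + Suc k) * ln (real \<Lambda>)" using l0 by simp
        then show "exp 1 \<le> 4 + real (n + Suc k) * ln (real \<Lambda>)" using exp_le by linarith
        show "lg (real (t (Suc k))) \<le> 4 + real (n + Suc k) * ln (real \<Lambda>)" using lg_le by linarith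
      qed
      also have "\<dots> \<le> 4 * real (k + (n + 2)) + real (k + (n + 2)) * ln (real \<Lambda>)"
        using l0 by (intro add_mono mult_right_mono) auto
      finally have "exp (ll (real (t (Suc k)))) \<le> (4 + ln (real \<Lambda>)) * real (k + (n + 2))"
        by (simp add: algebra_simps)
      then have "q / ((4 + ln (real \<Lambda>)) * real (k + (n + 2))) \<le> q / exp (ll (real (t (Suc k))))"
        using q l0 by (intro divide_left_mono mult_pos_pos) auto
      also have "\<dots> = q * exp (- ll (real (t (Suc k))))" by (simp add: exp_minus divide_inverse)
      also have "\<dots> \<le> Er (\<phi> k)" by (rule p_ge)
      finally show ?thesis by (simp add: divide_divide_eq_left)
    qed
    \<comment> \<open>Enough blocks for the product of failures to drop to \<epsilon>/2; the other
      \<epsilon>/2 is the exceptional event of the upper half.\<close>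
    obtain r where r: "ln (2 / \<epsilon>) < (\<Sum>k<r. Er (\<phi> k))"
    proof -
      have "0 < q / (4 + ln (real \<Lambda>))" using q \<Lambda>(1) by (intro divide_pos_pos add_pos_nonneg) auto
      from not_summable_shifted_harmonic[OF this p_harm] show ?thesis
        using that Er_bounds(1)[OF BL\<phi> \<phi>01(1)] by auto
    qed
    let ?P = "\<lambda>x. \<Prod>k<r. 1 - \<phi> k (\<lambda>i. x (t k + i))"
    define K where "K = t r"
    let ?A = "{\<omega> \<in> space M. \<exists>m\<in>{n..K}. s * lil_norm m \<le> partial_sum Y m \<omega>}"
    let ?U = "{\<omega> \<in> space M. \<exists>m\<in>{n..K}. 2 * \<sigma> * lil_norm m \<le> \<bar>partial_sum Y m \<omega>\<bar>}"
    have t_b: "t (Suc k) = t k + b k" for k using tt[of k] by (simp add: b_def)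
    have block: "s * lil_norm (t (Suc k)) \<le> partial_sum Y (t (Suc k)) \<omega>"
      if pos: "0 < \<phi> k (\<lambda>i. path \<omega> (t k + i))" and nU: "\<bar>partial_sum Y (t k) \<omega>\<bar> \<le> 2 * \<sigma> * lil_norm (t k)" for k \<omega>
    proof -
      define a where "a = lil_norm (t (Suc k))"
      define l where "l = ll (real (t (Suc k)))"
      define S where "S = (\<Sum>i<b k. path \<omega> (t k + i))"
      have apos: "0 < a" unfolding a_def using tpos[of "Suc k"] by (intro lil_norm_pos) simp
      have lpos: "0 < l" unfolding l_def by (rule ll_pos)
      have aH: "sqrt (H k) * a = sqrt 2 * l"
      proof -
        have "H k * (2 * real (t (Suc k)) * l) = 2 * l\<^sup>2"
          unfolding H_def l_def[symmetric] using tpos[of "Suc k"] by (simp add: power2_eq_square)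
        then have "sqrt (H k * (2 * real (t (Suc k)) * l)) = sqrt (2 * l\<^sup>2)"
          by (simp only:)
        also have "\<dots> = sqrt 2 * l" using lpos by (simp add: real_sqrt_mult)
        finally have "sqrt (H k * (2 * real (t (Suc k)) * l)) = sqrt 2 * l" .
        then show ?thesis unfolding a_def lil_norm_ll l_def real_sqrt_mult by simp
      qed
      have "0 < wpos L \<kappa> (sqrt (H k) * S + - (\<beta> * H k * real (b k)))"
        using pos B(1) unfolding \<phi>_def S_def by (simp add: zero_less_divide_iff)
      then have "\<bar>sqrt (H k) * S + - (\<beta> * H k * real (b k))\<bar> < L" by (rule wpos_pos(1)[OF L(1)])
      then have "\<beta> * (H k * real (b k)) - L \<le> sqrt (H k) * S" by (simp add: abs_less_iff mult.assoc)
      moreover have "\<beta> * (H k * real (b k)) - L = sqrt (H k) * a * (s' * (1 - 1 / real \<Lambda>) - L / (sqrt 2 * l))"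
        unfolding aH Hb l_def[symmetric] \<beta>_def using lpos by (simp add: field_simps)
      ultimately have "sqrt (H k) * (a * (s' * (1 - 1 / real \<Lambda>) - L / (sqrt 2 * l))) \<le> sqrt (H k) * S"
        by (simp add: mult.assoc)
      then have S_ge: "a * (s' * (1 - 1 / real \<Lambda>) - L / (sqrt 2 * l)) \<le> S"
        using H(1)[of k] by (simp add: mult_le_cancel_left_pos)
      have at: "lil_norm (t k) \<le> sqrt (1 / real \<Lambda>) * a"
      proof -
        have "real (t k) = 1 / real \<Lambda> * real (t (Suc k))" using \<Lambda>(1) by (simp add: t_Suc)
        then have "2 * real (t k) * ll (real (t k)) \<le> 1 / real \<Lambda> * (2 * real (t (Suc k)) * l)"
          using ll_mono[of "real (t k)" "real (t (Suc k))"] tt[of k]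
          by (simp add: l_def mult_left_mono divide_right_mono)
        then show ?thesis
          unfolding lil_norm_ll a_def real_sqrt_mult[symmetric] l_def by (intro real_sqrt_le_mono)
      qed
      have "L / (sqrt 2 * l) \<le> s2 - s"
      proof -
        have "x1 \<le> real (t (Suc k))" using n_less[of "Suc k"] nx(3) by linarith
        then have "L / (sqrt 2 * (s2 - s)) \<le> l" unfolding l_def by (rule x1)
        then show ?thesis using s2(1) lpos by (simp add: field_simps)
      qed
      then have "a * s \<le> a * ((s' * (1 - 1 / real \<Lambda>) - L / (sqrt 2 * l)) - 2 * \<sigma> * sqrt (1 / real \<Lambda>))"
        using \<Lambda>(2) apos by (intro mult_left_mono) auto
      moreover have "2 * \<sigma> * lil_norm (t k) \<le> 2 * \<sigma> * (sqrt (1 / real \<Lambda>) * a)"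
        using at \<sigma> by (intro mult_left_mono) auto
      moreover have "partial_sum Y (t (Suc k)) \<omega> = partial_sum Y (t k) \<omega> + S"
        unfolding partial_sum_path t_b S_def by (rule sum_shift)
      ultimately show ?thesis using S_ge nU unfolding a_def[symmetric] by (simp add: algebra_simps abs_le_iff)
    qed
    have BLP: "BL (t r) (\<lambda>x. 1 - ?P x)"
    proof (rule blip_diff_const, rule BL_prod)
      fix k assume "k \<in> {..<r}"
      then have "t k + b k \<le> t r" using mono_t[of "Suc k" r] by (simp add: t_b)
      then show "BL (t r) (\<lambda>x. 1 - \<phi> k (\<lambda>i. x (t k + i)))"
        by (intro blip_diff_const BL_mono[OF BL_shift[OF BL\<phi>]])
    qed auto
    have "1 - (\<Prod>k<r. 1 - Er (\<phi> k)) = Er (\<lambda>x. 1 - ?P x)"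
      by (rule Er_block_product[where n = t and b = b, symmetric]) (auto simp: t_b BL\<phi> \<phi>01)
    also have "\<dots> \<le> V (?A \<union> ?U)"
    proof (rule V_ge_Er[OF BLP])
      show "?A \<union> ?U \<in> sets M" by (intro sets.Un sets_exceed sets_exceed_above)
      fix \<omega> assume \<omega>: "\<omega> \<in> space M"
      have P0: "0 \<le> ?P (path \<omega>)" using \<phi>01(2) by (intro prod_nonneg) auto
      show "1 - ?P (path \<omega>) \<le> indicator (?A \<union> ?U) \<omega>"
      proof (cases "\<exists>k<r. 0 < \<phi> k (\<lambda>i. path \<omega> (t k + i))")
        case True
        then obtain k where k: "k < r" "0 < \<phi> k (\<lambda>i. path \<omega> (t k + i))" by blast
        have range: "t k \<in> {n..K}" "t (Suc k) \<in> {n..K}"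
          using n_less mono_t[of k r] mono_t[of "Suc k" r] k(1) by (auto simp: K_def)
        have "\<omega> \<in> ?A \<union> ?U"
        proof (cases "\<omega> \<in> ?U")
          case False
          then have "\<bar>partial_sum Y (t k) \<omega>\<bar> \<le> 2 * \<sigma> * lil_norm (t k)"
            using range(1) \<omega> by force
          from block[OF k(2) this] range(2) \<omega> show ?thesis by blast
        qed blast
        then show ?thesis using P0 by simp
      next
        case False
        then have "\<phi> k (\<lambda>i. path \<omega> (t k + i)) = 0" if "k < r" for k
          using \<phi>01(1)[of k] that by (meson antisym not_less)
        then have "?P (path \<omega>) = 1" by (intro prod.neutral) auto
        then show ?thesis by simp
      qed
    qed
    also have "\<dots> \<le> V ?A + V ?U" by (intro V_Un sets_exceed sets_exceed_above)
    also have "V ?U \<le> \<epsilon> / 2" using nx(1) by (rule n0)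
    finally have "1 - (\<Prod>k<r. 1 - Er (\<phi> k)) \<le> V ?A + \<epsilon> / 2" by simp
    moreover have "(\<Prod>k<r. 1 - Er (\<phi> k)) \<le> \<epsilon> / 2"
    proof -
      have "(\<Prod>k<r. 1 - Er (\<phi> k)) \<le> exp (- (\<Sum>k<r. Er (\<phi> k)))"
        using Er_bounds(2)[OF BL\<phi> \<phi>01(2)] by (intro prod_1_minus_le_exp)
      also have "\<dots> \<le> exp (- ln (2 / \<epsilon>))" using r by simp
      also have "\<dots> = \<epsilon> / 2" using \<epsilon> by (simp add: exp_minus)
      finally show ?thesis .
    qed
    ultimately have "1 - \<epsilon> \<le> V ?A" by simp
    moreover have "n \<le> K" unfolding K_def by (rule n_less)
    ultimately show ?thesis by blast
  qed
  then show ?thesis by blast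
qed

end

section \<open>Truncated expectations and the law of the iterated logarithm\<close>

lemma min_square_trunc: "0 \<le> c \<Longrightarrow> min (x\<^sup>2) c = (trunc (sqrt c) x)\<^sup>2"
proof -
  assume c: "0 \<le> c"
  show ?thesis
  proof (cases "\<bar>x\<bar> \<le> sqrt c")
    case True
    then have "\<bar>x\<bar>\<^sup>2 \<le> (sqrt c)\<^sup>2" by (intro power_mono) auto
    then show ?thesis using True c by (simp add: trunc_eq)
  next
    case False
    moreover have "0 \<le> sqrt c" using c by simp
    ultimately have "\<bar>trunc (sqrt c) x\<bar> = sqrt c"
      unfolding trunc_def by (auto simp: max_def min_def)
    then have "(trunc (sqrt c) x)\<^sup>2 = c" using c by (metis power2_abs real_sqrt_pow2)
    moreover have "(sqrt c)\<^sup>2 \<le> \<bar>x\<bar>\<^sup>2" using False c by (intro power_mono) auto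
    ultimately show ?thesis using c by simp
  qed
qed

lemma SUP_ge_iff_finite:
  fixes f :: "nat \<Rightarrow> real"
  assumes "n \<le> K"
  shows "c \<le> (SUP m\<in>{n..K}. f m) \<longleftrightarrow> (\<exists>m\<in>{n..K}. c \<le> f m)"
    "(SUP m\<in>{n..K}. f m) \<le> c \<longleftrightarrow> (\<forall>m\<in>{n..K}. f m \<le> c)"
  using assms by (simp_all add: cSup_eq_Max Max_ge_iff Max_le_iff)

context lil_setting
begin

lemma E_trunc: "E (\<lambda>\<omega>. max (- c) (min (Y 1 \<omega>) c)) = ereal (N (trunc c))"
  using E_LB_Y[OF LB_trunc, of 1 c] by (simp add: trunc_def)

lemma E_trunc_neg: "0 \<le> c \<Longrightarrow> E (\<lambda>\<omega>. max (- c) (min (- Y 1 \<omega>) c)) = ereal (N (\<lambda>x. - trunc c x))"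
proof -
  assume "0 \<le> c"
  then have "max (- c) (min (- x) c) = - trunc c x" for x
    by (auto simp: trunc_def)
  then show ?thesis
    using E_LB_Y[OF blip_uminus[OF LB_trunc], of 1 c] by simp
qed

lemma E_min_square: "0 \<le> c \<Longrightarrow> E (\<lambda>\<omega>. min ((Y 1 \<omega>)\<^sup>2) c) = ereal (N (\<lambda>x. (trunc (sqrt c) x)\<^sup>2))"
  using E_LB_Y[OF blip_power[OF LB_trunc], of 1 "sqrt c" 2] by (simp add: min_square_trunc)

lemma breve_mean_zero: "has_breve_expectation E (Y 1) 0 \<longleftrightarrow> mean_zero 1"
  unfolding has_breve_expectation_def mean_zero_def E_trunc zero_ereal_def by simp

lemma breve_neg_mean_zero: "has_breve_expectation E (\<lambda>\<omega>. - Y 1 \<omega>) 0 \<longleftrightarrow> mean_zero (- 1)"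
proof -
  have "has_breve_expectation E (\<lambda>\<omega>. - Y 1 \<omega>) 0 \<longleftrightarrow> ((\<lambda>c. ereal (N (\<lambda>x. - trunc c x))) \<longlongrightarrow> ereal 0) at_top"
    unfolding has_breve_expectation_def zero_ereal_def
  proof (rule tendsto_cong)
    show "\<forall>\<^sub>F c in at_top. E (\<lambda>\<omega>. max (- c) (min (- Y 1 \<omega>) c)) = ereal (N (\<lambda>x. - trunc c x))"
      using eventually_ge_at_top[of 0] by eventually_elim (rule E_trunc_neg)
  qed
  then show ?thesis by (simp add: mean_zero_def)
qed

definition sq_trunc :: "real \<Rightarrow> real" where
  "sq_trunc c = N (\<lambda>x. (trunc (sqrt c) x)\<^sup>2)"

lemma sq_trunc_mono: "0 \<le> c \<Longrightarrow> c \<le> c' \<Longrightarrow> sq_trunc c \<le> sq_trunc c'"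
  unfolding sq_trunc_def
proof (intro N_mono blip_power LB_trunc)
  fix x assume "0 \<le> c" "c \<le> c'"
  then show "(trunc (sqrt c) x)\<^sup>2 \<le> (trunc (sqrt c') x)\<^sup>2"
    by (subst (1 2) min_square_trunc[symmetric]) auto
qed

text \<open>Monotonicity in c identifies the limit with the supremum, finite or infinite.\<close>

lemma sq_trunc_limit:
  "((\<lambda>c. E (\<lambda>\<omega>. min ((Y 1 \<omega>)\<^sup>2) c)) \<longlongrightarrow> (SUP c\<in>{0..}. ereal (sq_trunc c))) at_top"
proof -
  let ?S = "SUP c\<in>{0..}. ereal (sq_trunc c)"
  have "((\<lambda>c. ereal (sq_trunc c)) \<longlongrightarrow> ?S) at_top"
  proof (rule order_tendstoI)
    fix a assume "a < ?S"
    then obtain c where c: "0 \<le> c" "a < ereal (sq_trunc c)" by (auto simp: less_SUP_iff)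
    show "\<forall>\<^sub>F c in at_top. a < ereal (sq_trunc c)"
      using eventually_ge_at_top[of c]
    proof eventually_elim
      case (elim c')
      then have "ereal (sq_trunc c) \<le> ereal (sq_trunc c')" using c(1) by (simp add: sq_trunc_mono)
      with c(2) show ?case by (rule less_le_trans)
    qed
  next
    fix a assume a: "?S < a"
    show "\<forall>\<^sub>F c in at_top. ereal (sq_trunc c) < a"
      using eventually_ge_at_top[of 0]
    proof eventually_elim
      case (elim c)
      then have "ereal (sq_trunc c) \<le> ?S" by (intro SUP_upper) auto
      then show ?case using a by (rule le_less_trans)
    qed
  qed
  moreover have "\<forall>\<^sub>F c in at_top. E (\<lambda>\<omega>. min ((Y 1 \<omega>)\<^sup>2) c) = ereal (sq_trunc c)"
    using eventually_ge_at_top[of 0] unfolding sq_trunc_def by eventually_elim (rule E_min_square)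
  ultimately show ?thesis by (simp add: tendsto_cong)
qed

lemma breve_square: "breve_expectation E (\<lambda>\<omega>. (Y 1 \<omega>)\<^sup>2) = (SUP c\<in>{0..}. ereal (sq_trunc c))"
proof -
  have "\<forall>\<^sub>F c in at_top. E (\<lambda>\<omega>. max (- c) (min ((Y 1 \<omega>)\<^sup>2) c)) = E (\<lambda>\<omega>. min ((Y 1 \<omega>)\<^sup>2) c)"
    using eventually_ge_at_top[of 0]
  proof eventually_elim
    case (elim c)
    then have "max (- c) (min (x\<^sup>2) c) = min (x\<^sup>2) c" for x :: real
      using zero_le_power2[of x] by (intro max_absorb2) linarith
    then show ?case by simp
  qed
  then have lim: "has_breve_expectation E (\<lambda>\<omega>. (Y 1 \<omega>)\<^sup>2) (SUP c\<in>{0..}. ereal (sq_trunc c))"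
    unfolding has_breve_expectation_def using sq_trunc_limit by (simp add: tendsto_cong)
  show ?thesis
    unfolding breve_expectation_def
  proof (rule the_equality)
    show "has_breve_expectation E (\<lambda>\<omega>. (Y 1 \<omega>)\<^sup>2) (SUP c\<in>{0..}. ereal (sq_trunc c))" by (rule lim)
    fix l assume "has_breve_expectation E (\<lambda>\<omega>. (Y 1 \<omega>)\<^sup>2) l"
    then show "l = (SUP c\<in>{0..}. ereal (sq_trunc c))"
      using lim unfolding has_breve_expectation_def
      by (intro tendsto_unique[OF trivial_limit_at_top_linorder])
  qed
qed

lemma second_moment_SUP:
  assumes "(SUP c\<in>{0..}. ereal (sq_trunc c)) = ereal v"
  shows "second_moment v" "0 \<le> v"
proof -
  have le: "sq_trunc c \<le> v" if "0 \<le> c" for c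
  proof -
    have "ereal (sq_trunc c) \<le> ereal v"
      unfolding assms[symmetric] using that by (intro SUP_upper) auto
    then show ?thesis by simp
  qed
  have le_v: "second_moment_le v"
    unfolding second_moment_le_def
  proof (intro allI impI)
    fix w :: real assume "0 \<le> w"
    then show "N (\<lambda>x. (trunc w x)\<^sup>2) \<le> v" using le[of "w\<^sup>2"] by (simp add: sq_trunc_def)
  qed
  then show "0 \<le> v" by (rule second_moment_nonneg)
  show "second_moment v"
    unfolding second_moment_def
  proof (intro conjI le_v allI impI)
    fix \<delta> :: real assume "0 < \<delta>"
    then have "ereal (v - \<delta>) < (SUP c\<in>{0..}. ereal (sq_trunc c))" unfolding assms by simp
    then obtain c where c: "0 \<le> c" "v - \<delta> < sq_trunc c" by (auto simp: less_SUP_iff)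
    then have "v - \<delta> \<le> sq_trunc (max c 1)" using sq_trunc_mono[of c "max c 1"] by simp
    then show "\<exists>w>0. v - \<delta> \<le> N (\<lambda>x. (trunc w x)\<^sup>2)"
      unfolding sq_trunc_def by (intro exI[of _ "sqrt (max c 1)"]) auto
  qed
qed

text \<open>For positive \<sigma> the level may be raised to a positive one. For \<sigma> = 0 the
  level is negative, and the upper half at -\<sigma>1 already keeps the sum above it at the single
  time n.\<close>

lemma attain_below:
  assumes fin: choquet_fin and v: "second_moment (\<sigma>\<^sup>2)" and mz: "mean_zero 1" "mean_zero (- 1)"
    and \<sigma>: "0 \<le> \<sigma>" "\<sigma>1 < \<sigma>" and \<epsilon>: "0 < \<epsilon>"
  shows "\<exists>n1. \<forall>n\<ge>n1. \<exists>K\<ge>n. 1 - \<epsilon> \<le> V {\<omega> \<in> space M. \<exists>m\<in>{n..K}. \<sigma>1 * lil_norm m \<le> partial_sum Y m \<omega>}"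
proof (cases "\<sigma> = 0")
  case False
  define s where "s = max \<sigma>1 (\<sigma> / 2)"
  have s: "0 < s" "s < \<sigma>" using False \<sigma> by (auto simp: s_def less_max_iff_disj)
  obtain n1 where n1: "\<And>n. n \<ge> n1 \<Longrightarrow> \<exists>K\<ge>n. 1 - \<epsilon> \<le> V {\<omega> \<in> space M. \<exists>m\<in>{n..K}. s * lil_norm m \<le> partial_sum Y m \<omega>}"
    using lower_V[OF fin v mz s \<epsilon>] by blast
  have le: "V {\<omega> \<in> space M. \<exists>m\<in>{n..K}. s * lil_norm m \<le> partial_sum Y m \<omega>}
      \<le> V {\<omega> \<in> space M. \<exists>m\<in>{n..K}. \<sigma>1 * lil_norm m \<le> partial_sum Y m \<omega>}" for n K
  proof (rule V_mono[OF sets_exceed_above sets_exceed_above], rule subsetI)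
    fix \<omega> assume "\<omega> \<in> {\<omega> \<in> space M. \<exists>m\<in>{n..K}. s * lil_norm m \<le> partial_sum Y m \<omega>}"
    then obtain m where m: "\<omega> \<in> space M" "m \<in> {n..K}" "s * lil_norm m \<le> partial_sum Y m \<omega>" by blast
    have "\<sigma>1 * lil_norm m \<le> s * lil_norm m" by (intro mult_right_mono lil_norm_nonneg) (simp add: s_def)
    then have "\<sigma>1 * lil_norm m \<le> partial_sum Y m \<omega>" using m(3) by (rule order_trans)
    with m show "\<omega> \<in> {\<omega> \<in> space M. \<exists>m\<in>{n..K}. \<sigma>1 * lil_norm m \<le> partial_sum Y m \<omega>}" by blast
  qed
  show ?thesis
  proof (rule exI[of _ n1], intro allI impI)
    fix n assume "n1 \<le> n"
    then obtain K where "K \<ge> n" "1 - \<epsilon> \<le> V {\<omega> \<in> space M. \<exists>m\<in>{n..K}. s * lil_norm m \<le> partial_sum Y m \<omega>}"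
      using n1 by blast
    then show "\<exists>K\<ge>n. 1 - \<epsilon> \<le> V {\<omega> \<in> space M. \<exists>m\<in>{n..K}. \<sigma>1 * lil_norm m \<le> partial_sum Y m \<omega>}"
      using le[of n K] by (intro exI[of _ K]) auto
  qed
next
  case True
  have "\<sigma>\<^sup>2 < (- \<sigma>1)\<^sup>2" using True \<sigma> by simp
  then obtain n1 where n1: "\<And>n K. n \<ge> n1 \<Longrightarrow> V {\<omega> \<in> space M. \<exists>m\<in>{n..K}. - \<sigma>1 * lil_norm m \<le> \<bar>partial_sum Y m \<omega>\<bar>} \<le> \<epsilon>"
    using upper_V[OF fin _ mz _ _ \<epsilon>, of "\<sigma>\<^sup>2" "- \<sigma>1"] v True \<sigma> by (auto simp: second_moment_def)
  show ?thesis
  proof (rule exI[of _ n1], intro allI impI)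
    fix n assume n: "n1 \<le> n"
    let ?A = "{\<omega> \<in> space M. \<exists>m\<in>{n..n}. \<sigma>1 * lil_norm m \<le> partial_sum Y m \<omega>}"
    let ?U = "{\<omega> \<in> space M. \<exists>m\<in>{n..n}. - \<sigma>1 * lil_norm m \<le> \<bar>partial_sum Y m \<omega>\<bar>}"
    have "space M \<subseteq> ?A \<union> ?U" by auto
    then have "V (space M) \<le> V (?A \<union> ?U)" by (intro V_mono sets.Un sets_exceed sets_exceed_above) auto
    also have "\<dots> \<le> V ?A + V ?U" by (intro V_Un sets_exceed sets_exceed_above)
    also have "V ?U \<le> \<epsilon>" by (rule n1[OF n])
    finally have "1 - \<epsilon> \<le> V ?A" by (simp add: V_space)
    then show "\<exists>K\<ge>n. 1 - \<epsilon> \<le> V {\<omega> \<in> space M. \<exists>m\<in>{n..K}. \<sigma>1 * lil_norm m \<le> partial_sum Y m \<omega>}"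
      by (intro exI[of _ n]) simp
  qed
qed

lemma lil_capacity_limit:
  assumes fin: choquet_fin and v: "second_moment (\<sigma>\<^sup>2)" and mz: "mean_zero 1" "mean_zero (- 1)"
    and \<sigma>: "0 \<le> \<sigma>" "\<sigma>1 < \<sigma>" "\<sigma> < \<sigma>2"
  shows "(\<lambda>n. SUP K\<in>{n..}. V {\<omega> \<in> space M.
      \<sigma>1 \<le> (SUP m\<in>{n..K}. partial_sum Y m \<omega> / lil_norm m) \<and>
      (SUP m\<in>{n..K}. partial_sum Y m \<omega> / lil_norm m) \<le> \<sigma>2}) \<longlonglongrightarrow> 1"
    (is "(\<lambda>n. SUP K\<in>{n..}. V (?B n K)) \<longlonglongrightarrow> 1")
proof (rule LIMSEQ_I)
  fix \<epsilon> :: real assume "0 < \<epsilon>"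
  then have \<epsilon>: "0 < \<epsilon> / 3" by simp
  have vle: "second_moment_le (\<sigma>\<^sup>2)" using v by (simp add: second_moment_def)
  have "\<sigma>\<^sup>2 < \<sigma>2\<^sup>2" "0 < \<sigma>2" using \<sigma> by (auto intro: power_strict_mono)
  then obtain n1 where n1: "\<And>n K. n \<ge> n1 \<Longrightarrow> V {\<omega> \<in> space M. \<exists>m\<in>{n..K}. \<sigma>2 * lil_norm m \<le> \<bar>partial_sum Y m \<omega>\<bar>} \<le> \<epsilon> / 3"
    using upper_V[OF fin vle mz _ _ \<epsilon>, of \<sigma>2] by blast
  obtain n2 where n2: "\<And>n. n \<ge> n2 \<Longrightarrow> \<exists>K\<ge>n. 1 - \<epsilon> / 3 \<le> V {\<omega> \<in> space M. \<exists>m\<in>{n..K}. \<sigma>1 * lil_norm m \<le> partial_sum Y m \<omega>}"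
    using attain_below[OF fin v mz \<sigma>(1,2) \<epsilon>] by blast
  have B_eq: "?B n K = {\<omega> \<in> space M. (\<exists>m\<in>{n..K}. \<sigma>1 \<le> partial_sum Y m \<omega> / lil_norm m) \<and>
      (\<forall>m\<in>{n..K}. partial_sum Y m \<omega> / lil_norm m \<le> \<sigma>2)}" if "n \<le> K" for n K
    using SUP_ge_iff_finite[OF that] by simp
  have B_sets: "?B n K \<in> sets M" if "n \<le> K" for n K
    unfolding B_eq[OF that] partial_sum_path by measurable
  have "norm ((SUP K\<in>{n..}. V (?B n K)) - 1) < \<epsilon>" if n: "n \<ge> max 1 (max n1 n2)" for n
  proof -
    obtain K where K: "K \<ge> n" "1 - \<epsilon> / 3 \<le> V {\<omega> \<in> space M. \<exists>m\<in>{n..K}. \<sigma>1 * lil_norm m \<le> partial_sum Y m \<omega>}"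
      using n2[of n] n by auto
    let ?A = "{\<omega> \<in> space M. \<exists>m\<in>{n..K}. \<sigma>1 * lil_norm m \<le> partial_sum Y m \<omega>}"
    let ?U = "{\<omega> \<in> space M. \<exists>m\<in>{n..K}. \<sigma>2 * lil_norm m \<le> \<bar>partial_sum Y m \<omega>\<bar>}"
    \<comment> \<open>Reaching \<sigma>1 either happens while staying below \<sigma>2, or falls into
      the event excluded by the upper half.\<close>
    have sub: "?A \<subseteq> ?B n K \<union> ?U"
    proof
      fix \<omega> assume \<omega>: "\<omega> \<in> ?A"
      then obtain m where m: "m \<in> {n..K}" "\<sigma>1 * lil_norm m \<le> partial_sum Y m \<omega>" by blast
      have pos: "0 < lil_norm j" if "j \<in> {n..K}" for j using that n by (intro lil_norm_pos) auto
      have "\<sigma>1 \<le> partial_sum Y m \<omega> / lil_norm m" using m pos[OF m(1)] by (simp add: field_simps)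
      moreover have "partial_sum Y j \<omega> / lil_norm j \<le> \<sigma>2" if "\<omega> \<notin> ?U" "j \<in> {n..K}" for j
      proof -
        have "\<bar>partial_sum Y j \<omega>\<bar> < \<sigma>2 * lil_norm j" using that \<omega> by force
        then show ?thesis using pos[OF that(2)] by (simp add: pos_divide_le_eq abs_less_iff)
      qed
      ultimately show "\<omega> \<in> ?B n K \<union> ?U" unfolding B_eq[OF K(1)] using m(1) \<omega> by blast
    qed
    have "V ?A \<le> V (?B n K \<union> ?U)"
      by (intro V_mono sub sets.Un sets_exceed sets_exceed_above B_sets K(1))
    also have "\<dots> \<le> V (?B n K) + V ?U" by (intro V_Un sets_exceed B_sets K(1))
    also have "V ?U \<le> \<epsilon> / 3" using n by (intro n1) auto
    finally have "1 - 2 * (\<epsilon> / 3) \<le> V (?B n K)" using K(2) by simp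
    also have "V (?B n K) \<le> (SUP K\<in>{n..}. V (?B n K))"
    proof (rule cSUP_upper)
      show "bdd_above ((\<lambda>K. V (?B n K)) ` {n..})"
        by (intro bdd_aboveI2[where M = 1] V_le_1 B_sets) auto
    qed (use K in simp)
    finally have "1 - 2 * (\<epsilon> / 3) \<le> (SUP K\<in>{n..}. V (?B n K))" .
    moreover have "(SUP K\<in>{n..}. V (?B n K)) \<le> 1"
      by (intro cSUP_least V_le_1 B_sets) auto
    ultimately show ?thesis using \<open>0 < \<epsilon>\<close> by (simp add: abs_less_iff)
  qed
  then show "\<exists>n0. \<forall>n\<ge>n0. norm ((SUP K\<in>{n..}. V (?B n K)) - 1) < \<epsilon>" by blast
qed

text \<open>The events grow with the horizon, so each is bounded by the limit; the level is raised
  to at least 1 to be positive.\<close>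

lemma lil_bounded_from_limit:
  assumes "1 \<le> n0" "l < 1"
    and lim: "(\<lambda>K. V {\<omega> \<in> space M. (SUP m\<in>{n0..K}. \<bar>partial_sum Y m \<omega>\<bar> / lil_norm m) \<ge> C}) \<longlonglongrightarrow> l"
  shows "lil_bounded (max 1 C) n0 l"
  unfolding lil_bounded_def
proof (intro conjI allI impI)
  let ?S = "\<lambda>K. {\<omega> \<in> space M. (SUP m\<in>{n0..K}. \<bar>partial_sum Y m \<omega>\<bar> / lil_norm m) \<ge> C}"
  let ?T = "\<lambda>K. {\<omega> \<in> space M. \<exists>m\<in>{n0..K}. C \<le> \<bar>partial_sum Y m \<omega>\<bar> / lil_norm m}"
  have eq: "?S K = ?T K" if "n0 \<le> K" for K
    using SUP_ge_iff_finite(1)[OF that] by simp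
  have sets_T: "?T K \<in> sets M" for K
    unfolding partial_sum_path by measurable
  fix K assume K: "n0 \<le> K"
  let ?A = "{\<omega> \<in> space M. \<exists>m\<in>{n0..K}. max 1 C * lil_norm m \<le> \<bar>partial_sum Y m \<omega>\<bar>}"
  have sub: "?A \<subseteq> ?T K'" if "K \<le> K'" for K'
  proof
    fix \<omega> assume "\<omega> \<in> ?A"
    then obtain m where m: "\<omega> \<in> space M" "m \<in> {n0..K}" "max 1 C * lil_norm m \<le> \<bar>partial_sum Y m \<omega>\<bar>" by blast
    have "0 < lil_norm m" using m(2) assms(1) by (intro lil_norm_pos) auto
    moreover have "C * lil_norm m \<le> max 1 C * lil_norm m" by (intro mult_right_mono lil_norm_nonneg) simp
    then have "C * lil_norm m \<le> \<bar>partial_sum Y m \<omega>\<bar>" using m(3) by (rule order_trans)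
    ultimately have "C \<le> \<bar>partial_sum Y m \<omega>\<bar> / lil_norm m" by (simp add: pos_le_divide_eq)
    with m that show "\<omega> \<in> ?T K'" by (auto intro!: bexI[of _ m])
  qed
  show "V ?A \<le> l"
  proof (rule LIMSEQ_le_const[OF lim], intro exI[of _ K] allI impI)
    fix K' assume K': "K \<le> K'"
    then have "?S K' = ?T K'" using K by (intro eq) simp
    then show "V ?A \<le> V (?S K')" using V_mono[OF sets_exceed sets_T sub[OF K']] by simp
  qed
qed (use assms in auto)

lemma mean_zero_limits_if_bounded:
  assumes "lil_bounded C n0 l" shows "mean_zero 1" "mean_zero (- 1)"
proof -
  have small: "\<epsilon> * ll y / y \<le> \<epsilon>" if "y \<ge> 1" "\<epsilon> > 0" for y \<epsilon> :: real
    using ll_le_self[OF that(1)] that by (simp add: field_simps)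
  have ev: "\<forall>\<^sub>F y in at_top. \<bar>N (trunc y)\<bar> < \<epsilon> \<and> \<bar>N (\<lambda>x. - trunc y x)\<bar> < \<epsilon>" if \<epsilon>: "\<epsilon> > 0" for \<epsilon>
  proof -
    obtain y0 where y0: "\<And>y. y \<ge> y0 \<Longrightarrow> \<bar>N (trunc y)\<bar> \<le> \<epsilon> / 2 * ll y / y \<and> \<bar>N (\<lambda>x. - trunc y x)\<bar> \<le> \<epsilon> / 2 * ll y / y"
      using mean_zero_if_bounded[OF assms, of "\<epsilon> / 2"] \<epsilon> by auto
    show ?thesis
      using eventually_ge_at_top[of "max 1 y0"]
    proof eventually_elim
      case (elim y)
      then have "\<epsilon> / 2 * ll y / y \<le> \<epsilon> / 2" using \<epsilon> by (intro small) auto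
      moreover have "y0 \<le> y" using elim by simp
      ultimately show ?case using y0[of y] \<epsilon> by linarith
    qed
  qed
  show "mean_zero 1"
    unfolding mean_zero_def
  proof (rule tendstoI)
    fix e :: real assume "0 < e"
    from ev[OF this] show "\<forall>\<^sub>F y in at_top. dist (N (\<lambda>x. 1 * trunc y x)) 0 < e"
      by eventually_elim simp
  qed
  show "mean_zero (- 1)"
    unfolding mean_zero_def
  proof (rule tendstoI)
    fix e :: real assume "0 < e"
    from ev[OF this] show "\<forall>\<^sub>F y in at_top. dist (N (\<lambda>x. - 1 * trunc y x)) 0 < e"
      by eventually_elim simp
  qed
qed

end

theorem theorem5p4:
  fixes M :: "'a measure" and H :: "('a \<Rightarrow> real) set" and E :: "('a \<Rightarrow> real) \<Rightarrow> ereal"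
    and V :: "'a set \<Rightarrow> real" and Y :: "nat \<Rightarrow> 'a \<Rightarrow> real"
    and \<sigma>sq \<sigma> :: ereal
  assumes "sublinear_expectation_space M H E"
    and "\<And>n. n \<ge> 1 \<Longrightarrow> Y n \<in> H"
    and "independent_seq H E Y"
    and "identically_distributed_seq E Y"
    and "subadditive_capacity M V"
    and "property_C M H E V"
    and "\<sigma>sq = breve_expectation E (\<lambda>\<omega>. (Y 1 \<omega>)\<^sup>2)"
    and "\<sigma> = ereal_sqrt \<sigma>sq"
  shows
    "(choquet_integral M V (\<lambda>\<omega>. (Y 1 \<omega>)\<^sup>2 / lg (lg \<bar>Y 1 \<omega>\<bar>)) < \<infinity> \<and>
      has_breve_expectation E (Y 1) 0 \<and> has_breve_expectation E (\<lambda>\<omega>. - Y 1 \<omega>) 0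
      \<longrightarrow>
      V_hat_star M H E
        {\<omega> \<in> space M. limsup (\<lambda>n. ereal (\<bar>partial_sum Y n \<omega>\<bar> / lil_norm n)) > \<sigma>} = 0 \<and>
      (\<forall>\<sigma>\<^sub>1 \<sigma>\<^sub>2 :: real. ereal \<sigma>\<^sub>1 < \<sigma> \<and> \<sigma> < ereal \<sigma>\<^sub>2 \<longrightarrow>
        (\<lambda>n. SUP N\<in>{n..}. V {\<omega> \<in> space M.
            \<sigma>\<^sub>1 \<le> (SUP m\<in>{n..N}. partial_sum Y m \<omega> / lil_norm m) \<and>
            (SUP m\<in>{n..N}. partial_sum Y m \<omega> / lil_norm m) \<le> \<sigma>\<^sub>2}) \<longlonglongrightarrow> 1))
     \<and>
     ((\<exists>n\<^sub>0\<ge>1. \<exists>K::real. \<forall>n\<ge>n\<^sub>0. \<exists>l<1.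
        (\<lambda>N. V {\<omega> \<in> space M. (SUP m\<in>{n..N}. \<bar>partial_sum Y m \<omega>\<bar> / lil_norm m) \<ge> K}) \<longlonglongrightarrow> l)
      \<longrightarrow>
      choquet_integral M V (\<lambda>\<omega>. (Y 1 \<omega>)\<^sup>2 / lg (lg \<bar>Y 1 \<omega>\<bar>)) < \<infinity> \<and>
      has_breve_expectation E (Y 1) 0 \<and> has_breve_expectation E (\<lambda>\<omega>. - Y 1 \<omega>) 0 \<and>
      ((\<lambda>c::real. E (\<lambda>\<omega>. min ((Y 1 \<omega>)\<^sup>2) c)) \<longlongrightarrow> \<sigma>sq) at_top \<and> \<sigma>sq < \<infinity>)"
proof -
  interpret sublinear_expectation_space M H E by (rule assms(1))
  interpret lil_setting M H E Y V
    by (intro lil_setting.intro iid_seq.intro iid_seq_axioms.intro lil_setting_axioms.intro assms)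
  have \<sigma>sq: "\<sigma>sq = (SUP c\<in>{0..}. ereal (sq_trunc c))"
    unfolding assms(7) by (rule breve_square)
  have \<sigma>sq_nonneg: "0 \<le> \<sigma>sq"
  proof -
    have "0 \<le> sq_trunc 0" unfolding sq_trunc_def by (intro N_bounds blip_power LB_trunc) simp
    then show ?thesis unfolding \<sigma>sq by (intro SUP_upper2[of 0]) auto
  qed
  show ?thesis
    unfolding choquet_fin_iff breve_mean_zero breve_neg_mean_zero
  proof (intro conjI impI)
    assume "choquet_fin \<and> mean_zero 1 \<and> mean_zero (- 1)"
    then have hyp: choquet_fin "mean_zero 1" "mean_zero (- 1)" by auto
    show "V_hat_star M H E
        {\<omega> \<in> space M. limsup (\<lambda>n. ereal (\<bar>partial_sum Y n \<omega>\<bar> / lil_norm n)) > \<sigma>} = 0"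
    proof (cases "\<sigma>sq = \<infinity>")
      case True
      \<comment> \<open>With infinite variance the event is empty, as nothing exceeds
        infinity.\<close>
      then show ?thesis by (simp add: assms(8) ereal_sqrt_def V_hat_star_empty)
    next
      case False
      then obtain v where v: "\<sigma>sq = ereal v" using \<sigma>sq_nonneg by (cases \<sigma>sq) auto
      have sm: "second_moment v" "0 \<le> v" using second_moment_SUP \<sigma>sq v by auto
      have "\<sigma> = ereal (sqrt v)" by (simp add: assms(8) ereal_sqrt_def v)
      moreover have "v \<le> (sqrt v)\<^sup>2" using sm(2) by simp
      moreover have "second_moment_le v" using sm(1) by (simp add: second_moment_def)
      ultimately show ?thesis
        using V_hat_star_limsup[OF hyp(1) _ hyp(2,3), of v "sqrt v"] sm(2) by simp
    qed
    show "\<forall>\<sigma>\<^sub>1 \<sigma>\<^sub>2 :: real. ereal \<sigma>\<^sub>1 < \<sigma> \<and> \<sigma> < ereal \<sigma>\<^sub>2 \<longrightarrow>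
        (\<lambda>n. SUP N\<in>{n..}. V {\<omega> \<in> space M.
            \<sigma>\<^sub>1 \<le> (SUP m\<in>{n..N}. partial_sum Y m \<omega> / lil_norm m) \<and>
            (SUP m\<in>{n..N}. partial_sum Y m \<omega> / lil_norm m) \<le> \<sigma>\<^sub>2}) \<longlonglongrightarrow> 1"
    proof (intro allI impI)
      fix \<sigma>\<^sub>1 \<sigma>\<^sub>2 :: real assume lt: "ereal \<sigma>\<^sub>1 < \<sigma> \<and> \<sigma> < ereal \<sigma>\<^sub>2"
      \<comment> \<open>A finite level above \<sigma> exists, so here the variance is
        finite.\<close>
      then have "\<sigma>sq \<noteq> \<infinity>" by (auto simp: assms(8) ereal_sqrt_def)
      then obtain v where v: "\<sigma>sq = ereal v" using \<sigma>sq_nonneg by (cases \<sigma>sq) auto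
      have sm: "second_moment v" "0 \<le> v" using second_moment_SUP \<sigma>sq v by auto
      have \<sigma>: "\<sigma> = ereal (sqrt v)" by (simp add: assms(8) ereal_sqrt_def v)
      show "(\<lambda>n. SUP N\<in>{n..}. V {\<omega> \<in> space M.
            \<sigma>\<^sub>1 \<le> (SUP m\<in>{n..N}. partial_sum Y m \<omega> / lil_norm m) \<and>
            (SUP m\<in>{n..N}. partial_sum Y m \<omega> / lil_norm m) \<le> \<sigma>\<^sub>2}) \<longlonglongrightarrow> 1"
        using sm lt unfolding \<sigma> by (intro lil_capacity_limit[OF hyp(1) _ hyp(2,3), of "sqrt v"]) auto
    qed
  next
    assume "\<exists>n\<^sub>0\<ge>1. \<exists>K::real. \<forall>n\<ge>n\<^sub>0. \<exists>l<1.
        (\<lambda>N. V {\<omega> \<in> space M. (SUP m\<in>{n..N}. \<bar>partial_sum Y m \<omega>\<bar> / lil_norm m) \<ge> K}) \<longlonglongrightarrow> l"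
    then obtain n0 C l where "1 \<le> n0" "l < 1"
      "(\<lambda>N. V {\<omega> \<in> space M. (SUP m\<in>{n0..N}. \<bar>partial_sum Y m \<omega>\<bar> / lil_norm m) \<ge> C}) \<longlonglongrightarrow> l"
      by blast
    then have bd: "lil_bounded (max 1 C) n0 l" by (rule lil_bounded_from_limit)
    show choquet_fin by (rule choquet_fin_if_bounded[OF bd])
    show "mean_zero 1" "mean_zero (- 1)" by (rule mean_zero_limits_if_bounded[OF bd])+
    show "((\<lambda>c::real. E (\<lambda>\<omega>. min ((Y 1 \<omega>)\<^sup>2) c)) \<longlongrightarrow> \<sigma>sq) at_top"
      unfolding \<sigma>sq by (rule sq_trunc_limit)
    have "\<sigma>sq \<le> ereal (4096 * (max 1 C)\<^sup>2)"
      unfolding \<sigma>sq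
    proof (rule SUP_least)
      fix c :: real assume "c \<in> {0..}"
      then show "ereal (sq_trunc c) \<le> ereal (4096 * (max 1 C)\<^sup>2)"
        unfolding sq_trunc_def using variance_le_if_bounded[OF bd, of "sqrt c"] by simp
    qed
    also have "\<dots> < \<infinity>" by simp
    finally show "\<sigma>sq < \<infinity>" .
  qed
qed

end
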